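(* Let $M$ be a connected one-dimensional manifold (not assumed Hausdorff, nor assumed to have a countable base) that is not homeomorphic to the circle $S^1$. Let $M_{br}$ be the set of branch points of $M$, $\partial M$ its boundary, $\approx$ the chain inseparability relation on $M$, $\Gamma = M/\!\approx$ the quotient space with the quotient topology, and $\pi\colon M\to\Gamma$ the quotient map. Put $M^0 = M_{br}\cup\partial M$ and $M^1 = M\setminus M^0$. Then the following conditions are equivalent: (G1) $M_{br}$ is locally finite in $M$, and every connected component of $M^1$ has a countable base; (G2) $M_{br}$ is nowhere dense in $M$, and $\Gamma$ has a structure of a topological graph compatible with the relation $\approx$ of chain inseparability on $M$. Moreover, under these (equivalent) conditions, $\Gamma$ is Hausdorff, and for every continuous map $f\colon M\to N$ into a Hausdorff space $N$ there exists a unique continuous map $\hat f\colon\Gamma\to N$ such that $f=\hat f\circ\pi$.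
   Context: A one-dimensional manifold is a topological space $M$ (not necessarily Hausdorff or second countable) in which every point has an open neighbourhood homeomorphic to $(-1,1)$ or to $[0,1)$. The boundary $\partial M$ is the set of points corresponding to $0$ under a homeomorphism of an open neighbourhood onto $[0,1)$. Points $x,y$ of a topological space $M$ are inseparable if every neighbourhood of $x$ meets every neighbourhood of $y$. A point $x$ is a branch point if it is inseparable from some point $y\neq x$; $M_{br}$ denotes the set of all branch points. Points $x,y$ are chain inseparable, written $x\approx y$, if there is a finite sequence $x=x_0,x_1,\dots,x_k=y$ in $M$ such that $x_i$ and $x_{i+1}$ are inseparable for all $i=0,\dots,k-1$; this is an equivalence relation. A subset $A\subset M$ is locally finite if every point of $M$ has a neighbourhood whose intersection with $A$ is finite. Topological graph (open one-dimensional CW complex): let $\Lambda$ be a discrete space, $P\subset\{0,1\}\times\Lambda$ any (possibly empty) subset, $E=([0,1]\times\Lambda)\setminus P$, $\partial E=E\cap(\{0,1\}\times\Lambda)$, $\mathrm{Int}(E)=(0,1)\times\Lambda$. Let $\sim$ be an equivalence relation on $\partial E$, extended to $E$ so that each point of $\mathrm{Int}(E)$ is equivalent only to itself. Then $K=E/\!\sim$ with the quotient topology is called a topological graph; the classes of points of $\partial E$ are its vertices, and the images of the intervals $(0,1)\times\{\lambda\}$, $\lambda\in\Lambda$, are its open edges. (Equivalently, $K$ is a one-dimensional CW complex with some, possibly empty, set of vertices removed.) A structure of a topological graph on a space $\Gamma$ is a homeomorphism from some topological graph onto $\Gamma$; vertices and open edges of $\Gamma$ are the images of those of the graph. A structure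 of a topological graph on $\Gamma=M/\!\approx$ is compatible with the relation $\approx$ if $\pi(M^0)$ is the set of vertices of $\Gamma$ and, accordingly, the connected components of $\pi(M^1)$ are the open edges of $\Gamma$. *)

theory Defs
  imports "HOL-Analysis.Analysis"
begin

section \<open>Point-set notions for abstract topologies\<close>

definition has_countable_base :: "'a topology \<Rightarrow> bool" where
  "has_countable_base X \<longleftrightarrow>
     (\<exists>\<B>. countable \<B> \<and> (\<forall>B\<in>\<B>. openin X B) \<and>
          (\<forall>U. openin X U \<longrightarrow> (\<exists>\<C>\<subseteq>\<B>. U = \<Union>\<C>)))"

definition locally_finite_subset :: "'a topology \<Rightarrow> 'a set \<Rightarrow> bool" where
  "locally_finite_subset X A \<longleftrightarrow>
     A \<subseteq> topspace X \<and> (\<forall>x\<in>topspace X. \<exists>U. openin X U \<and> x \<in> U \<and> finite (U \<inter> A))"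

definition nowhere_dense_in :: "'a topology \<Rightarrow> 'a set \<Rightarrow> bool" where
  "nowhere_dense_in X A \<longleftrightarrow> A \<subseteq> topspace X \<and> X interior_of (X closure_of A) = {}"

text \<open>
  For an equivalence relation \<open>R\<close> on \<^term>\<open>topspace X\<close> the points of the quotient are the
  classes, so the quotient of an \<^typ>\<open>'a topology\<close> is an \<^typ>\<open>'a set topology\<close>.
\<close>

definition quotient_proj :: "('a \<times> 'a) set \<Rightarrow> 'a \<Rightarrow> 'a set" where
  "quotient_proj R x = R `` {x}"

definition quotient_topology :: "'a topology \<Rightarrow> ('a \<times> 'a) set \<Rightarrow> 'a set topology" where
  "quotient_topology X R =
     topology (\<lambda>U. U \<subseteq> topspace X // R \<and> openin X {x \<in> topspace X. quotient_proj R x \<in> U})"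

lemma openin_quotient_topology:
  "openin (quotient_topology X R) U \<longleftrightarrow>
     U \<subseteq> topspace X // R \<and> openin X {x \<in> topspace X. quotient_proj R x \<in> U}"
proof -
  have "istopology (\<lambda>U. U \<subseteq> topspace X // R \<and> openin X {x \<in> topspace X. quotient_proj R x \<in> U})"
    unfolding istopology_def
  proof (intro conjI allI impI)
    fix S T
    assume S: "S \<subseteq> topspace X // R \<and> openin X {x \<in> topspace X. quotient_proj R x \<in> S}"
      and T: "T \<subseteq> topspace X // R \<and> openin X {x \<in> topspace X. quotient_proj R x \<in> T}"
    show "S \<inter> T \<subseteq> topspace X // R" using S by blast
    have "{x \<in> topspace X. quotient_proj R x \<in> S \<inter> T} =
        {x \<in> topspace X. quotient_proj R x \<in> S} \<inter> {x \<in> topspace X. quotient_proj R x \<in> T}"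
      by blast
    then show "openin X {x \<in> topspace X. quotient_proj R x \<in> S \<inter> T}"
      using S T by auto
  next
    fix \<K>
    assume K: "\<forall>K\<in>\<K>. K \<subseteq> topspace X // R \<and> openin X {x \<in> topspace X. quotient_proj R x \<in> K}"
    then show "\<Union>\<K> \<subseteq> topspace X // R" by blast
    have "{x \<in> topspace X. quotient_proj R x \<in> \<Union>\<K>} =
        (\<Union>K\<in>\<K>. {x \<in> topspace X. quotient_proj R x \<in> K})"
      by blast
    then show "openin X {x \<in> topspace X. quotient_proj R x \<in> \<Union>\<K>}"
      using K by auto
  qed
  then show ?thesis
    by (simp add: quotient_topology_def topology_inverse')
qed

lemma topspace_quotient_topology: "topspace (quotient_topology X R) = topspace X // R"
proof
  show "topspace (quotient_topology X R) \<subseteq> topspace X // R"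
    using openin_quotient_topology openin_topspace by blast
  have "{x \<in> topspace X. quotient_proj R x \<in> topspace X // R} = topspace X"
    by (auto simp: quotient_proj_def quotientI)
  then have "openin (quotient_topology X R) (topspace X // R)"
    by (simp add: openin_quotient_topology)
  then show "topspace X // R \<subseteq> topspace (quotient_topology X R)"
    by (rule openin_subset)
qed

lemma quotient_map_quotient_proj:
  "quotient_map X (quotient_topology X R) (quotient_proj R)"
  by (auto simp: quotient_map_def topspace_quotient_topology openin_quotient_topology
      quotient_proj_def quotient_def)


section \<open>One-dimensional manifolds\<close>

definition one_manifold :: "'a topology \<Rightarrow> bool" where
  "one_manifold M \<longleftrightarrow>
     (\<forall>x\<in>topspace M. \<exists>U. openin M U \<and> x \<in> U \<and>
        (subtopology M U homeomorphic_space top_of_set {-1<..<1::real} \<or>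
         subtopology M U homeomorphic_space top_of_set {0..<1::real}))"

definition manifold_boundary :: "'a topology \<Rightarrow> 'a set" where
  "manifold_boundary M =
     {x. \<exists>U h. openin M U \<and> x \<in> U \<and>
           homeomorphic_map (subtopology M U) (top_of_set {0..<1::real}) h \<and> h x = 0}"

definition inseparable :: "'a topology \<Rightarrow> 'a \<Rightarrow> 'a \<Rightarrow> bool" where
  "inseparable M x y \<longleftrightarrow>
     x \<in> topspace M \<and> y \<in> topspace M \<and>
     (\<forall>U V. openin M U \<and> x \<in> U \<and> openin M V \<and> y \<in> V \<longrightarrow> U \<inter> V \<noteq> {})"

definition branch_points :: "'a topology \<Rightarrow> 'a set" where
  "branch_points M = {x. \<exists>y. y \<noteq> x \<and> inseparable M x y}"

definition chain_inseparable :: "'a topology \<Rightarrow> ('a \<times> 'a) set" where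
  "chain_inseparable M =
     {(x, y). x \<in> topspace M \<and> y \<in> topspace M \<and> (inseparable M)\<^sup>*\<^sup>* x y}"

lemma equiv_chain_inseparable: "equiv (topspace M) (chain_inseparable M)"
proof (rule equivI)
  have "symp (inseparable M)"
    by (rule sympI) (auto simp: inseparable_def Int_commute)
  then show "sym (chain_inseparable M)"
    by (auto simp: sym_def chain_inseparable_def dest: symp_rtranclp sympD)
qed (auto simp: chain_inseparable_def refl_on_def trans_def)

definition manifold_M0 :: "'a topology \<Rightarrow> 'a set" where
  "manifold_M0 M = branch_points M \<union> manifold_boundary M"

definition manifold_M1 :: "'a topology \<Rightarrow> 'a set" where
  "manifold_M1 M = topspace M - manifold_M0 M"

definition chain_quotient :: "'a topology \<Rightarrow> 'a set topology" where
  "chain_quotient M = quotient_topology M (chain_inseparable M)"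

definition chain_proj :: "'a topology \<Rightarrow> 'a \<Rightarrow> 'a set" where
  "chain_proj M = quotient_proj (chain_inseparable M)"


section \<open>Topological graphs\<close>

text \<open>
  A topological graph is presented by a set \<open>L\<close> indexing the edges, the set \<open>P\<close> of removed
  endpoints, and an equivalence relation \<open>r\<close> on the remaining endpoints.
\<close>

definition graph_cells :: "'l set \<Rightarrow> (real \<times> 'l) set \<Rightarrow> (real \<times> 'l) set" where
  "graph_cells L P = {0..1} \<times> L - P"

definition graph_ends :: "'l set \<Rightarrow> (real \<times> 'l) set \<Rightarrow> (real \<times> 'l) set" where
  "graph_ends L P = graph_cells L P \<inter> {0, 1} \<times> L"

definition graph_data :: "'l set \<Rightarrow> (real \<times> 'l) set \<Rightarrow> ((real \<times> 'l) \<times> (real \<times> 'l)) set \<Rightarrow> bool" where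
  "graph_data L P r \<longleftrightarrow> P \<subseteq> {0, 1} \<times> L \<and> equiv (graph_ends L P) r"

definition graph_rel :: "'l set \<Rightarrow> ((real \<times> 'l) \<times> (real \<times> 'l)) set \<Rightarrow> ((real \<times> 'l) \<times> (real \<times> 'l)) set" where
  "graph_rel L r = r \<union> Id_on ({0<..<1} \<times> L)"

definition topological_graph ::
    "'l set \<Rightarrow> (real \<times> 'l) set \<Rightarrow> ((real \<times> 'l) \<times> (real \<times> 'l)) set \<Rightarrow> (real \<times> 'l) set topology" where
  "topological_graph L P r =
     quotient_topology
       (subtopology (prod_topology euclideanreal (discrete_topology L)) (graph_cells L P))
       (graph_rel L r)"

definition graph_vertices ::
    "'l set \<Rightarrow> (real \<times> 'l) set \<Rightarrow> ((real \<times> 'l) \<times> (real \<times> 'l)) set \<Rightarrow> (real \<times> 'l) set set" where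
  "graph_vertices L P r = quotient_proj (graph_rel L r) ` graph_ends L P"

definition graph_edges ::
    "'l set \<Rightarrow> ((real \<times> 'l) \<times> (real \<times> 'l)) set \<Rightarrow> (real \<times> 'l) set set set" where
  "graph_edges L r = (\<lambda>l. quotient_proj (graph_rel L r) ` ({0<..<1} \<times> {l})) ` L"

definition graph_structure ::
    "'l set \<Rightarrow> (real \<times> 'l) set \<Rightarrow> ((real \<times> 'l) \<times> (real \<times> 'l)) set \<Rightarrow>
     ((real \<times> 'l) set \<Rightarrow> 'b) \<Rightarrow> 'b topology \<Rightarrow> bool" where
  "graph_structure L P r h X \<longleftrightarrow>
     graph_data L P r \<and> homeomorphic_map (topological_graph L P r) X h"

definition compatible_structure ::
    "'a topology \<Rightarrow> 'l set \<Rightarrow> (real \<times> 'l) set \<Rightarrow> ((real \<times> 'l) \<times> (real \<times> 'l)) set \<Rightarrow>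
     ((real \<times> 'l) set \<Rightarrow> 'a set) \<Rightarrow> bool" where
  "compatible_structure M L P r h \<longleftrightarrow>
     graph_structure L P r h (chain_quotient M) \<and>
     h ` graph_vertices L P r = chain_proj M ` manifold_M0 M \<and>
     (\<lambda>e. h ` e) ` graph_edges L r =
       connected_components_of (subtopology (chain_quotient M) (chain_proj M ` manifold_M1 M))"

text \<open>
  The edges are indexed here by a set of points of the quotient space. This loses no generality:
  the open edges are nonempty and pairwise disjoint, so any index set of edges injects into that
  space.
\<close>

definition has_compatible_graph_structure :: "'a topology \<Rightarrow> bool" where
  "has_compatible_graph_structure M \<longleftrightarrow>
     (\<exists>(L :: 'a set set) P r h. compatible_structure M L P r h)"

definition condition_G1 :: "'a topology \<Rightarrow> bool" where
  "condition_G1 M \<longleftrightarrow>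
     locally_finite_subset M (branch_points M) \<and>
     (\<forall>C\<in>connected_components_of (subtopology M (manifold_M1 M)).
        has_countable_base (subtopology M C))"

definition condition_G2 :: "'a topology \<Rightarrow> bool" where
  "condition_G2 M \<longleftrightarrow>
     nowhere_dense_in M (branch_points M) \<and> has_compatible_graph_structure M"

end

theory Submission
  imports Defs
begin

text \<open>
  Points of \<open>M\<^sup>1\<close> are separated from all other points, so under (G1) every component of \<open>M\<^sup>1\<close> is a
  connected Hausdorff one-manifold with a countable base, hence a line: a circle would be compact and
  therefore clopen in \<open>M\<close>. Near a point \<open>x\<close> of \<open>M\<^sup>0\<close> each half arc lies in one such component and runs
  to one of its ends, because a limit inside the component would be inseparable from \<open>x\<close>. Attaching
  to every end its limit in the quotient, when there is one, presents \<open>M/\<approx>\<close> as a graph.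

  Conversely, if \<open>M\<^sup>0\<close> accumulated at \<open>x\<close> along a half arc, then arbitrarily close to \<open>x\<close> the half arc
  would traverse whole components of \<open>M\<^sup>1\<close>, by the same remark about ends. But the set of midpoints of
  all edges is closed in a graph, which keeps a neighbourhood of \<open>x\<close> away from them.
\<close>


section \<open>Arcs and their ends\<close>

text \<open>Limits in M are not unique, so ends are studied through real coordinates. An
  \<open>open_arc\<close> is an open embedding of the whole line: its inverse is continuous on its
  range in any space, and its two ends are just the filters at_bot and at_top. A path g inside an
  arc f becomes the real function \<tau> = \<open>inv f \<circ> g\<close>. If g tends to a point
  inseparable from no point of the arc, compactness drives |\<tau>| to infinity and the intermediate
  value theorem singles out one end (\<open>arc_end\<close>). If this happens at both ends of an
  injective g, then \<tau> is onto (\<open>arc_between_ends\<close>). This traversal principle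
  serves twice: it tames the frontier of a maximal arc in the classification of Hausdorff
  one-manifolds, and it forces a half arc to pass midpoints of edges in the converse. A countable
  base lets a maximal arc be reached in countably many steps; otherwise a component could be a long
  line, which no single arc covers. Nowhere density enters the converse by supplying a point of M^1
  between any two parameters of a half arc, and with it an edge to traverse.\<close>

definition open_arc :: "'a topology \<Rightarrow> (real \<Rightarrow> 'a) \<Rightarrow> bool" where
  "open_arc X f \<longleftrightarrow> continuous_map euclideanreal X f \<and> open_map euclideanreal X f \<and> inj f"

definition locally_line :: "'a topology \<Rightarrow> bool" where
  "locally_line X \<longleftrightarrow> (\<forall>x\<in>topspace X. \<exists>f. open_arc X f \<and> f 0 = x)"

lemma open_arc_in_topspace: "open_arc X f \<Longrightarrow> f t \<in> topspace X"
  using continuous_map_image_subset_topspace[of euclideanreal X f] by (auto simp: open_arc_def)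

lemma open_arc_openin: "open_arc X f \<Longrightarrow> open U \<Longrightarrow> openin X (f ` U)"
  by (auto simp: open_arc_def open_map_def)

text \<open>Invariance of domain makes q open. Bounded q shrink an arc; q that continue a monotone
  coordinate function lengthen a compact piece of one.\<close>

lemma open_arc_compose:
  assumes f: "open_arc X f" and q: "continuous_on UNIV q" "inj (q :: real \<Rightarrow> real)"
  shows "open_arc X (f \<circ> q)"
proof -
  have "open_map euclideanreal euclideanreal q"
    unfolding open_map_def
    using invariance_of_domain[OF continuous_on_subset[OF q(1)]] inj_on_subset[OF q(2)] by simp
  moreover have "continuous_map euclideanreal euclideanreal q"
    using q(1) by simp
  ultimately show ?thesis
    using f q(2) unfolding open_arc_def
    by (meson continuous_map_compose open_map_compose inj_compose)
qed

lemma open_arc_uminus: "open_arc X f \<Longrightarrow> open_arc X (\<lambda>t. f (- t))"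
  using open_arc_compose[of X f uminus] by (simp add: o_def continuous_on_minus)

text \<open>Continuity of the coordinate along f: as f is open and injective, the preimage of U
  under \<open>inv f \<circ> g\<close> is the preimage under g of the open image of U under
  f.\<close>

lemma continuous_map_inv_open_arc:
  assumes f: "open_arc X f" and g: "continuous_map Y X g" and sub: "g ` topspace Y \<subseteq> range f"
  shows "continuous_map Y euclideanreal (inv f \<circ> g)"
  unfolding continuous_map_def
proof (intro conjI allI impI)
  show "inv f \<circ> g \<in> topspace Y \<rightarrow> topspace euclideanreal" by simp
  fix U :: "real set" assume "openin euclideanreal U"
  then have "openin X (f ` U)" using f by (simp add: open_arc_openin)
  then have 1: "openin Y {x \<in> topspace Y. g x \<in> f ` U}"
    using g by (rule openin_continuous_map_preimage[rotated])
  have "g x \<in> f ` U \<longleftrightarrow> inv f (g x) \<in> U" if "x \<in> topspace Y" for x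
  proof -
    have "g x \<in> range f" using sub that by (simp add: image_subset_iff)
    then obtain t where "g x = f t" by (rule rangeE)
    then show ?thesis using f by (auto simp: open_arc_def inj_image_mem_iff)
  qed
  then have "{x \<in> topspace Y. g x \<in> f ` U} = {x \<in> topspace Y. (inv f \<circ> g) x \<in> U}"
    by auto
  with 1 show "openin Y {x \<in> topspace Y. (inv f \<circ> g) x \<in> U}" by simp
qed

text \<open>Invariance of domain transferred to X: near each point g is read in the coordinate of an
  arc, where it is an injective real function.\<close>

lemma continuous_inj_imp_open_map:
  assumes X: "locally_line X" and S: "open S"
    and g: "continuous_map (top_of_set S) X g" "inj_on g S"
  shows "open_map (top_of_set S) X (g :: real \<Rightarrow> 'a)"
  unfolding open_map_def
proof (intro allI impI)
  fix T assume "openin (top_of_set S) T"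
  then have T: "open T" "T \<subseteq> S"
    using S by (auto simp: openin_open_eq)
  show "openin X (g ` T)"
  proof (subst openin_subopen, intro ballI)
    fix x assume "x \<in> g ` T"
    then obtain t where t: "t \<in> T" "x = g t" by blast
    have "x \<in> topspace X"
      using continuous_map_image_subset_topspace[OF g(1)] t T by auto
    then obtain f where f: "open_arc X f" "f 0 = x"
      using X by (auto simp: locally_line_def)
    define N where "N = {s \<in> T. g s \<in> range f}"
    have gT: "continuous_map (top_of_set T) X g"
      using g(1) T(2) by (rule continuous_map_from_subtopology_mono)
    have "openin (top_of_set T) {s \<in> topspace (top_of_set T). g s \<in> range f}"
      by (rule openin_continuous_map_preimage[OF gT]) (simp add: open_arc_openin f)
    then have N: "open N" using T by (auto simp: openin_open_eq N_def)
    have gN: "continuous_map (top_of_set N) X g"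
      using gT by (rule continuous_map_from_subtopology_mono) (auto simp: N_def)
    have "continuous_map (top_of_set N) euclideanreal (inv f \<circ> g)"
      by (rule continuous_map_inv_open_arc[OF f(1) gN]) (auto simp: N_def)
    then have c: "continuous_on N (inv f \<circ> g)" by simp
    have i: "inj_on (inv f \<circ> g) N"
    proof (rule inj_onI)
      fix u v assume "u \<in> N" "v \<in> N" "(inv f \<circ> g) u = (inv f \<circ> g) v"
      then have r: "g u \<in> range f" "g v \<in> range f" "inv f (g u) = inv f (g v)" "u \<in> S" "v \<in> S"
        using T(2) by (simp_all add: N_def subset_iff)
      have "g u = g v"
        using f_inv_into_f[OF r(1)] f_inv_into_f[OF r(2)] r(3) by metis
      then show "u = v" using inj_onD[OF g(2)] r(4,5) by blast
    qed
    have "open ((inv f \<circ> g) ` N)"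
      by (rule invariance_of_domain[OF c N i])
    then have "openin X (f ` (inv f \<circ> g) ` N)"
      by (simp add: open_arc_openin f)
    also have "f ` (inv f \<circ> g) ` N = g ` N"
      unfolding image_image by (rule image_cong) (auto simp: N_def f_inv_into_f)
    finally show "\<exists>V. openin X V \<and> x \<in> V \<and> V \<subseteq> g ` T"
    proof (intro exI[of _ "g ` N"] conjI)
      have "g t = f 0" using t f(2) by simp
      then have "t \<in> N" using t by (simp add: N_def)
      then show "x \<in> g ` N" using t by simp
    qed (auto simp: N_def)
  qed
qed

lemma open_arcI:
  "locally_line X \<Longrightarrow> continuous_map euclideanreal X f \<Longrightarrow> inj f \<Longrightarrow> open_arc X f"
  using continuous_inj_imp_open_map[of X UNIV f] by (simp add: open_arc_def)

section \<open>Compact sets, inseparability and the behaviour of a path at an end\<close>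

lemma compact_inseparable_avoid:
  assumes K: "compactin X K" and y: "y \<in> topspace X" and sep: "\<And>k. k \<in> K \<Longrightarrow> \<not> inseparable X k y"
  obtains U where "openin X U" "y \<in> U" "U \<inter> K = {}"
proof -
  have "\<exists>U V. openin X U \<and> k \<in> U \<and> openin X V \<and> y \<in> V \<and> U \<inter> V = {}" if "k \<in> K" for k
    using sep[OF that] y that compactin_subset_topspace[OF K] by (auto simp: inseparable_def)
  then obtain U V where UV: "\<And>k. k \<in> K \<Longrightarrow> openin X (U k) \<and> k \<in> U k \<and> openin X (V k) \<and> y \<in> V k \<and> U k \<inter> V k = {}"
    by metis
  obtain \<F> where \<F>: "finite \<F>" "\<F> \<subseteq> U ` K" "K \<subseteq> \<Union>\<F>"
    using K UV unfolding compactin_def by (metis (no_types, lifting) UN_iff imageE subsetI)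
  then obtain F where F: "finite F" "F \<subseteq> K" "\<F> = U ` F"
    by (meson finite_subset_image)
  \<comment> \<open>As for a point and a compact set in a Hausdorff space, except that separation is
    assumed only for the pairs (k, y). Intersecting with the whole space covers the case of empty
    F.\<close>
  define W where "W = topspace X \<inter> (\<Inter>k\<in>F. V k)"
  have "openin X W"
    using F UV unfolding W_def by (subst Int_commute, intro openin_INT) auto
  moreover have "y \<in> W" using F UV y by (auto simp: W_def)
  moreover have "W \<inter> K = {}"
  proof (rule ccontr)
    assume "W \<inter> K \<noteq> {}"
    then obtain w where w: "w \<in> W" "w \<in> K" by blast
    then obtain k where "k \<in> F" "w \<in> U k" using F \<F>(3) by auto
    then show False using w UV[of k] F(2) by (auto simp: W_def)
  qed
  ultimately show thesis using that by blast
qed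

text \<open>Away from branch points inseparability means equality, so K can be separated from each
  point of its complement as in a Hausdorff space.\<close>

lemma compact_nonbranch_closed:
  assumes "compactin X K" and "K \<inter> branch_points X = {}"
  shows "closedin X K"
proof -
  have "openin X (topspace X - K)"
  proof (subst openin_subopen, intro ballI)
    fix y assume y: "y \<in> topspace X - K"
    have "\<not> inseparable X k y" if "k \<in> K" for k
      using that y assms(2) by (auto simp: branch_points_def)
    then obtain U where "openin X U" "y \<in> U" "U \<inter> K = {}"
      using compact_inseparable_avoid[OF assms(1), of y] y by blast
    then show "\<exists>T. openin X T \<and> y \<in> T \<and> T \<subseteq> topspace X - K"
      using openin_subset by blast
  qed
  then show ?thesis
    using compactin_subset_topspace[OF assms(1)] by (simp add: closedin_def)
qed

lemma limits_inseparable: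
  assumes "limitin X f x F" "limitin X f y F" "F \<noteq> bot"
  shows "inseparable X x y"
  unfolding inseparable_def
proof (intro conjI allI impI)
  show "x \<in> topspace X" "y \<in> topspace X" using assms by (auto simp: limitin_def)
  fix U V assume "openin X U \<and> x \<in> U \<and> openin X V \<and> y \<in> V"
  then have "\<forall>\<^sub>F t in F. f t \<in> U" "\<forall>\<^sub>F t in F. f t \<in> V"
    using assms by (auto simp: limitin_def)
  then have "\<forall>\<^sub>F t in F. f t \<in> U \<inter> V" by eventually_elim auto
  then show "U \<inter> V \<noteq> {}"
    using eventually_happens'[OF assms(3)] by blast
qed

lemma IVT_at_right_top:
  fixes \<tau> :: "real \<Rightarrow> real"
  assumes c: "continuous_on {a<..<b} \<tau>" and lim: "filterlim \<tau> at_top (at_right a)"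
    and v: "a < v" "v < b" and u: "\<tau> v \<le> u"
  obtains w where "a < w" "w \<le> v" "\<tau> w = u"
proof -
  have "\<forall>\<^sub>F t in at_right a. u \<le> \<tau> t"
    using lim by (simp add: filterlim_at_top)
  then obtain d where d: "d > a" "\<And>t. a < t \<Longrightarrow> t < d \<Longrightarrow> u \<le> \<tau> t"
    unfolding eventually_at_right_field by blast
  \<comment> \<open>At most v, and still in (a, d), where \<tau> is at least u.\<close>
  define s where "s = min v ((a + d) / 2)"
  have s: "a < s" "s \<le> v" "s < d" using d v by (auto simp: s_def min_def)
  have "\<exists>w. s \<le> w \<and> w \<le> v \<and> \<tau> w = u"
    by (rule IVT2') (use s d u v in \<open>auto intro: continuous_on_subset[OF c]\<close>)
  then obtain w where "s \<le> w" "w \<le> v" "\<tau> w = u" by blast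
  then show thesis using that[of w] s by simp
qed

text \<open>Near a the function has no zero, hence one sign by connectedness; growth of |\<tau>|
  then leaves a single infinity.\<close>

lemma at_right_top_or_bot:
  fixes \<tau> :: "real \<Rightarrow> real"
  assumes ab: "a < b" and c: "continuous_on {a<..<b} \<tau>"
    and lim: "\<And>K. \<forall>\<^sub>F t in at_right a. K < \<bar>\<tau> t\<bar>"
  shows "filterlim \<tau> at_top (at_right a) \<or> filterlim \<tau> at_bot (at_right a)"
proof -
  obtain d0 where d0: "d0 > a" "\<And>t. a < t \<Longrightarrow> t < d0 \<Longrightarrow> 0 < \<bar>\<tau> t\<bar>"
    using lim[of 0] unfolding eventually_at_right_field by blast
  define d where "d = min d0 b"
  have d: "d > a" "d \<le> b" "\<And>t. a < t \<Longrightarrow> t < d \<Longrightarrow> \<tau> t \<noteq> 0"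
    using d0 ab by (simp_all add: d_def min_def split: if_splits)
  have "connected (\<tau> ` {a<..<d})"
    by (intro connected_continuous_image continuous_on_subset[OF c]) (use d in auto)
  then have conn: "is_interval (\<tau> ` {a<..<d})" by (simp add: is_interval_connected_1)
  have "(\<forall>t. a < t \<and> t < d \<longrightarrow> 0 < \<tau> t) \<or> (\<forall>t. a < t \<and> t < d \<longrightarrow> \<tau> t < 0)"
  proof (rule ccontr)
    assume "\<not> ?thesis"
    then obtain s t where "a < s" "s < d" "\<tau> s \<le> 0" "a < t" "t < d" "0 \<le> \<tau> t"
      by (meson not_le)
    then have "0 \<in> \<tau> ` {a<..<d}"
      using mem_is_interval_1_I[OF conn, of "\<tau> s" "\<tau> t" 0] by auto
    then show False using d by auto
  qed
  moreover have ev: "\<forall>\<^sub>F t in at_right a. a < t \<and> t < d"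
    unfolding eventually_at_right_field using d by blast
  ultimately show ?thesis
  proof (elim disjE)
    assume p: "\<forall>t. a < t \<and> t < d \<longrightarrow> 0 < \<tau> t"
    have "\<forall>\<^sub>F t in at_right a. K < \<tau> t" for K
      using lim[of K] ev by eventually_elim (use p in force)
    then show ?thesis by (simp add: filterlim_at_top_dense)
  next
    assume p: "\<forall>t. a < t \<and> t < d \<longrightarrow> \<tau> t < 0"
    have "\<forall>\<^sub>F t in at_right a. \<tau> t < K" for K
      using lim[of "-K"] ev by eventually_elim (use p in force)
    then show ?thesis by (simp add: filterlim_at_bot_dense)
  qed
qed

text \<open>A compact stretch of the arc can be kept away from y, so the coordinate \<tau> of g
  leaves every bounded interval and, having one sign, runs to a single end. Conversely the whole
  tail of f at that end consists of points of g with parameter close to a, so f inherits the limit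
  y.\<close>

lemma arc_end:
  fixes g :: "real \<Rightarrow> 'a"
  assumes f: "open_arc X f" and ab: "a < b"
    and g: "continuous_map (top_of_set {a<..<b}) X g" and sub: "g ` {a<..<b} \<subseteq> range f"
    and lim: "limitin X g y (at_right a)"
    and sep: "\<And>t. \<not> inseparable X (f t) y"
  shows "filterlim (inv f \<circ> g) at_top (at_right a) \<and> limitin X f y at_top \<or>
         filterlim (inv f \<circ> g) at_bot (at_right a) \<and> limitin X f y at_bot"
proof -
  define \<tau> where "\<tau> = inv f \<circ> g"
  have f\<tau>: "f (\<tau> t) = g t" if "t \<in> {a<..<b}" for t
    using sub that by (auto simp: \<tau>_def f_inv_into_f image_subset_iff)
  have c: "continuous_on {a<..<b} \<tau>"
    using continuous_map_inv_open_arc[OF f g] sub by (simp add: \<tau>_def)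
  have y: "y \<in> topspace X" using lim by (simp add: limitin_def)
  have ev: "\<forall>\<^sub>F t in at_right a. t \<in> {a<..<b}"
    using eventually_at_right_real[OF ab] .
  have abs: "\<forall>\<^sub>F t in at_right a. K < \<bar>\<tau> t\<bar>" for K
  proof -
    have "compactin X (f ` {-K..K})"
      by (rule image_compactin[of euclideanreal]) (use f in \<open>auto simp: open_arc_def\<close>)
    then obtain U where U: "openin X U" "y \<in> U" "U \<inter> f ` {-K..K} = {}"
      by (rule compact_inseparable_avoid[OF _ y]) (use sep in auto)
    then have "\<forall>\<^sub>F t in at_right a. g t \<in> U" using lim by (simp add: limitin_def)
    with ev show ?thesis
    proof eventually_elim
      case (elim t)
      then have "\<tau> t \<notin> {-K..K}" using f\<tau>[of t] U(3) by (metis IntI empty_iff imageI)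
      then show ?case by auto
    qed
  qed
  have near: "\<exists>s>a. s < b \<and> g ` {a<..s} \<subseteq> U" if "openin X U" "y \<in> U" for U
  proof -
    have "\<forall>\<^sub>F t in at_right a. g t \<in> U" using lim that by (simp add: limitin_def)
    then obtain d where "d > a" "\<And>t. a < t \<Longrightarrow> t < d \<Longrightarrow> g t \<in> U"
      unfolding eventually_at_right_field by blast
    then show ?thesis using ab
      by (intro exI[of _ "(a + min d b) / 2"]) (auto simp: min_def field_simps)
  qed
  from at_right_top_or_bot[OF ab c abs] show ?thesis
  proof
    assume top: "filterlim \<tau> at_top (at_right a)"
    have "limitin X f y at_top"
      unfolding limitin_def
    proof (intro conjI allI impI y)
      fix U assume "openin X U \<and> y \<in> U"
      then obtain s where s: "s > a" "s < b" "g ` {a<..s} \<subseteq> U" using near by blast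
      have "f u \<in> U" if u: "u \<ge> \<tau> s" for u
      proof -
        obtain w where "a < w" "w \<le> s" "\<tau> w = u"
          using IVT_at_right_top[OF c top s(1,2) u] by blast
        then show ?thesis using f\<tau>[of w] s by auto
      qed
      then show "\<forall>\<^sub>F u in at_top. f u \<in> U" unfolding eventually_at_top_linorder by blast
    qed
    then show ?thesis using top by (simp add: \<tau>_def)
  next
    assume bot: "filterlim \<tau> at_bot (at_right a)"
    have top: "filterlim (\<lambda>t. - \<tau> t) at_top (at_right a)"
      using bot by (simp add: filterlim_uminus_at_top)
    have c': "continuous_on {a<..<b} (\<lambda>t. - \<tau> t)" by (intro continuous_intros c)
    have "limitin X f y at_bot"
      unfolding limitin_def
    proof (intro conjI allI impI y)
      fix U assume "openin X U \<and> y \<in> U"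
      then obtain s where s: "s > a" "s < b" "g ` {a<..s} \<subseteq> U" using near by blast
      have "f u \<in> U" if u: "u \<le> \<tau> s" for u
      proof -
        have "- \<tau> s \<le> - u" using u by simp
        then obtain w where w: "a < w" "w \<le> s" "- \<tau> w = - u"
          using IVT_at_right_top[OF c' top s(1,2)] by blast
        then have "\<tau> w = u" by simp
        with w show ?thesis using f\<tau>[of w] s by auto
      qed
      then show "\<forall>\<^sub>F u in at_bot. f u \<in> U" unfolding eventually_at_bot_linorder by blast
    qed
    then show ?thesis using bot by (simp add: \<tau>_def)
  qed
qed

section \<open>Shrinking, extending and exhausting arcs\<close>

lemma ex_squash:
  assumes "0 < (e::real)"
  shows "\<exists>q :: real \<Rightarrow> real. continuous_on UNIV q \<and> inj q \<and> q 0 = 0 \<and> (\<forall>s. \<bar>q s\<bar> < e \<and> (0 < q s \<longleftrightarrow> 0 < s))"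
proof -
  \<comment> \<open>|arctan| stays below pi/2 < 2, so half of it stays below 1. The sign is
    preserved, which later keeps the two sides of a centred arc apart.\<close>
  let ?q = "\<lambda>s. e * (arctan s / 2)"
  have "continuous_on UNIV ?q" by (intro continuous_intros) auto
  moreover have "inj ?q" using assms by (auto simp: inj_on_def arctan_eq_iff)
  moreover have "\<bar>?q s\<bar> < e" for s
  proof -
    have "\<bar>arctan s\<bar> < 2" using arctan_bounded[of s] pi_less_4 by linarith
    then show ?thesis using assms by (simp add: abs_mult)
  qed
  moreover have "0 < ?q s \<longleftrightarrow> 0 < s" for s using assms by (simp add: zero_less_mult_iff)
  moreover have "?q 0 = 0" by simp
  ultimately show ?thesis by - (rule exI[of _ ?q], blast)
qed

lemma open_arc_small:
  assumes f: "open_arc X f" and U: "openin X U" "f 0 \<in> U"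
  obtains g where "open_arc X g" "g 0 = f 0" "range g \<subseteq> U"
proof -
  have "openin euclideanreal {t \<in> topspace euclideanreal. f t \<in> U}"
    using f U by (intro openin_continuous_map_preimage) (auto simp: open_arc_def)
  then have "open {t. f t \<in> U}" by simp
  then obtain e where e: "e > 0" "ball 0 e \<subseteq> {t. f t \<in> U}"
    using U(2) by (auto elim!: openE[of _ 0])
  obtain q :: "real \<Rightarrow> real" where q: "continuous_on UNIV q" "inj q" "q 0 = 0" "\<And>s. \<bar>q s\<bar> < e"
    using ex_squash[OF e(1)] by blast
  show thesis
    by (rule that[of "f \<circ> q"]) (use q e in \<open>auto intro: open_arc_compose[OF f] simp: subset_iff dist_real_def\<close>)
qed

text \<open>\<tau> is continued with slope m on both sides of [-r, r], steep enough that one more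
  unit of parameter reaches past c - 1 and c + 1. This fixed cost of one unit is what lets stage n
  of the exhaustion be frozen on [-n, n].\<close>

lemma monotone_extension:
  fixes \<tau> :: "real \<Rightarrow> real"
  assumes r: "0 \<le> r" and c: "continuous_on {-r..r} \<tau>" and mono: "strict_mono_on {-r..r} \<tau>"
  obtains \<sigma> where "continuous_on UNIV \<sigma>" "strict_mono \<sigma>" "\<And>t. t \<in> {-r..r} \<Longrightarrow> \<sigma> t = \<tau> t"
    "{c-1..c+1} \<subseteq> \<sigma> ` {-(r+1)..r+1}"
proof -
  \<comment> \<open>Clamping to [-r, r]; t - k t is the overshoot and vanishes inside.\<close>
  define k where "k t = max (-r) (min r t)" for t
  \<comment> \<open>Large enough for \<open>\<tau> r + m \<ge> c + 1\<close> and
    \<open>\<tau> (-r) - m \<le> c - 1\<close>, and positive.\<close>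
  define m where "m = 2 + \<bar>\<tau> r\<bar> + \<bar>\<tau> (-r)\<bar> + \<bar>c\<bar>"
  define \<sigma> where "\<sigma> t = \<tau> (k t) + m * (t - k t)" for t
  have m: "m > 0" by (simp add: m_def add_pos_nonneg)
  have k: "k t \<in> {-r..r}" for t using r by (auto simp: k_def)
  have ck: "continuous_on UNIV k" unfolding k_def by (intro continuous_intros)
  have "continuous_on UNIV (\<lambda>t. \<tau> (k t))"
    by (rule continuous_on_compose2[OF c ck]) (use k in auto)
  then have cs: "continuous_on UNIV \<sigma>"
    unfolding \<sigma>_def by (intro continuous_intros ck)
  have sm: "strict_mono \<sigma>"
  proof (rule strict_monoI)
    fix s t :: real assume st: "s < t"
    have k1: "k s \<le> k t" "s - k s \<le> t - k t" using st r by (auto simp: k_def)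
    then have "m * (s - k s) \<le> m * (t - k t)" using m by (intro mult_left_mono) auto
    moreover have "\<tau> (k s) < \<tau> (k t)" if "k s < k t"
      using strict_mono_onD[OF mono k k that] .
    moreover have "m * (s - k s) < m * (t - k t)" if "k s = k t"
      using that st m by simp
    ultimately show "\<sigma> s < \<sigma> t"
      unfolding \<sigma>_def using k1(1) by (cases "k s = k t") auto
  qed
  have kr: "k (r+1) = r" "k (-(r+1)) = -r" using r by (auto simp: k_def)
  have "\<sigma> (r+1) = \<tau> r + m" "\<sigma> (-(r+1)) = \<tau> (-r) - m"
    unfolding \<sigma>_def kr by (simp_all add: algebra_simps)
  then have bd: "\<sigma> (-(r+1)) \<le> c - 1" "c + 1 \<le> \<sigma> (r+1)"
    unfolding m_def by (auto simp: abs_if)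
  have "{c-1..c+1} \<subseteq> \<sigma> ` {-(r+1)..r+1}"
  proof
    fix u assume u: "u \<in> {c-1..c+1}"
    have "\<exists>w. -(r+1) \<le> w \<and> w \<le> r+1 \<and> \<sigma> w = u"
      by (rule IVT') (use bd u r in \<open>auto intro: continuous_on_subset[OF cs]\<close>)
    then show "u \<in> \<sigma> ` {-(r+1)..r+1}" by auto
  qed
  moreover have "\<sigma> t = \<tau> t" if "t \<in> {-r..r}" for t
  proof -
    have "k t = t" using that by (auto simp: k_def)
    then show ?thesis by (simp add: \<sigma>_def)
  qed
  ultimately show thesis using that cs sm by blast
qed

text \<open>In the coordinate of g the piece of f over [-r, r] is an injective, hence monotone, real
  function. After reversing g if necessary it is increasing, and \<open>monotone_extension\<close>
  prolongs it so as to swallow the stretch of g over [c - 1, c + 1].\<close>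

lemma open_arc_extension:
  assumes f: "open_arc X f" and g: "open_arc X g" and r: "0 \<le> r"
    and sub: "f ` {-r..r} \<subseteq> range g"
  obtains h where "open_arc X h" "\<And>t. t \<in> {-r..r} \<Longrightarrow> h t = f t"
    "g ` {c-1..c+1} \<subseteq> h ` {-(r+1)..r+1}"
proof -
  note result = that
  \<comment> \<open>The increasing case, for g' = g or its reversal; reversal moves the centre c to
    -c, hence the separate c'.\<close>
  have *: thesis if g: "open_arc X g'" and sub: "f ` {-r..r} \<subseteq> range g'"
    and mono: "strict_mono_on {-r..r} (inv g' \<circ> f)" and eq: "g' ` {c'-1..c'+1} = g ` {c-1..c+1}"
  for g' c'
  proof -
    have fc: "continuous_map (top_of_set {-r..r}) X f"
      using f by (auto simp: open_arc_def intro: continuous_map_from_subtopology)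
    have "continuous_on {-r..r} (inv g' \<circ> f)"
      using continuous_map_inv_open_arc[OF g fc] sub by simp
    then obtain \<sigma> where \<sigma>: "continuous_on UNIV \<sigma>" "strict_mono \<sigma>"
      "\<And>t. t \<in> {-r..r} \<Longrightarrow> \<sigma> t = (inv g' \<circ> f) t" "{c'-1..c'+1} \<subseteq> \<sigma> ` {-(r+1)..r+1}"
      using monotone_extension[OF r _ mono, of c'] by blast
    show thesis
    proof (rule result)
      show "open_arc X (g' \<circ> \<sigma>)"
        by (rule open_arc_compose[OF g \<sigma>(1)]) (use \<sigma>(2) strict_mono_imp_inj_on in blast)
      fix t assume t: "t \<in> {-r..r}"
      then have "f t \<in> range g'" using sub by (simp add: image_subset_iff)
      then show "(g' \<circ> \<sigma>) t = f t" using \<sigma>(3)[OF t] by (simp add: f_inv_into_f)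
    next
      show "g ` {c-1..c+1} \<subseteq> (g' \<circ> \<sigma>) ` {-(r+1)..r+1}"
        unfolding eq[symmetric] image_comp[symmetric] using \<sigma>(4) by (rule image_mono)
    qed
  qed
  have fc: "continuous_map (top_of_set {-r..r}) X f"
    using f by (auto simp: open_arc_def intro: continuous_map_from_subtopology)
  have c: "continuous_on {-r..r} (inv g \<circ> f)"
    using continuous_map_inv_open_arc[OF g fc] sub by simp
  have "inj_on (inv g \<circ> f) {-r..r}"
  proof (rule comp_inj_on)
    show "inj_on f {-r..r}" using f by (auto simp: open_arc_def inj_on_def)
    show "inj_on (inv g) (f ` {-r..r})" using sub by (rule inj_on_inv_into)
  qed
  then consider "strict_mono_on {-r..r} (inv g \<circ> f)" | "strict_antimono_on {-r..r} (inv g \<circ> f)"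
    using injective_eq_monotone_map[OF _ c] by auto
  then show thesis
  proof cases
    case 1
    then show ?thesis using *[OF g sub, of c] by blast
  next
    case 2
    define g' where "g' t = g (- t)" for t
    have g': "open_arc X g'" unfolding g'_def by (rule open_arc_uminus[OF g])
    have rg: "range g' = range g"
    proof -
      have "range g' = g ` range uminus" unfolding image_image g'_def ..
      also have "range uminus = (UNIV :: real set)" by (metis minus_minus surjI)
      finally show ?thesis .
    qed
    have sub': "f ` {-r..r} \<subseteq> range g'" using sub rg by simp
    have ginv: "(inv g' \<circ> f) t = - (inv g \<circ> f) t" if "t \<in> {-r..r}" for t
    proof -
      have "f t \<in> range g" using that sub by blast
      then have "g' (- inv g (f t)) = f t" by (simp add: g'_def f_inv_into_f)
      then show ?thesis using g' by (metis comp_apply inv_f_f open_arc_def)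
    qed
    have "strict_mono_on {-r..r} (inv g' \<circ> f)"
    proof (rule strict_mono_onI)
      fix s t assume st: "s \<in> {-r..r}" "t \<in> {-r..r}" "s < t"
      then have "(inv g \<circ> f) t < (inv g \<circ> f) s"
        using 2 by (auto simp: monotone_on_def)
      then show "(inv g' \<circ> f) s < (inv g' \<circ> f) t" using ginv st by simp
    qed
    moreover have "g' ` {-c-1..-c+1} = g ` {c-1..c+1}"
    proof -
      have "g' ` {-c-1..-c+1} = g ` uminus ` {-c-1..-c+1}" unfolding image_image g'_def ..
      also have "uminus ` {-c-1..-c+1} = {c-1..c+1}" by simp
      finally show ?thesis .
    qed
    ultimately show ?thesis by (rule *[OF g' sub'])
  qed
qed

text \<open>At t the stages are constant from the first n \<ge> |t| on, so f agrees with
  \<open>F n\<close> on (-n, n). Continuity and openness are local and injectivity concerns two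
  points of a common interval, so all three pass to f.\<close>

lemma open_arc_limit:
  assumes F: "\<And>n. open_arc X (F n)"
    and step: "\<And>n t. \<bar>t\<bar> \<le> real n \<Longrightarrow> F (Suc n) t = F n t"
  obtains f where "open_arc X f" "\<And>n t. \<bar>t\<bar> \<le> real n \<Longrightarrow> f t = F n t"
proof -
  define f where "f t = F (nat \<lceil>\<bar>t\<bar>\<rceil>) t" for t
  have mono: "F m t = F n t" if "n \<le> m" "\<bar>t\<bar> \<le> real n" for m n t
    using that(1)
  proof (induction rule: dec_induct)
    case (step k)
    then show ?case using that(2) assms(2)[of t k] by simp
  qed simp
  have f: "f t = F n t" if "\<bar>t\<bar> \<le> real n" for n t
  proof -
    have "nat \<lceil>\<bar>t\<bar>\<rceil> \<le> n" using that by linarith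
    moreover have "\<bar>t\<bar> \<le> real (nat \<lceil>\<bar>t\<bar>\<rceil>)" by linarith
    ultimately show ?thesis unfolding f_def using mono by metis
  qed
  have ex: "\<exists>n. t \<in> {-real n<..<real n}" for t :: real
  proof -
    obtain n where "\<bar>t\<bar> < real n" using reals_Archimedean2 by blast
    then show ?thesis by (intro exI[of _ n]) auto
  qed
  have "openin euclideanreal {t \<in> topspace euclideanreal. f t \<in> U}" if "openin X U" for U
  proof -
    have "{t. f t \<in> U} = (\<Union>n. {t. F n t \<in> U} \<inter> {-real n<..<real n})"
    proof (intro set_eqI iffI)
      fix t assume "t \<in> {t. f t \<in> U}"
      moreover obtain n where "t \<in> {-real n<..<real n}" using ex by blast
      moreover have "f t = F n t" by (rule f) (use \<open>t \<in> {-real n<..<real n}\<close> in auto)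
      ultimately show "t \<in> (\<Union>n. {t. F n t \<in> U} \<inter> {-real n<..<real n})" by auto
    next
      fix t assume "t \<in> (\<Union>n. {t. F n t \<in> U} \<inter> {-real n<..<real n})"
      then obtain n where n: "F n t \<in> U" "t \<in> {-real n<..<real n}" by blast
      moreover have "f t = F n t" by (rule f) (use n in auto)
      ultimately show "t \<in> {t. f t \<in> U}" by simp
    qed
    moreover have "open {t. F n t \<in> U}" for n
      using openin_continuous_map_preimage[of euclideanreal X "F n" U] F[of n] that
      by (simp add: open_arc_def)
    ultimately show ?thesis by (auto intro!: open_UN open_Int)
  qed
  moreover have "f t \<in> topspace X" for t
    unfolding f_def using F by (rule open_arc_in_topspace)
  ultimately have cont: "continuous_map euclideanreal X f"
    unfolding continuous_map_def by auto
  have "openin X (f ` T)" if "open T" for T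
  proof -
    have "f ` T = (\<Union>n. F n ` (T \<inter> {-real n<..<real n}))"
    proof (intro set_eqI iffI)
      fix x assume "x \<in> f ` T"
      then obtain t where t: "t \<in> T" "x = f t" by blast
      obtain n where n: "t \<in> {-real n<..<real n}" using ex by blast
      have "f t = F n t" by (rule f) (use n in auto)
      then have "x \<in> F n ` (T \<inter> {-real n<..<real n})" using t n by blast
      then show "x \<in> (\<Union>n. F n ` (T \<inter> {-real n<..<real n}))" by blast
    next
      fix x assume "x \<in> (\<Union>n. F n ` (T \<inter> {-real n<..<real n}))"
      then obtain n t where n: "t \<in> T" "t \<in> {-real n<..<real n}" "x = F n t" by blast
      moreover have "f t = F n t" by (rule f) (use n in auto)
      ultimately have "x = f t" by simp
      then show "x \<in> f ` T" using n(1) by blast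
    qed
    moreover have "openin X (F n ` (T \<inter> {-real n<..<real n}))" for n
      by (rule open_arc_openin[OF F]) (use that in auto)
    ultimately show ?thesis by auto
  qed
  then have "open_map euclideanreal X f" by (simp add: open_map_def)
  moreover have "inj f"
  proof (rule injI)
    fix s t assume eq: "f s = f t"
    obtain n where n: "max \<bar>s\<bar> \<bar>t\<bar> < real n" using reals_Archimedean2 by blast
    have "f s = F n s" "f t = F n t" using n by (auto intro: f)
    then show "s = t" using eq F[of n] by (auto simp: open_arc_def dest: injD)
  qed
  ultimately have "open_arc X f" using cont by (simp add: open_arc_def)
  then show thesis using f that by blast
qed

text \<open>
  The arcs are enlarged greedily along the base: step \<open>n\<close> absorbs the \<open>n\<close>-th basic set whenever
  an arc that agrees with the current one on \<open>[-n, n]\<close> can do so.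
\<close>

lemma ex_maximal_open_arc:
  assumes X: "locally_line X" and base: "has_countable_base X" and ne: "topspace X \<noteq> {}"
  obtains f where "open_arc X f" "\<And>g. open_arc X g \<Longrightarrow> range f \<subseteq> range g \<Longrightarrow> range g \<subseteq> range f"
proof -
  obtain \<B> where \<B>: "countable \<B>" "\<And>U. openin X U \<Longrightarrow> \<exists>\<C>\<subseteq>\<B>. U = \<Union>\<C>"
    using base by (auto simp: has_countable_base_def)
  \<comment> \<open>Adding the empty set makes the family nonempty, so that
    \<open>from_nat_into\<close> enumerates it.\<close>
  define B where "B = from_nat_into (insert {} \<B>)"
  have B: "\<exists>n. x \<in> B n \<and> B n \<subseteq> U" if U: "openin X U" "x \<in> U" for x U
  proof -
    obtain V where V: "V \<in> \<B>" "x \<in> V" "V \<subseteq> U" using \<B>(2)[OF U(1)] U(2) by blast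
    then have "V \<in> range B"
      unfolding B_def using \<B>(1) by (subst range_from_nat_into) auto
    then show ?thesis using V by blast
  qed
  define P where "P n g h \<longleftrightarrow> open_arc X h \<and> (\<forall>t. \<bar>t\<bar> \<le> real n \<longrightarrow> h t = g t) \<and>
      B n \<subseteq> h ` {-(real n+1)..real n+1}" for n and g h :: "real \<Rightarrow> 'a"
  obtain f0 where f0: "open_arc X f0" using ne X unfolding locally_line_def by blast
  have "\<exists>F. (\<forall>n. open_arc X (F n)) \<and> (\<forall>n. (\<forall>t. \<bar>t\<bar> \<le> real n \<longrightarrow> F (Suc n) t = F n t) \<and>
      ((\<exists>h. P n (F n) h) \<longrightarrow> P n (F n) (F (Suc n))))"
  proof -
    have "\<exists>F. \<forall>n. open_arc X (F n) \<and> ((\<forall>t. \<bar>t\<bar> \<le> real n \<longrightarrow> F (Suc n) t = F n t) \<and>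
      ((\<exists>h. P n (F n) h) \<longrightarrow> P n (F n) (F (Suc n))))"
    proof (rule dependent_nat_choice)
      show "\<exists>f. open_arc X f" using f0 by blast
      fix f n assume f: "open_arc X f"
      show "\<exists>g. open_arc X g \<and> (\<forall>t. \<bar>t\<bar> \<le> real n \<longrightarrow> g t = f t) \<and> ((\<exists>h. P n f h) \<longrightarrow> P n f g)"
      proof (cases "\<exists>h. P n f h")
        case True
        then obtain h where "P n f h" by blast
        then show ?thesis by (intro exI[of _ h]) (auto simp: P_def)
      next
        case False
        then show ?thesis using f by blast
      qed
    qed
    then show ?thesis by blast
  qed
  then obtain F where F: "\<And>n. open_arc X (F n)" "\<And>n t. \<bar>t\<bar> \<le> real n \<Longrightarrow> F (Suc n) t = F n t"
    and FP: "\<And>n h. P n (F n) h \<Longrightarrow> P n (F n) (F (Suc n))"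
    by blast
  obtain f where f: "open_arc X f" "\<And>n t. \<bar>t\<bar> \<le> real n \<Longrightarrow> f t = F n t"
    using open_arc_limit[of X F, OF F(1) F(2)] by blast
  show thesis
  proof (rule that[OF f(1)])
    fix g assume g: "open_arc X g" "range f \<subseteq> range g"
    show "range g \<subseteq> range f"
    proof
      fix x assume "x \<in> range g"
      then obtain c where c: "x = g c" by blast
      \<comment> \<open>A basic set \<open>B n\<close> around x fits into this stretch of g. Since g
        contains f and with it stage n over [-n, n], \<open>open_arc_extension\<close> shows that
        absorbing \<open>B n\<close> was possible at stage n; the greedy choice has therefore done
        it, and x already lies on f.\<close>
      have "openin X (g ` {c-1<..<c+1})" by (rule open_arc_openin[OF g(1)]) simp
      moreover have "x \<in> g ` {c-1<..<c+1}" using c by simp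
      ultimately obtain n where n: "x \<in> B n" "B n \<subseteq> g ` {c-1<..<c+1}"
        using B by blast
      have "F n ` {-real n..real n} \<subseteq> range g"
      proof
        fix z assume "z \<in> F n ` {-real n..real n}"
        then obtain t where "t \<in> {-real n..real n}" "z = F n t" by blast
        then have "z = f t" using f(2)[of t n] by (simp add: abs_le_iff)
        then show "z \<in> range g" using g(2) by blast
      qed
      then obtain h where h: "open_arc X h" "\<And>t. t \<in> {-real n..real n} \<Longrightarrow> h t = F n t"
        "g ` {c-1..c+1} \<subseteq> h ` {-(real n+1)..real n+1}"
        using open_arc_extension[OF F(1)[of n] g(1), of "real n" c] of_nat_0_le_iff[of n] by blast
      have "g ` {c-1<..<c+1} \<subseteq> g ` {c-1..c+1}" by (rule image_mono) auto
      then have "B n \<subseteq> h ` {-(real n+1)..real n+1}" using n h(3) by (meson order_trans)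
      then have "P n (F n) h" using h(1,2) unfolding P_def by (auto simp: abs_le_iff)
      then have "P n (F n) (F (Suc n))" by (rule FP)
      then have "x \<in> F (Suc n) ` {-(real n+1)..real n+1}" using n by (auto simp: P_def)
      then obtain t where t: "t \<in> {-(real n+1)..real n+1}" "x = F (Suc n) t" by blast
      then have "x = f t" using f(2)[of t "Suc n"] by (simp add: abs_le_iff)
      then show "x \<in> range f" by blast
    qed
  qed
qed

section \<open>Paths that traverse a whole arc\<close>

lemma surj_of_infinite_ends:
  fixes \<tau> :: "real \<Rightarrow> real"
  assumes ab: "a < b" and c: "continuous_on {a<..<b} \<tau>" and inj: "inj_on \<tau> {a<..<b}"
    and R: "filterlim \<tau> at_top (at_right a) \<or> filterlim \<tau> at_bot (at_right a)"
    and L: "filterlim (\<lambda>t. \<tau> (- t)) at_top (at_right (- b)) \<or> filterlim (\<lambda>t. \<tau> (- t)) at_bot (at_right (- b))"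
  shows "\<tau> ` {a<..<b} = UNIV"
proof -
  \<comment> \<open>Opposite infinities: the level u is reached to the left or to the right of the
    midpoint v according to its comparison with \<open>\<sigma> v\<close>.\<close>
  have above: "\<exists>w. a < w \<and> w < b \<and> \<sigma> w = u"
    if c: "continuous_on {a<..<b} \<sigma>" and R: "filterlim \<sigma> at_top (at_right a)"
      and L: "filterlim (\<lambda>t. \<sigma> (- t)) at_bot (at_right (- b))" for \<sigma> :: "real \<Rightarrow> real" and u
  proof -
    define v where "v = (a + b) / 2"
    have v: "a < v" "v < b" using ab by (auto simp: v_def)
    show ?thesis
    proof (cases "\<sigma> v \<le> u")
      case True
      then show ?thesis using IVT_at_right_top[OF c R v] v by (metis order.strict_trans1)
    next
      case False
      have "continuous_on {-b<..<-a} (\<lambda>t. - \<sigma> (- t))"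
        by (intro continuous_intros continuous_on_compose2[OF c]) auto
      moreover have "filterlim (\<lambda>t. - \<sigma> (- t)) at_top (at_right (- b))"
        using L by (simp add: filterlim_uminus_at_top)
      ultimately obtain w where "-b < w" "w \<le> -v" "- \<sigma> (- w) = -u"
        by (rule IVT_at_right_top[of _ _ _ "-v" "-u"]) (use v False in auto)
      then show ?thesis using v by (intro exI[of _ "-w"]) auto
    qed
  qed
  \<comment> \<open>Equal infinities contradict injectivity: the level \<open>\<sigma> v + 1\<close>
    is reached on both sides of v. The limit at b is written at -b for the mirrored function, so
    that the lemma for right-hand limits serves both ends.\<close>
  have same: False
    if c: "continuous_on {a<..<b} \<sigma>" and inj: "inj_on \<sigma> {a<..<b}" and R: "filterlim \<sigma> at_top (at_right a)"
      and L: "filterlim (\<lambda>t. \<sigma> (- t)) at_top (at_right (- b))" for \<sigma> :: "real \<Rightarrow> real"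
  proof -
    define v where "v = (a + b) / 2"
    have v: "a < v" "v < b" using ab by (auto simp: v_def)
    obtain w where w: "a < w" "w \<le> v" "\<sigma> w = \<sigma> v + 1"
      by (rule IVT_at_right_top[OF c R v, of "\<sigma> v + 1"]) auto
    have "continuous_on {-b<..<-a} (\<lambda>t. \<sigma> (- t))"
      by (intro continuous_on_compose2[OF c] continuous_intros) auto
    then obtain w' where w': "-b < w'" "w' \<le> -v" "\<sigma> (- w') = \<sigma> v + 1"
      by (rule IVT_at_right_top[OF _ L, of _ "-v" "\<sigma> v + 1"]) (use v in auto)
    have "w = - w'" by (rule inj_onD[OF inj]) (use w w' v in auto)
    then have "w = v" using w w' by linarith
    then show False using w by simp
  qed
  have cm: "continuous_on {a<..<b} (\<lambda>t. - \<tau> t)" by (intro continuous_intros c)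
  have im: "inj_on (\<lambda>t. - \<tau> t) {a<..<b}" using inj by (auto simp: inj_on_def)
  consider "filterlim \<tau> at_top (at_right a)" "filterlim (\<lambda>t. \<tau> (- t)) at_top (at_right (- b))"
    | "filterlim \<tau> at_bot (at_right a)" "filterlim (\<lambda>t. \<tau> (- t)) at_bot (at_right (- b))"
    | "filterlim \<tau> at_top (at_right a)" "filterlim (\<lambda>t. \<tau> (- t)) at_bot (at_right (- b))"
    | "filterlim \<tau> at_bot (at_right a)" "filterlim (\<lambda>t. \<tau> (- t)) at_top (at_right (- b))"
    using R L by blast
  then show ?thesis
  proof cases
    case 1
    then show ?thesis using same[OF c inj] by blast
  next
    case 2
    then show ?thesis using same[OF cm im] by (simp add: filterlim_uminus_at_top)
  next
    case 3
    have "u \<in> \<tau> ` {a<..<b}" for u using above[OF c 3, of u] by auto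
    then show ?thesis by blast
  next
    case 4
    have "u \<in> \<tau> ` {a<..<b}" for u
      using above[OF cm, of "-u"] 4 by (auto simp: filterlim_uminus_at_top)
    then show ?thesis by blast
  qed
qed

lemma limitin_at_right:
  fixes g :: "real \<Rightarrow> 'a"
  assumes g: "continuous_map (top_of_set {a..<b}) X g" and ab: "a < b"
  shows "limitin X g (g a) (at_right a)"
  unfolding limitin_def
proof (intro conjI allI impI)
  show "g a \<in> topspace X"
    using continuous_map_image_subset_topspace[OF g] ab by auto
  fix U assume U: "openin X U \<and> g a \<in> U"
  then have "openin (top_of_set {a..<b}) {t \<in> topspace (top_of_set {a..<b}). g t \<in> U}"
    by (intro openin_continuous_map_preimage[OF g]) auto
  then obtain T where T: "open T" "{t \<in> {a..<b}. g t \<in> U} = {a..<b} \<inter> T"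
    by (auto simp: openin_open)
  have "a \<in> T" using T(2) U ab by (metis (mono_tags, lifting) IntD2 atLeastLessThan_iff mem_Collect_eq order_refl)
  then have "\<forall>\<^sub>F t in at_right a. t \<in> T"
    using T(1) eventually_at_topological by blast
  moreover have "\<forall>\<^sub>F t in at_right a. t \<in> {a<..<b}"
    using eventually_at_right_real[OF ab] .
  ultimately show "\<forall>\<^sub>F t in at_right a. g t \<in> U"
  proof eventually_elim
    case (elim t)
    then have "t \<in> {a..<b} \<inter> T" by auto
    then show ?case using T(2) by blast
  qed
qed

text \<open>With \<open>arc_end\<close> at both ends of g, the coordinate runs to infinity at a and
  at b, and injectivity forces opposite infinities. A path inside an arc that leaves it at both ends
  has thus covered it.\<close>

lemma arc_between_ends:
  fixes g :: "real \<Rightarrow> 'a"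
  assumes f: "open_arc X f" and ab: "a < b"
    and g: "continuous_map (top_of_set {a..b}) X g" "inj_on g {a<..<b}" "g ` {a<..<b} \<subseteq> range f"
    and sep: "\<And>t. \<not> inseparable X (f t) (g a)" "\<And>t. \<not> inseparable X (f t) (g b)"
  shows "g ` {a<..<b} = range f"
proof -
  define \<tau> where "\<tau> = inv f \<circ> g"
  have g1: "continuous_map (top_of_set {a..<b}) X g" "continuous_map (top_of_set {a<..<b}) X g"
    using g(1) by (auto elim!: continuous_map_from_subtopology_mono)
  have g2: "continuous_map (top_of_set {-b..-a}) X (\<lambda>t. g (- t))"
    using continuous_map_compose[of "top_of_set {-b..-a}" "top_of_set {a..b}" uminus X g] g(1)
    by (auto simp: o_def continuous_on_minus)
  have g3: "continuous_map (top_of_set {-b..<-a}) X (\<lambda>t. g (- t))"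
    "continuous_map (top_of_set {-b<..<-a}) X (\<lambda>t. g (- t))"
    using g2 by (auto elim!: continuous_map_from_subtopology_mono)
  have "limitin X g (g a) (at_right a)" by (rule limitin_at_right[OF g1(1) ab])
  from arc_end[OF f ab g1(2) g(3) this sep(1)]
  have R: "filterlim \<tau> at_top (at_right a) \<or> filterlim \<tau> at_bot (at_right a)"
    by (auto simp: \<tau>_def)
  have "limitin X (\<lambda>t. g (- t)) (g (- (- b))) (at_right (- b))"
    by (rule limitin_at_right[OF g3(1)]) (use ab in auto)
  then have lim: "limitin X (\<lambda>t. g (- t)) (g b) (at_right (- b))" by simp
  have "(\<lambda>t. g (- t)) ` {-b<..<-a} \<subseteq> range f"
    using g(3) by (auto simp: image_subset_iff)
  from arc_end[OF f _ g3(2) this lim sep(2)] ab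
  have L: "filterlim (\<lambda>t. \<tau> (- t)) at_top (at_right (- b)) \<or> filterlim (\<lambda>t. \<tau> (- t)) at_bot (at_right (- b))"
    by (auto simp: \<tau>_def o_def)
  have c: "continuous_on {a<..<b} \<tau>"
    using continuous_map_inv_open_arc[OF f g1(2)] g(3) by (simp add: \<tau>_def)
  have "inj_on \<tau> {a<..<b}"
    unfolding \<tau>_def by (rule comp_inj_on[OF g(2) inj_on_inv_into[OF g(3)]])
  then have "\<tau> ` {a<..<b} = UNIV" by (rule surj_of_infinite_ends[OF ab c _ R L])
  then have "range f = f ` \<tau> ` {a<..<b}" by simp
  also have "\<dots> = g ` {a<..<b}"
    unfolding image_image by (rule image_cong) (use g(3) in \<open>auto simp: \<tau>_def f_inv_into_f image_subset_iff\<close>)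
  finally show ?thesis by simp
qed

lemma open_real_component:
  fixes A :: "real set"
  assumes A: "open A" and q: "r < q" "q < p" "r \<notin> A" "p \<notin> A" "q \<in> A"
  obtains a b where "r \<le> a" "a < q" "q < b" "b \<le> p" "a \<notin> A" "b \<notin> A" "{a<..<b} \<subseteq> A"
proof -
  \<comment> \<open>The ends sought are the last point outside A before q and the first one after q;
    r and p make both sets nonempty.\<close>
  define S where "S = {r..q} - A"
  define T where "T = {q..p} - A"
  have S: "closed S" "S \<noteq> {}" "bdd_above S" and T: "closed T" "T \<noteq> {}" "bdd_below T"
  proof -
    have "r \<in> S" "p \<in> T" using q by (auto simp: S_def T_def)
    then show "S \<noteq> {}" "T \<noteq> {}" by blast+
    show "bdd_above S" "bdd_below T" by (auto simp: S_def T_def intro: bdd_above_mono bdd_below_mono)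
    show "closed S" "closed T" using A by (auto simp: S_def T_def intro!: closed_Diff)
  qed
  have aS: "Sup S \<in> S" by (rule closed_contains_Sup[OF S(2,3,1)])
  have bT: "Inf T \<in> T" by (rule closed_contains_Inf[OF T(2,3,1)])
  have 1: "Sup S < q" "q < Inf T" using aS bT q(5) by (auto simp: S_def T_def less_le)
  have "{Sup S<..<Inf T} \<subseteq> A"
  proof
    fix t assume t: "t \<in> {Sup S<..<Inf T}"
    have "t \<notin> S" using cSup_upper[OF _ S(3), of t] t by auto
    moreover have "t \<notin> T" using cInf_lower[OF _ T(3), of t] t by auto
    ultimately show "t \<in> A" using t aS bT unfolding S_def T_def by (cases "t \<le> q") auto
  qed
  then show thesis using that[of "Sup S" "Inf T"] 1 aS bT by (auto simp: S_def T_def)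
qed


section \<open>Connected Hausdorff one-manifolds\<close>

text \<open>The arc with y added is the one-point compactification of the line, parametrized by the
  circle through stereographic projection. Being compact it is closed in X, and it is open by
  assumption, so connectedness makes it everything.\<close>

lemma circle_of_arc:
  assumes f: "open_arc X f" and X: "Hausdorff_space X" "connected_space X"
    and lim: "limitin X f y at_top" "limitin X f y at_bot" and y: "y \<notin> range f"
    and op: "openin X (insert y (range f))"
  shows "X homeomorphic_space top_of_set (sphere (0::complex) 1)"
proof -
  define S where "S = sphere (0::complex) 1"
  \<comment> \<open>Stereographic projection from -1: the tangent of half the angle.\<close>
  define st where "st z = Im z / (1 + Re z)" for z
  define p where "p z = (if z = -1 then y else f (st z))" for z :: complex
  have S: "(Re z)\<^sup>2 + (Im z)\<^sup>2 = 1" if "z \<in> S" for z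
  proof -
    have "(cmod z)\<^sup>2 = 1" using that by (simp add: S_def)
    then show ?thesis by (simp add: cmod_power2)
  qed
  have pos: "0 < 1 + Re z" if "z \<in> S" "z \<noteq> -1" for z
  proof -
    have "(Re z)\<^sup>2 \<le> 1" using S[OF that(1)] zero_le_power2[of "Im z"] by linarith
    then have "\<bar>Re z\<bar> \<le> 1" by (simp add: abs_square_le_1)
    moreover have "Re z \<noteq> -1"
      using S[OF that(1)] that(2) by (auto simp: complex_eq_iff)
    ultimately show ?thesis by linarith
  qed
  \<comment> \<open>This relation controls the size of \<open>st z\<close> without division; it
    yields both the neighbourhoods of -1 below and the injectivity of p.\<close>
  have sq: "(st z)\<^sup>2 * (1 + Re z) = 1 - Re z" if "z \<in> S" "z \<noteq> -1" for z
  proof -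
    have "(Im z)\<^sup>2 = (1 - Re z) * (1 + Re z)"
      using S[OF that(1)] by (simp add: algebra_simps power2_eq_square)
    then show ?thesis using pos[OF that]
      by (simp add: st_def power_divide power2_eq_square)
  qed
  have cont: "continuous_map (top_of_set S) X p"
    unfolding continuous_map_def
  proof (intro conjI allI impI)
    show "p \<in> topspace (top_of_set S) \<rightarrow> topspace X"
      using lim(1) open_arc_in_topspace[OF f] by (auto simp: p_def limitin_def)
    fix U assume U: "openin X U"
    show "openin (top_of_set S) {z \<in> topspace (top_of_set S). p z \<in> U}"
    proof (subst openin_subopen, intro ballI)
      fix z assume z: "z \<in> {z \<in> topspace (top_of_set S). p z \<in> U}"
      define T where "T = {u. f u \<in> U}"
      have T: "open T"
        using openin_continuous_map_preimage[of euclideanreal X f U] f U by (simp add: open_arc_def T_def)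
      show "\<exists>W. openin (top_of_set S) W \<and> z \<in> W \<and> W \<subseteq> {z \<in> topspace (top_of_set S). p z \<in> U}"
      proof (cases "z = -1")
        case False
        have c: "continuous_on (S - {-1}) st"
          unfolding st_def by (intro continuous_intros) (use pos in force)
        have o: "openin (top_of_set S) (S - {-1})"
          by (auto simp: openin_open intro!: exI[of _ "- {-1}"])
        have "openin (top_of_set (S - {-1})) ((S - {-1}) \<inter> st -` T)"
          using c T by (simp add: continuous_on_open_gen[of st _ UNIV] )
        then have "openin (top_of_set S) ((S - {-1}) \<inter> st -` T)"
          using o openin_trans by blast
        then show ?thesis
          using z False by (intro exI[of _ "(S - {-1}) \<inter> st -` T"]) (auto simp: p_def T_def)
      next
        case True
        then have yU: "y \<in> U" using z by (simp add: p_def)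
        have "\<forall>\<^sub>F u in at_top. f u \<in> U" "\<forall>\<^sub>F u in at_bot. f u \<in> U"
          using lim U yU by (auto simp: limitin_def)
        then obtain K1 K2 where K: "\<And>u. u \<ge> K1 \<Longrightarrow> f u \<in> U" "\<And>u. u \<le> K2 \<Longrightarrow> f u \<in> U"
          unfolding eventually_at_top_linorder eventually_at_bot_linorder by blast
        define K where "K = \<bar>K1\<bar> + \<bar>K2\<bar>"
        have Kf: "f u \<in> U" if "K \<le> \<bar>u\<bar>" for u
          using K that unfolding K_def by (cases "u \<ge> 0") auto
        \<comment> \<open>On the circle away from -1 the condition means K < |\<open>st z\<close>|;
          at -1 itself it reads 0 < 2.\<close>
        define W where "W = {z. K\<^sup>2 * (1 + Re z) < 1 - Re z}"
        have "open W" unfolding W_def by (intro open_Collect_less continuous_intros)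
        then have "openin (top_of_set S) (S \<inter> W)" by (simp add: openin_open_Int)
        moreover have "z \<in> S \<inter> W" using z True by (simp add: W_def)
        moreover have "p w \<in> U" if w: "w \<in> S \<inter> W" for w
        proof (cases "w = -1")
          case False
          have "K\<^sup>2 * (1 + Re w) < (st w)\<^sup>2 * (1 + Re w)"
            using w sq[OF _ False] by (simp add: W_def)
          then have "K\<^sup>2 < (st w)\<^sup>2" using pos[OF _ False] w by simp
          then have "K \<le> \<bar>st w\<bar>"
            using abs_le_square_iff[of K "st w"] by (simp add: K_def)
          then show ?thesis using False Kf by (simp add: p_def)
        qed (simp add: p_def yU)
        ultimately show ?thesis by (intro exI[of _ "S \<inter> W"]) auto
      qed
    qed
  qed
  have injp: "inj_on p S"
  proof (rule inj_onI)
    fix z w assume zw: "z \<in> S" "w \<in> S" "p z = p w"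
    show "z = w"
    proof (cases "z = -1 \<or> w = -1")
      case True
      then show ?thesis using zw(3) y by (auto simp: p_def split: if_splits)
    next
      case False
      then have st: "st z = st w" using zw(3) f by (auto simp: p_def open_arc_def dest: injD)
      have "(st w)\<^sup>2 * (1 + Re z) = 1 - Re z" "(st w)\<^sup>2 * (1 + Re w) = 1 - Re w"
        using sq[of z] sq[of w] zw False st by auto
      then have "((st w)\<^sup>2 + 1) * (Re z - Re w) = 0" by (simp add: algebra_simps)
      moreover have "(st w)\<^sup>2 + 1 \<noteq> 0" using zero_le_power2[of "st w"] by linarith
      ultimately have re: "Re z = Re w" by simp
      have "Im z = st z * (1 + Re z)" "Im w = st w * (1 + Re w)"
        using pos[of z] pos[of w] zw False by (auto simp: st_def)
      then show ?thesis using re st by (simp add: complex_eq_iff)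
    qed
  qed
  have surj: "insert y (range f) \<subseteq> p ` S"
  proof
    fix x assume "x \<in> insert y (range f)"
    then consider "x = y" | u where "x = f u" by blast
    then show "x \<in> p ` S"
    proof cases
      case 1
      then show ?thesis by (intro image_eqI[of _ _ "-1"]) (auto simp: p_def S_def)
    next
      case 2
      have u: "1 + u\<^sup>2 > 0" by (simp add: add_pos_nonneg)
      \<comment> \<open>The rational parametrization of the circle, inverse to
        \<open>st\<close>.\<close>
      define z where "z = Complex ((1 - u\<^sup>2) / (1 + u\<^sup>2)) (2 * u / (1 + u\<^sup>2))"
      have "(cmod z)\<^sup>2 = ((1 - u\<^sup>2)\<^sup>2 + (2 * u)\<^sup>2) / (1 + u\<^sup>2)\<^sup>2"
        by (simp add: z_def cmod_power2 power_divide add_divide_distrib)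
      also have "(1 - u\<^sup>2)\<^sup>2 + (2 * u)\<^sup>2 = (1 + u\<^sup>2)\<^sup>2" by algebra
      finally have "(cmod z)\<^sup>2 = 1" using u by simp
      then have "z \<in> S" using power2_eq_1_iff[of "cmod z"] norm_ge_zero[of z] by (auto simp: S_def)
      have r: "1 + Re z = 2 / (1 + u\<^sup>2)" using u by (simp add: z_def field_simps)
      then have "z \<noteq> -1" using u by auto
      have "st z = u" unfolding st_def r using u by (simp add: z_def)
      then show ?thesis using \<open>z \<in> S\<close> \<open>z \<noteq> -1\<close> 2 by (intro image_eqI[of _ _ z]) (auto simp: p_def)
    qed
  qed
  have im: "p ` S = insert y (range f)" using surj by (auto simp: p_def)
  have comp: "compact_space (top_of_set S)" by (simp add: compact_space_subtopology S_def)
  have "compactin X (p ` S)"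
    using comp cont by (metis compact_space_def image_compactin topspace_euclidean_subtopology)
  then have "closedin X (insert y (range f))" using X(1) im by (simp add: compactin_imp_closedin)
  then have "insert y (range f) = topspace X"
    using op X(2) unfolding connected_space_clopen_in by blast
  then have "homeomorphic_map (top_of_set S) X p"
    by (intro continuous_imp_homeomorphic_map) (use comp X cont im injp in auto)
  then show ?thesis
    unfolding S_def using homeomorphic_map_imp_homeomorphic_space homeomorphic_space_sym by metis
qed

lemma Hausdorff_not_inseparable:
  assumes X: "Hausdorff_space X" and ne: "x \<noteq> z"
  shows "\<not> inseparable X x z"
proof
  assume i: "inseparable X x z"
  then have "x \<in> topspace X" "z \<in> topspace X" by (auto simp: inseparable_def)
  then obtain U V where "openin X U" "openin X V" "x \<in> U" "z \<in> V" "disjnt U V"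
    using X ne unfolding Hausdorff_space_def by metis
  then show False using i by (auto simp: inseparable_def disjnt_def)
qed

text \<open>If g both met and left the arc arbitrarily close to 0, some [a, b] with a > 0 would be
  an excursion through the arc, which by \<open>arc_between_ends\<close> covers all of it. The
  closure of the arc would then lie in the compact set g[a, b], which omits g 0.\<close>

lemma arc_side_alternative:
  assumes X: "Hausdorff_space X" and f: "open_arc X f" and g: "open_arc X g"
    and y: "g 0 \<in> X closure_of range f" "g 0 \<notin> range f"
  obtains e where "e > 0" "g ` {0<..<e} \<subseteq> range f" | e where "e > 0" "g ` {0<..<e} \<inter> range f = {}"
proof -
  note result = that
  have sep: "\<not> inseparable X x z" if "x \<noteq> z" for x z
    using Hausdorff_not_inseparable[OF X that] .
  define A where "A = {t. g t \<in> range f}"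
  have A: "open A"
    using openin_continuous_map_preimage[of euclideanreal X g "range f"] g open_arc_openin[OF f, of UNIV]
    by (simp add: open_arc_def A_def)
  show thesis
  proof (rule ccontr)
    assume neg: "\<not> thesis"
    have in1: "\<exists>t. 0 < t \<and> t < e \<and> t \<in> A" if e: "e > 0" for e
    proof (rule ccontr)
      assume n: "\<not> ?thesis"
      have "x \<notin> range f" if x: "x \<in> g ` {0<..<e}" for x
      proof -
        obtain t where t: "0 < t" "t < e" "x = g t" using x by auto
        then have "t \<notin> A" using n by blast
        then show ?thesis using t by (simp add: A_def)
      qed
      then have "g ` {0<..<e} \<inter> range f = {}" by blast
      from result(2)[OF e this] neg show False by argo
    qed
    have out1: "\<exists>t. 0 < t \<and> t < e \<and> t \<notin> A" if "e > 0" for e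
      using result(1)[OF that] neg unfolding A_def by (metis (mono_tags, lifting) greaterThanLessThan_iff image_subsetI mem_Collect_eq)
    obtain p where p: "0 < p" "p \<notin> A" using out1[of 1] by auto
    obtain q where q: "0 < q" "q < p" "q \<in> A" using in1 p by blast
    obtain r where r: "0 < r" "r < q" "r \<notin> A" using out1 q by blast
    obtain a b where ab: "r \<le> a" "a < q" "q < b" "a \<notin> A" "b \<notin> A" "{a<..<b} \<subseteq> A"
      by (rule open_real_component[OF A r(2) q(2) r(3) p(2) q(3)])
    have gc: "continuous_map (top_of_set {a..b}) X g"
      using g by (auto simp: open_arc_def intro: continuous_map_from_subtopology)
    have "g ` {a<..<b} = range f"
    proof (rule arc_between_ends[OF f])
      show "a < b" using ab by linarith
      show "inj_on g {a<..<b}" using g by (auto simp: open_arc_def inj_on_def)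
      show "g ` {a<..<b} \<subseteq> range f" using ab(6) by (auto simp: A_def)
      show "\<not> inseparable X (f t) (g a)" for t
        using ab(4) by (intro sep) (metis A_def mem_Collect_eq rangeI)
      show "\<not> inseparable X (f t) (g b)" for t
        using ab(5) by (intro sep) (metis A_def mem_Collect_eq rangeI)
    qed (rule gc)
    then have sub: "range f \<subseteq> g ` {a..b}" by force
    have "compactin X (g ` {a..b})"
      by (rule image_compactin[of euclideanreal]) (use g in \<open>auto simp: open_arc_def\<close>)
    then have "X closure_of range f \<subseteq> g ` {a..b}"
      using sub X by (simp add: closure_of_minimal compactin_imp_closedin)
    then obtain t where "t \<in> {a..b}" "g t = g 0" using y by force
    then have "t = 0" using g by (auto simp: open_arc_def dest: injD)
    then show False using \<open>t \<in> {a..b}\<close> ab r by auto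
  qed
qed

text \<open>Follow f up to a point shared with g, then run g backwards through g 0 and beyond. All
  of f is still contained, since its tail is covered by g on (0, 1].\<close>

lemma arc_extends_past_end:
  assumes X: "locally_line X" and f: "open_arc X f" and g: "open_arc X g"
    and pos: "\<And>t. 0 < t \<Longrightarrow> g t \<in> range f" and neg: "\<And>t. t \<le> 0 \<Longrightarrow> g t \<notin> range f"
    and top: "filterlim (inv f \<circ> g) at_top (at_right 0)"
  obtains h where "open_arc X h" "insert (g 0) (range f) \<subseteq> range h"
proof -
  define \<tau> where "\<tau> = inv f \<circ> g"
  have f\<tau>: "f (\<tau> t) = g t" if "0 < t" for t
    using pos[OF that] by (simp add: \<tau>_def f_inv_into_f)
  have injf: "f s = f t \<longleftrightarrow> s = t" and injg: "g s = g t \<longleftrightarrow> s = t" for s t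
    using f g by (auto simp: open_arc_def inj_eq)
  have gc: "continuous_map (top_of_set {0<..<2}) X g"
    using g by (auto simp: open_arc_def intro: continuous_map_from_subtopology)
  have c: "continuous_on {0<..<2} \<tau>"
    using continuous_map_inv_open_arc[OF f gc] pos by (simp add: \<tau>_def image_subset_iff)
  have ivt: "\<exists>w. 0 < w \<and> w \<le> v \<and> \<tau> w = u" if "0 < v" "v \<le> 1" "\<tau> v \<le> u" for u v
    by (rule IVT_at_right_top[OF c, of v u]) (use that top in \<open>auto simp: \<tau>_def\<close>)
  define K where "K = \<tau> 1"
  \<comment> \<open>The junction is \<open>f K = g 1\<close>; beyond it g is run backwards, so g 0
    is reached at t = 1 + K.\<close>
  define h where "h t = (if t \<le> K then f t else g (1 + K - t))" for t
  have eqK: "f K = g (1 + K - K)" using f\<tau>[of 1] by (simp add: K_def)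
  have "continuous_map euclideanreal X (\<lambda>t. if t \<le> K then f t else g (1 + K - t))"
  proof (rule continuous_map_cases_le)
    show "continuous_map (subtopology euclideanreal {x \<in> topspace euclideanreal. x \<le> K}) X f"
      using f by (auto simp: open_arc_def intro: continuous_map_from_subtopology)
    have "continuous_map euclideanreal X (g \<circ> (\<lambda>t. 1 + K - t))"
      using g by (intro continuous_map_compose[of _ euclideanreal]) (auto simp: open_arc_def intro!: continuous_intros)
    then show "continuous_map (subtopology euclideanreal {x \<in> topspace euclideanreal. K \<le> x}) X (\<lambda>t. g (1 + K - t))"
      by (auto simp: o_def intro: continuous_map_from_subtopology)
  qed (use eqK in auto)
  then have hc: "continuous_map euclideanreal X h" by (simp add: h_def[abs_def])
  \<comment> \<open>If f before the junction met g again at some v in (0, 1), then \<tau> on its way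
    to infinity would take the value K at a parameter other than 1, against injectivity of
    g.\<close>
  have mixed: "f s \<noteq> g (1 + K - t)" if st: "s \<le> K" "K < t" for s t
  proof
    assume eq: "f s = g (1 + K - t)"
    define v where "v = 1 + K - t"
    have v: "0 < v" using neg[of v] eq by (metis not_le rangeI v_def)
    have "v < 1" using st by (simp add: v_def)
    have "f (\<tau> v) = f s" using f\<tau>[OF v] eq by (simp add: v_def)
    then have "\<tau> v = s" by (simp only: injf)
    then obtain w where w: "0 < w" "w \<le> v" "\<tau> w = K"
      using ivt[of v K] v \<open>v < 1\<close> st by auto
    have "g w = g 1" using f\<tau>[OF w(1)] f\<tau>[of 1] w(3) by (simp add: K_def)
    then show False using injg w \<open>v < 1\<close> by auto
  qed
  have "inj h"
  proof (rule injI)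
    fix s t assume "h s = h t"
    then show "s = t"
      using mixed[of s t] mixed[of t s] injf injg unfolding h_def
      by (cases "s \<le> K"; cases "t \<le> K") (auto simp: not_le dest: sym)
  qed
  then have h: "open_arc X h" using open_arcI[OF X hc] by simp
  have "f u \<in> range h" for u
  proof (cases "u \<le> K")
    case True
    then have "f u = h u" by (simp add: h_def)
    then show ?thesis by blast
  next
    case False
    then obtain w where w: "0 < w" "w \<le> 1" "\<tau> w = u" using ivt[of 1 u] by (auto simp: K_def)
    moreover have "w \<noteq> 1" using w False by (auto simp: K_def)
    ultimately have "h (1 + K - w) = f u" using f\<tau>[OF w(1)] by (simp add: h_def)
    then show ?thesis by (metis rangeI)
  qed
  moreover have "g 0 = h (1 + K)" by (simp add: h_def)
  ultimately show thesis using that[OF h] by auto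
qed


text \<open>Take a maximal arc. If it is not all of X, connectedness gives a point y in its closure
  but not on it; centre an arc g at y. Each side of g near y lies in the maximal arc or avoids it.
  No side inside: y would not be in the closure. One inside: the arc could be prolonged past y. Both
  inside: they run to different ends, and y closes the arc to a circle.\<close>

lemma line_or_circle:
  assumes X: "locally_line X" "Hausdorff_space X" "connected_space X"
    and base: "has_countable_base X" and ne: "topspace X \<noteq> {}"
  shows "(\<exists>f. open_arc X f \<and> range f = topspace X) \<or> X homeomorphic_space top_of_set (sphere (0::complex) 1)"
proof -
  obtain m where m: "open_arc X m" "\<And>g. open_arc X g \<Longrightarrow> range m \<subseteq> range g \<Longrightarrow> range g \<subseteq> range m"
    using ex_maximal_open_arc[OF X(1) base ne] by blast
  show ?thesis
  proof (cases "range m = topspace X")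
    case True
    then show ?thesis using m(1) by blast
  next
    case False
    have mo: "openin X (range m)" by (rule open_arc_openin[OF m(1)]) simp
    have "\<not> closedin X (range m)"
      using False mo X(3) unfolding connected_space_clopen_in by blast
    then have "\<not> X closure_of range m \<subseteq> range m"
      using closure_of_subset_eq[of "range m" X] openin_subset[OF mo] by metis
    then obtain y where y: "y \<in> X closure_of range m" "y \<notin> range m" by blast
    have "y \<in> topspace X" using y(1) closure_of_subset_topspace by (metis subsetD)
    then obtain g0 where g0: "open_arc X g0" "g0 0 = y"
      using X(1) unfolding locally_line_def by metis
    \<comment> \<open>Here f is the maximal arc, possibly reversed so that the positive side of g
      runs to its upper end.\<close>
    have circle: ?thesis
      if f: "open_arc X f" "range f = range m" and g: "open_arc X g" "g 0 = y"
        and e: "e > 0" "g ` {0<..<e} \<subseteq> range f"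
        and top: "filterlim (inv f \<circ> g) at_top (at_right 0)" "limitin X f y at_top" for f g e
    proof -
      have g': "open_arc X (\<lambda>t. g (- t))" by (rule open_arc_uminus[OF g(1)])
      have injg: "g s = g t \<longleftrightarrow> s = t" for s t
        using g by (auto simp: open_arc_def inj_eq)
      have sep: "\<not> inseparable X (f t) y" for t
        by (rule Hausdorff_not_inseparable[OF X(2)]) (use y(2) f(2) in auto)
      have yc: "g (- 0) \<in> X closure_of range f" "g (- 0) \<notin> range f" using y f(2) g(2) by auto
      obtain d where d: "d > 0" "(\<lambda>t. g (- t)) ` {0<..<d} \<subseteq> range f"
      proof (rule arc_side_alternative[OF X(2) f(1) g' yc])
        fix d assume d: "d > 0" "(\<lambda>t. g (- t)) ` {0<..<d} \<inter> range f = {}"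
        \<comment> \<open>Squeezing g around y turns the local alternatives into global ones:
          positive parameters land on f and all others off it, as
          \<open>arc_extends_past_end\<close> demands.\<close>
        obtain q :: "real \<Rightarrow> real" where q: "continuous_on UNIV q" "inj q" "q 0 = 0"
            "\<And>s. \<bar>q s\<bar> < min e d" "\<And>s. 0 < q s \<longleftrightarrow> 0 < s"
          using ex_squash[of "min e d"] d(1) e(1) by (metis min_less_iff_conj)
        have gq: "open_arc X (g \<circ> q)" by (rule open_arc_compose[OF g(1) q(1,2)])
        have "(g \<circ> q) t \<in> range f" if "0 < t" for t
          using e(2) q(4)[of t] q(5)[of t] that by (auto simp: image_subset_iff)
        moreover have "(g \<circ> q) t \<notin> range f" if "t \<le> 0" for t
        proof (cases "q t = 0")
          case True
          then show ?thesis using y(2) f(2) g(2) by simp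
        next
          case False
          then have "- q t \<in> {0<..<d}" using q(4)[of t] q(5)[of t] that by auto
          then have "g (- (- q t)) \<notin> range f" using d(2) by blast
          then show ?thesis by simp
        qed
        moreover have "filterlim (inv f \<circ> (g \<circ> q)) at_top (at_right 0)"
        proof -
          have "(q \<longlongrightarrow> q 0) (at_right 0)"
            using q(1) by (simp add: continuous_on_def filterlim_at_split)
          moreover have "\<forall>\<^sub>F t in at_right 0. q t \<in> {0<..} \<and> q t \<noteq> 0"
            unfolding eventually_at_right_field using q(5) by (metis greaterThan_iff less_irrefl zero_less_one)
          ultimately have "filterlim q (at_right 0) (at_right 0)"
            using q(3) by (simp add: filterlim_at)
          then show ?thesis
            using filterlim_compose[OF top(1)] by (simp add: o_def)
        qed
        ultimately obtain h where h: "open_arc X h" "insert ((g \<circ> q) 0) (range f) \<subseteq> range h"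
          using arc_extends_past_end[OF X(1) f(1) gq] by blast
        then have "range h \<subseteq> range m" using m(2)[OF h(1)] f(2) by blast
        then have False using h(2) y(2) q(3) g(2) by auto
        then show thesis ..
      qed
      have gc: "continuous_map (top_of_set {0<..<d}) X (\<lambda>t. g (- t))"
        using g' by (auto simp: open_arc_def intro: continuous_map_from_subtopology)
      have gc2: "continuous_map (top_of_set {0..<d}) X (\<lambda>t. g (- t))"
        using g' by (auto simp: open_arc_def intro: continuous_map_from_subtopology)
      have lim: "limitin X (\<lambda>t. g (- t)) y (at_right 0)"
        using limitin_at_right[OF gc2 d(1)] g(2) by simp
      have bot: "limitin X f y at_bot"
      proof -
        have "\<not> filterlim (inv f \<circ> (\<lambda>t. g (- t))) at_top (at_right 0)"
        proof
          assume t: "filterlim (inv f \<circ> (\<lambda>t. g (- t))) at_top (at_right 0)"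
          have c: "continuous_on {0<..<d} (inv f \<circ> (\<lambda>t. g (- t)))"
            using continuous_map_inv_open_arc[OF f(1) gc] d(2) by simp
          have gce: "continuous_map (top_of_set {0<..<e}) X g"
            using g by (auto simp: open_arc_def intro: continuous_map_from_subtopology)
          have ce: "continuous_on {0<..<e} (inv f \<circ> g)"
            using continuous_map_inv_open_arc[OF f(1) gce] e(2) by simp
          \<comment> \<open>If both sides ran to the same end, both would take the coordinate u, and
            g would pass one point at w > 0 and at -v < 0.\<close>
          define u where "u = max (inv f (g (e/2))) (inv f (g (- (d/2))))"
          obtain w where w: "0 < w" "w \<le> e/2" "(inv f \<circ> g) w = u"
            by (rule IVT_at_right_top[OF ce top(1), of "e/2" u]) (use e in \<open>auto simp: u_def\<close>)
          obtain v where v: "0 < v" "v \<le> d/2" "(inv f \<circ> (\<lambda>t. g (- t))) v = u"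
            by (rule IVT_at_right_top[OF c t, of "d/2" u]) (use d in \<open>auto simp: u_def\<close>)
          have "g w \<in> range f" "g (- v) \<in> range f"
            using w v e d by (auto simp: image_subset_iff)
          then have "g w = g (- v)"
            using w(3) v(3) by (metis comp_apply f_inv_into_f)
          then show False using injg[of w "-v"] w(1) v(1) by simp
        qed
        then show ?thesis using arc_end[OF f(1) d(1) gc d(2) lim sep] by blast
      qed
      \<comment> \<open>The neighbourhood g(-d, e) of y consists of y and points of f, so adjoining
        y to the range keeps it open.\<close>
      have "openin X (range f \<union> g ` {-d<..<e})"
        using mo f(2) open_arc_openin[OF g(1), of "{-d<..<e}"] by auto
      moreover have "range f \<union> g ` {-d<..<e} = insert y (range f)"
      proof -
        have "g t \<in> insert y (range f)" if t: "-d < t" "t < e" for t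
        proof -
          consider "t < 0" | "t = 0" | "t > 0" by linarith
          then show ?thesis
          proof cases
            case 1
            then have "g (- (- t)) \<in> range f"
              using d(2) t by (intro subsetD[OF d(2)] image_eqI[of _ _ "-t"]) auto
            then show ?thesis by simp
          next
            case 2
            then show ?thesis using g(2) by simp
          next
            case 3
            then have "g t \<in> g ` {0<..<e}" using t by simp
            then show ?thesis using e(2) by blast
          qed
        qed
        then have "g ` {-d<..<e} \<subseteq> insert y (range f)" by (intro image_subsetI) simp
        moreover have "y \<in> g ` {-d<..<e}" using g(2) d(1) e(1) by (intro image_eqI[of _ _ 0]) auto
        ultimately show ?thesis by blast
      qed
      ultimately have "openin X (insert y (range f))" by simp
      then show ?thesis
        using circle_of_arc[OF f(1) X(2,3) top(2) bot] y(2) f(2) by blast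
    qed
    \<comment> \<open>A side that runs to the lower end is handled by reversing the maximal
      arc.\<close>
    have half: ?thesis if g: "open_arc X g" "g 0 = y" and e: "e > 0" "g ` {0<..<e} \<subseteq> range m" for g e
    proof -
      have gc: "continuous_map (top_of_set {0<..<e}) X g" "continuous_map (top_of_set {0..<e}) X g"
        using g by (auto simp: open_arc_def intro: continuous_map_from_subtopology)
      have lim: "limitin X g y (at_right 0)"
        using limitin_at_right[OF gc(2) e(1)] g(2) by simp
      have sep: "\<not> inseparable X (m t) y" for t
        by (rule Hausdorff_not_inseparable[OF X(2)]) (use y(2) in auto)
      from arc_end[OF m(1) e(1) gc(1) e(2) lim sep] show ?thesis
      proof (elim disjE conjE)
        assume "filterlim (inv m \<circ> g) at_top (at_right 0)" "limitin X m y at_top"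
        then show ?thesis using circle[OF m(1) refl g e] by blast
      next
        assume b: "filterlim (inv m \<circ> g) at_bot (at_right 0)" "limitin X m y at_bot"
        define n where "n t = m (- t)" for t
        have n: "open_arc X n" unfolding n_def by (rule open_arc_uminus[OF m(1)])
        have "range n = m ` range uminus" unfolding image_image n_def ..
        also have "range uminus = (UNIV :: real set)" by (metis minus_minus surjI)
        finally have rn: "range n = range m" .
        have inv: "(inv n \<circ> g) t = - (inv m \<circ> g) t" if "g t \<in> range m" for t
        proof -
          have "n (- inv m (g t)) = g t" using that by (simp add: n_def f_inv_into_f)
          then show ?thesis using n by (metis comp_apply inv_f_f open_arc_def)
        qed
        have "filterlim (\<lambda>t. - (inv m \<circ> g) t) at_top (at_right 0)"
          using b(1) by (simp add: filterlim_uminus_at_top o_def)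
        moreover have "\<forall>\<^sub>F t in at_right 0. - (inv m \<circ> g) t = (inv n \<circ> g) t"
          using eventually_at_right_real[OF e(1)]
          by eventually_elim (use inv e(2) in \<open>auto simp: image_subset_iff\<close>)
        ultimately have "filterlim (inv n \<circ> g) at_top (at_right 0)"
          by (rule filterlim_cong[OF refl refl, THEN iffD1, rotated])
        moreover have "limitin X n y at_top"
          unfolding limitin_def
        proof (intro conjI allI impI)
          show "y \<in> topspace X" using b(2) by (simp add: limitin_def)
          fix U assume "openin X U \<and> y \<in> U"
          then have "\<forall>\<^sub>F t in at_bot. m t \<in> U" using b(2) by (simp add: limitin_def)
          then show "\<forall>\<^sub>F t in at_top. n t \<in> U"
            by (simp add: n_def at_bot_mirror eventually_filtermap)
        qed
        ultimately show ?thesis using circle[OF n rn g e(1)] e(2) rn by blast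
      qed
    qed
    have y0: "g0 0 \<in> X closure_of range m" "g0 0 \<notin> range m" using y g0(2) by auto
    have g1: "open_arc X (\<lambda>t. g0 (- t))" by (rule open_arc_uminus[OF g0(1)])
    have y1: "g0 (- 0) \<in> X closure_of range m" "g0 (- 0) \<notin> range m" using y g0(2) by auto
    show ?thesis
    proof (rule arc_side_alternative[OF X(2) m(1) g0(1) y0])
      fix e assume "e > 0" "g0 ` {0<..<e} \<subseteq> range m"
      then show ?thesis using half[OF g0] by blast
    next
      fix e assume e: "e > 0" "g0 ` {0<..<e} \<inter> range m = {}"
      show ?thesis
      proof (rule arc_side_alternative[OF X(2) m(1) g1 y1])
        fix d assume "d > 0" "(\<lambda>t. g0 (- t)) ` {0<..<d} \<subseteq> range m"
        then show ?thesis using half[OF g1] g0(2) by simp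
      next
        fix d assume d: "d > 0" "(\<lambda>t. g0 (- t)) ` {0<..<d} \<inter> range m = {}"
        have "g0 t \<notin> range m" if t: "-d < t" "t < e" for t
        proof -
          consider "t < 0" | "t = 0" | "t > 0" by linarith
          then show ?thesis
          proof cases
            case 1
            then have "g0 (- (- t)) \<in> (\<lambda>t. g0 (- t)) ` {0<..<d}"
              using t by (intro image_eqI[of _ _ "-t"]) auto
            then show ?thesis using d(2) by auto
          next
            case 2
            then show ?thesis using g0(2) y by simp
          next
            case 3
            then have "g0 t \<in> g0 ` {0<..<e}" using t by simp
            then show ?thesis using e(2) by blast
          qed
        qed
        then have "z \<notin> range m" if "z \<in> g0 ` {-d<..<e}" for z
          using that by (elim imageE) simp
        then have "g0 ` {-d<..<e} \<inter> range m = {}" by blast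
        moreover have "openin X (g0 ` {-d<..<e})" by (rule open_arc_openin[OF g0(1)]) simp
        moreover have "y \<in> g0 ` {-d<..<e}" using g0(2) d(1) e(1) by (intro image_eqI[of _ _ 0]) auto
        ultimately have False using y(1) unfolding in_closure_of by blast
        then show ?thesis ..
      qed
    qed
  qed
qed


section \<open>Half arcs and the chain quotient\<close>

lemma open_arc_subtopology:
  assumes "openin X C" "range f \<subseteq> C"
  shows "open_arc (subtopology X C) f \<longleftrightarrow> open_arc X f"
proof -
  have "open_map euclideanreal (subtopology X C) f \<longleftrightarrow> open_map euclideanreal X f"
    unfolding open_map_def using assms by (metis image_mono openin_open_subtopology order_trans top_greatest)
  then show ?thesis
    using assms(2) unfolding open_arc_def continuous_map_in_subtopology by auto
qed

lemma open_arc_second_countable: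
  assumes f: "open_arc X f"
  shows "has_countable_base (subtopology X (range f))"
proof -
  obtain B :: "real set set" where B: "countable B" "topological_basis B"
    using ex_countable_basis by blast
  show ?thesis
    unfolding has_countable_base_def
  proof (rule exI[of _ "(\<lambda>b. f ` b) ` B"], intro conjI ballI allI impI)
    show "countable ((\<lambda>b. f ` b) ` B)" using B(1) by simp
    fix U assume "U \<in> (\<lambda>b. f ` b) ` B"
    then obtain b where b: "b \<in> B" "U = f ` b" by blast
    have "openin X U" using open_arc_openin[OF f] topological_basis_open[OF B(2) b(1)] b(2) by simp
    then show "openin (subtopology X (range f)) U"
      using b(2) by (simp add: open_arc_openin[OF f] openin_open_subtopology image_mono)
  next
    fix U assume "openin (subtopology X (range f)) U"
    then have U: "openin X U" "U \<subseteq> range f"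
      by (simp_all add: open_arc_openin[OF f] openin_open_subtopology)
    have "open {t. f t \<in> U}"
      using openin_continuous_map_preimage[of euclideanreal X f U] f U(1) by (simp add: open_arc_def)
    then obtain B' where B': "B' \<subseteq> B" "\<Union>B' = {t. f t \<in> U}"
      using B(2) unfolding topological_basis_def by blast
    have "U = f ` {t. f t \<in> U}" using U(2) by auto
    also have "\<dots> = \<Union>((\<lambda>b. f ` b) ` B')" unfolding B'(2)[symmetric] by (rule image_Union)
    finally show "\<exists>\<C>\<subseteq>(\<lambda>b. f ` b) ` B. U = \<Union>\<C>" using image_mono[OF B'(1)] by metis
  qed
qed

section \<open>Charts, the boundary, and half arcs at a point\<close>

lemma chart_parametrization:
  assumes U: "openin M U" and h: "homeomorphic_map (subtopology M U) (top_of_set J) h"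
  obtains g where "continuous_map (top_of_set J) M g" "open_map (top_of_set J) M g" "inj_on g J"
    "g ` J = U" "\<And>x. x \<in> U \<Longrightarrow> h x \<in> J \<and> g (h x) = x"
proof -
  obtain g where hg: "homeomorphic_maps (subtopology M U) (top_of_set J) h g"
    using h homeomorphic_map_maps by blast
  have tU: "topspace (subtopology M U) = U" using openin_subset[OF U] by auto
  have g: "homeomorphic_map (top_of_set J) (subtopology M U) g"
    using hg homeomorphic_maps_map by blast
  show thesis
  proof (rule that)
    show "continuous_map (top_of_set J) M g"
      using homeomorphic_imp_continuous_map[OF g] continuous_map_in_subtopology by blast
    show "open_map (top_of_set J) M g"
      using homeomorphic_imp_open_map[OF g] U unfolding open_map_def
      by (simp add: openin_open_subtopology)
    show "inj_on g J" using homeomorphic_imp_injective_map[OF g] by simp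
    show "g ` J = U" using homeomorphic_imp_surjective_map[OF g] tU by simp
    fix x assume x: "x \<in> U"
    show "h x \<in> J \<and> g (h x) = x"
      using hg x tU continuous_map_image_subset_topspace[of "subtopology M U" "top_of_set J" h]
      unfolding homeomorphic_maps_def by auto
  qed
qed

lemma chart_open_arc:
  fixes g :: "real \<Rightarrow> 'a"
  assumes g: "continuous_map (top_of_set J) M g" "open_map (top_of_set J) M g" "inj_on g J"
    and e: "0 < e" "{t-e<..<t+e} \<subseteq> J"
  obtains f where "open_arc M f" "f 0 = g t"
proof -
  obtain q :: "real \<Rightarrow> real" where q: "continuous_on UNIV q" "inj q" "q 0 = 0" "\<And>s. \<bar>q s\<bar> < e"
    using ex_squash[OF e(1)] by metis
  define k where "k s = t + q s" for s
  have kJ: "k s \<in> {t-e<..<t+e}" for s using q(4)[of s] by (auto simp: k_def abs_less_iff)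
  have kc: "continuous_on UNIV k" unfolding k_def by (intro continuous_intros q(1))
  have ki: "inj k" using q(2) by (simp add: k_def inj_def)
  show thesis
  proof (rule that)
    show "(g \<circ> k) 0 = g t" using q(3) by (simp add: k_def)
    have "continuous_map euclideanreal (top_of_set J) k"
      using kc kJ e(2) by (auto simp: continuous_map_in_subtopology)
    then have "continuous_map euclideanreal M (g \<circ> k)" by (rule continuous_map_compose[OF _ g(1)])
    moreover have "inj (g \<circ> k)"
    proof (rule comp_inj_on[OF ki])
      have "range k \<subseteq> J" using kJ e(2) by blast
      then show "inj_on g (range k)" by (rule inj_on_subset[OF g(3)])
    qed
    moreover have "openin M ((g \<circ> k) ` T)" if "open T" for T
    proof -
      have "open (k ` T)"
        by (rule invariance_of_domain) (use that kc ki in \<open>auto intro: continuous_on_subset inj_on_subset\<close>)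
      moreover have "k ` T \<subseteq> J" using kJ e(2) by blast
      ultimately have "openin (top_of_set J) (k ` T)" by (metis open_subset)
      then have "openin M (g ` k ` T)" using g(2) unfolding open_map_def by blast
      then show ?thesis by (simp only: image_comp)
    qed
    ultimately show "open_arc M (g \<circ> k)" by (simp add: open_arc_def open_map_def)
  qed
qed

text \<open>Only a half-open chart that sends x to 0 itself leads to the boundary case; at any other
  position there is room for an arc around x.\<close>

lemma one_manifold_cases:
  assumes M: "one_manifold M" and x: "x \<in> topspace M"
  obtains (interior) f where "open_arc M f" "f 0 = x"
  | (boundary) g where "x \<in> manifold_boundary M" "continuous_map (top_of_set {0..<1::real}) M g"
      "open_map (top_of_set {0..<1}) M g" "inj_on g {0..<1}" "g 0 = x"
proof -
  obtain U where U: "openin M U" "x \<in> U"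
    and c: "subtopology M U homeomorphic_space top_of_set {-1<..<1::real} \<or>
         subtopology M U homeomorphic_space top_of_set {0..<1::real}"
    using M x unfolding one_manifold_def by blast
  from c show thesis
  proof
    assume "subtopology M U homeomorphic_space top_of_set {-1<..<1::real}"
    then obtain h where "homeomorphic_map (subtopology M U) (top_of_set {-1<..<1::real}) h"
      using homeomorphic_space by blast
    then obtain g where g: "continuous_map (top_of_set {-1<..<1::real}) M g"
      "open_map (top_of_set {-1<..<1}) M g" "inj_on g {-1<..<1}"
      and hx: "h x \<in> {-1<..<1}" "g (h x) = x"
      using chart_parametrization[OF U(1)] U(2) by (metis (no_types, lifting))
    define e where "e = min (1 - h x) (1 + h x)"
    have "0 < e" "{h x-e<..<h x+e} \<subseteq> {-1<..<1}" using hx(1) by (auto simp: e_def)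
    then obtain f where "open_arc M f" "f 0 = g (h x)" using chart_open_arc[OF g] by blast
    then show thesis using interior hx(2) by simp
  next
    assume "subtopology M U homeomorphic_space top_of_set {0..<1::real}"
    then obtain h where h: "homeomorphic_map (subtopology M U) (top_of_set {0..<1::real}) h"
      using homeomorphic_space by blast
    then obtain g where g: "continuous_map (top_of_set {0..<1::real}) M g"
      "open_map (top_of_set {0..<1}) M g" "inj_on g {0..<1}"
      and hx: "h x \<in> {0..<1}" "g (h x) = x"
      using chart_parametrization[OF U(1)] U(2) by (metis (no_types, lifting))
    show thesis
    proof (cases "h x = 0")
      case True
      then have "x \<in> manifold_boundary M" using U h by (auto simp: manifold_boundary_def)
      then show thesis using boundary g hx(2) True by metis
    next
      case False
      define e where "e = min (1 - h x) (h x)"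
      have "0 < e" "{h x-e<..<h x+e} \<subseteq> {0..<1}" using hx(1) False by (auto simp: e_def)
      then obtain f where "open_arc M f" "f 0 = g (h x)" using chart_open_arc[OF g] by blast
      then show thesis using interior hx(2) by simp
    qed
  qed
qed

text \<open>\<open>[0, 1)\<close> is not open in the line, so no chart can turn an interior point into a boundary point.\<close>

lemma arc_avoids_boundary:
  fixes g :: "real \<Rightarrow> 'a"
  assumes g: "continuous_map (top_of_set S) M g" "inj_on g S" and S: "open S" and t: "t \<in> S"
  shows "g t \<notin> manifold_boundary M"
proof
  assume "g t \<in> manifold_boundary M"
  then obtain U h where U: "openin M U" "g t \<in> U"
    and h: "homeomorphic_map (subtopology M U) (top_of_set {0..<1::real}) h" "h (g t) = 0"
    by (auto simp: manifold_boundary_def)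
  have tU: "topspace (subtopology M U) = U" using openin_subset[OF U(1)] by auto
  define N where "N = {s \<in> S. g s \<in> U}"
  have "openin (top_of_set S) {s \<in> topspace (top_of_set S). g s \<in> U}"
    by (rule openin_continuous_map_preimage[OF g(1) U(1)])
  then have N: "open N" using S by (simp add: openin_open_eq N_def)
  have "continuous_map (top_of_set N) M g"
    by (rule continuous_map_from_subtopology_mono[OF g(1)]) (auto simp: N_def)
  then have gN: "continuous_map (top_of_set N) (subtopology M U) g"
    by (auto simp: continuous_map_in_subtopology N_def)
  have hg: "continuous_map (top_of_set N) (top_of_set {0..<1}) (h \<circ> g)"
    by (rule continuous_map_compose[OF gN homeomorphic_imp_continuous_map[OF h(1)]])
  then have c: "continuous_on N (h \<circ> g)" and r: "(h \<circ> g) ` N \<subseteq> {0..<1}"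
    by (auto simp: continuous_map_in_subtopology)
  have "inj_on (h \<circ> g) N"
  proof (rule comp_inj_on)
    show "inj_on g N" using g(2) by (rule inj_on_subset) (auto simp: N_def)
    show "inj_on h (g ` N)"
      using homeomorphic_imp_injective_map[OF h(1)] tU by (auto simp: N_def intro: inj_on_subset)
  qed
  then have "open ((h \<circ> g) ` N)" by (rule invariance_of_domain[OF c N])
  moreover have "0 \<in> (h \<circ> g) ` N" using t U(2) h(2) by (force simp: N_def)
  ultimately obtain e where "e > 0" "ball 0 e \<subseteq> (h \<circ> g) ` N" by (rule openE)
  then have "ball 0 e \<subseteq> {0..<1::real}" using r by (rule_tac order_trans)
  moreover have "- (e/2) \<in> ball 0 e" using \<open>e > 0\<close> by simp
  ultimately have "- (e/2) \<in> {0..<1::real}" by blast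
  then show False using \<open>e > 0\<close> by simp
qed

lemma locally_line_interior:
  assumes M: "one_manifold M" and C: "openin M C" "C \<inter> manifold_boundary M = {}"
  shows "locally_line (subtopology M C)"
  unfolding locally_line_def
proof
  fix x assume "x \<in> topspace (subtopology M C)"
  then have x: "x \<in> topspace M" "x \<in> C" by auto
  from M x(1) show "\<exists>f. open_arc (subtopology M C) f \<and> f 0 = x"
  proof (cases rule: one_manifold_cases)
    case (interior f)
    obtain f' where "open_arc M f'" "f' 0 = f 0" "range f' \<subseteq> C"
      by (rule open_arc_small[OF interior(1) C(1)]) (use interior(2) x(2) in auto)
    then show ?thesis using open_arc_subtopology[OF C(1)] interior(2) by auto
  next
    case boundary
    then show ?thesis using C(2) x(2) by blast
  qed
qed

text \<open>The half arcs \<open>G\<close> emanating from \<open>x\<close>: one at a boundary point, two at any other point.\<close>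

definition half_arcs :: "'a topology \<Rightarrow> 'a \<Rightarrow> (real \<Rightarrow> 'a) set \<Rightarrow> bool" where
  "half_arcs M x G \<longleftrightarrow> finite G \<and> G \<noteq> {} \<and>
     (\<forall>g\<in>G. g 0 = x \<and> continuous_map (top_of_set {0..<1}) M g \<and> inj_on g {0..<1} \<and>
        open_map (top_of_set {0<..<1}) M g) \<and>
     (\<forall>e. 0 < e \<and> e \<le> 1 \<longrightarrow> openin M (\<Union>g\<in>G. g ` {0..<e}))"

lemma half_arcs_exist:
  assumes M: "one_manifold M" and x: "x \<in> topspace M"
  obtains G where "half_arcs M x G"
  using assms
proof (cases rule: one_manifold_cases)
  case (interior f)
  have f': "open_arc M (\<lambda>t. f (- t))" by (rule open_arc_uminus[OF interior(1)])
  have *: "continuous_map (top_of_set {0..<1}) M g \<and> inj_on g {0..<1} \<and> open_map (top_of_set {0<..<1}) M g"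
    if g: "open_arc M g" for g
  proof (intro conjI)
    show "continuous_map (top_of_set {0..<1}) M g" "inj_on g {0..<1}"
      using g by (auto simp: open_arc_def inj_on_def intro: continuous_map_from_subtopology)
    show "open_map (top_of_set {0<..<1}) M g"
      unfolding open_map_def using open_arc_openin[OF g] by (simp add: openin_open_eq)
  qed
  have un: "f ` {0..<e} \<union> (\<lambda>t. f (- t)) ` {0..<e} = f ` {-e<..<e}" if e: "0 < e" for e
  proof (intro equalityI subsetI)
    fix z assume "z \<in> f ` {-e<..<e}"
    then obtain t where t: "t \<in> {-e<..<e}" "z = f t" by blast
    show "z \<in> f ` {0..<e} \<union> (\<lambda>t. f (- t)) ` {0..<e}"
    proof (cases "t \<ge> 0")
      case False
      then have "z \<in> (\<lambda>t. f (- t)) ` {0..<e}" using t by (intro image_eqI[of _ _ "-t"]) auto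
      then show ?thesis ..
    qed (use t in auto)
  qed (use e in auto)
  have "half_arcs M x {f, \<lambda>t. f (- t)}"
    unfolding half_arcs_def using *[OF interior(1)] *[OF f'] interior(2) un open_arc_openin[OF interior(1)]
    by simp
  then show thesis by (rule that)
next
  case (boundary g)
  have "half_arcs M x {g}"
    unfolding half_arcs_def
  proof (intro conjI ballI allI impI)
    fix g' assume "g' \<in> {g}"
    then show "g' 0 = x" "continuous_map (top_of_set {0..<1}) M g'" "inj_on g' {0..<1}"
      using boundary by auto
    have "openin M (g ` T)" if "openin (top_of_set {0<..<1}) T" for T
    proof -
      have "open T" "T \<subseteq> {0..<1}" using that by (auto simp: openin_open_eq)
      then have "openin (top_of_set {0..<1}) T" by (metis open_subset)
      then show ?thesis using boundary(3) unfolding open_map_def by blast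
    qed
    then show "open_map (top_of_set {0<..<1}) M g'" using \<open>g' \<in> {g}\<close> by (simp add: open_map_def)
  next
    fix e :: real assume e: "0 < e \<and> e \<le> 1"
    have "{0..<e} = {0..<1} \<inter> {..<e}" using e by auto
    then have "openin (top_of_set {0..<1}) {0..<e}" by (metis open_lessThan openin_open_Int)
    then show "openin M (\<Union>g\<in>{g}. g ` {0..<e})" using boundary(3) unfolding open_map_def by simp
  qed auto
  then show thesis by (rule that)
qed

lemma half_arc_avoids_boundary:
  assumes "half_arcs M x G" "g \<in> G" "0 < t" "t < 1"
  shows "g t \<notin> manifold_boundary M"
proof (rule arc_avoids_boundary)
  show "continuous_map (top_of_set {0<..<1}) M g"
    by (rule continuous_map_from_subtopology_mono[of _ "{0..<1}"]) (use assms in \<open>auto simp: half_arcs_def\<close>)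
  show "inj_on g {0<..<1}"
    by (rule inj_on_subset[of _ "{0..<1}"]) (use assms in \<open>auto simp: half_arcs_def\<close>)
qed (use assms in auto)

lemma half_arc_limit:
  assumes "half_arcs M x G" "g \<in> G"
  shows "limitin M g x (at_right 0)"
  using limitin_at_right[of 0 1 M g] assms by (auto simp: half_arcs_def)

text \<open>Reduces a neighbourhood of x to statements about each half arc separately; as G is
  finite, one bound d serves them all.\<close>

lemma half_arcs_neighbourhood:
  assumes G: "half_arcs M x G" and x: "x \<in> S"
    and ev: "\<And>g. g \<in> G \<Longrightarrow> \<forall>\<^sub>F t in at_right 0. g t \<in> S"
  obtains W where "openin M W" "x \<in> W" "W \<subseteq> S"
proof -
  have "\<forall>\<^sub>F t in at_right 0. \<forall>g\<in>G. g t \<in> S"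
    by (rule eventually_ball_finite) (use G ev in \<open>auto simp: half_arcs_def\<close>)
  then obtain d where d: "d > 0" "\<And>t g. 0 < t \<Longrightarrow> t < d \<Longrightarrow> g \<in> G \<Longrightarrow> g t \<in> S"
    unfolding eventually_at_right_field by blast
  define e where "e = min d 1"
  have e: "0 < e" "e \<le> 1" "e \<le> d" using d(1) by (auto simp: e_def)
  show thesis
  proof (rule that)
    show "openin M (\<Union>g\<in>G. g ` {0..<e})" using G e by (simp add: half_arcs_def)
    obtain g where g: "g \<in> G" using G by (auto simp: half_arcs_def)
    then have "g 0 = x" using G by (simp add: half_arcs_def)
    then show "x \<in> (\<Union>g\<in>G. g ` {0..<e})" using g e(1) by force
    have "g t \<in> S" if g: "g \<in> G" and t: "0 \<le> t" "t < e" for g t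
    proof (cases "t = 0")
      case True
      then show ?thesis using x G g by (simp add: half_arcs_def)
    next
      case False
      then show ?thesis using d(2)[of t g] g t e(3) by simp
    qed
    then show "(\<Union>g\<in>G. g ` {0..<e}) \<subseteq> S" by auto
  qed
qed

section \<open>Chain classes and the projection to the quotient\<close>

lemma nonbranch_inseparable:
  "x \<notin> branch_points M \<Longrightarrow> inseparable M x y \<Longrightarrow> x = y"
  by (auto simp: branch_points_def)

lemma chain_proj_eq_iff:
  assumes "x \<in> topspace M" "y \<in> topspace M"
  shows "chain_proj M x = chain_proj M y \<longleftrightarrow> (x, y) \<in> chain_inseparable M"
  unfolding chain_proj_def quotient_proj_def
  using assms eq_equiv_class_iff[OF equiv_chain_inseparable] by metis

lemma chain_proj_inseparable:
  assumes "inseparable M x y" shows "chain_proj M x = chain_proj M y"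
proof -
  have "x \<in> topspace M" "y \<in> topspace M" using assms by (auto simp: inseparable_def)
  then show ?thesis
    using assms by (auto simp: chain_proj_eq_iff chain_inseparable_def)
qed

text \<open>A chain cannot leave a point that is inseparable only from itself.\<close>

lemma chain_proj_nonbranch:
  assumes "chain_proj M x = chain_proj M y" "x \<in> topspace M" "y \<in> topspace M" "x \<notin> branch_points M"
  shows "x = y"
proof -
  have "(inseparable M)\<^sup>*\<^sup>* x y"
    using assms by (simp add: chain_proj_eq_iff chain_inseparable_def)
  then show ?thesis
    by (induction rule: rtranclp_induct) (use assms(4) nonbranch_inseparable in metis)+
qed

lemma quotient_map_chain_proj: "quotient_map M (chain_quotient M) (chain_proj M)"
  unfolding chain_quotient_def chain_proj_def by (rule quotient_map_quotient_proj)

lemma chain_proj_M1_eq: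
  assumes "x \<in> manifold_M1 M" "y \<in> topspace M" "chain_proj M x = chain_proj M y"
  shows "x = y"
  using chain_proj_nonbranch[OF assms(3)] assms by (auto simp: manifold_M1_def manifold_M0_def)

lemma M1_subset_topspace: "manifold_M1 M \<subseteq> topspace M"
  by (auto simp: manifold_M1_def)

lemma M0_subset_topspace: "manifold_M0 M \<subseteq> topspace M"
proof -
  have "manifold_boundary M \<subseteq> topspace M"
    using openin_subset by (fastforce simp: manifold_boundary_def)
  then show ?thesis by (auto simp: manifold_M0_def branch_points_def inseparable_def)
qed

lemma openin_chain_quotient:
  "openin (chain_quotient M) U \<longleftrightarrow>
     U \<subseteq> topspace (chain_quotient M) \<and> openin M {x \<in> topspace M. chain_proj M x \<in> U}"
  using quotient_map_chain_proj[of M] openin_subset unfolding quotient_map_def by metis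

lemma topspace_chain_quotient: "topspace (chain_quotient M) = chain_proj M ` topspace M"
  using quotient_map_chain_proj[of M] by (simp add: quotient_map_def)

text \<open>Points of M^1 are alone in their classes, so V is saturated.\<close>

lemma open_chain_proj_M1:
  assumes "openin M V" "V \<subseteq> manifold_M1 M"
  shows "openin (chain_quotient M) (chain_proj M ` V)"
proof -
  have "{x \<in> topspace M. chain_proj M x \<in> chain_proj M ` V} = V"
  proof (intro equalityI subsetI)
    fix x assume "x \<in> {x \<in> topspace M. chain_proj M x \<in> chain_proj M ` V}"
    then obtain v where "x \<in> topspace M" "v \<in> V" "chain_proj M v = chain_proj M x" by auto
    then show "x \<in> V" using chain_proj_M1_eq[of v M x] assms(2) by blast
  qed (use assms openin_subset in blast)
  moreover have "chain_proj M ` V \<subseteq> topspace (chain_quotient M)"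
    using openin_subset[OF assms(1)] by (auto simp: topspace_chain_quotient)
  ultimately show ?thesis using assms(1) by (simp add: openin_chain_quotient)
qed

text \<open>Matches the components of M^1 with those of its image, and allows edges of the quotient
  to be lifted back to M.\<close>

lemma homeomorphic_map_chain_proj_M1:
  assumes "openin M (manifold_M1 M)"
  shows "homeomorphic_map (subtopology M (manifold_M1 M))
           (subtopology (chain_quotient M) (chain_proj M ` manifold_M1 M)) (chain_proj M)"
proof (rule bijective_open_imp_homeomorphic_map)
  have c: "continuous_map M (chain_quotient M) (chain_proj M)"
    by (rule quotient_imp_continuous_map[OF quotient_map_chain_proj])
  have t: "topspace (subtopology M (manifold_M1 M)) = manifold_M1 M"
    using M1_subset_topspace[of M] by auto
  show "continuous_map (subtopology M (manifold_M1 M))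
           (subtopology (chain_quotient M) (chain_proj M ` manifold_M1 M)) (chain_proj M)"
    using continuous_map_from_subtopology[OF c] t by (simp add: continuous_map_in_subtopology)
  have "openin (chain_quotient M) (chain_proj M ` manifold_M1 M)"
    by (rule open_chain_proj_M1[OF assms]) simp
  then show "open_map (subtopology M (manifold_M1 M))
           (subtopology (chain_quotient M) (chain_proj M ` manifold_M1 M)) (chain_proj M)"
    unfolding open_map_def using assms open_chain_proj_M1[of M]
    by (simp add: openin_open_subtopology image_mono)
  show "chain_proj M ` topspace (subtopology M (manifold_M1 M)) =
      topspace (subtopology (chain_quotient M) (chain_proj M ` manifold_M1 M))"
    using M1_subset_topspace[of M] by (auto simp: topspace_chain_quotient)
  show "inj_on (chain_proj M) (topspace (subtopology M (manifold_M1 M)))"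
    unfolding t using chain_proj_M1_eq[of _ M] M1_subset_topspace[of M] by (auto intro!: inj_onI)
qed

text \<open>Each point of M^1 lies on an open arc in M^1; being connected, the arc stays in the
  component of that point.\<close>

lemma M1_component_open:
  assumes M: "one_manifold M" and op: "openin M (manifold_M1 M)"
    and C: "C \<in> connected_components_of (subtopology M (manifold_M1 M))"
  shows "openin M C"
proof (subst openin_subopen, intro ballI)
  fix x assume x: "x \<in> C"
  have C1: "C \<subseteq> manifold_M1 M"
    using connected_components_of_subset[OF C] by auto
  have "locally_line (subtopology M (manifold_M1 M))"
    by (rule locally_line_interior[OF M op]) (auto simp: manifold_M1_def manifold_M0_def)
  moreover have "x \<in> topspace (subtopology M (manifold_M1 M))"
    using x C1 M1_subset_topspace[of M] by auto
  ultimately obtain f where f: "open_arc (subtopology M (manifold_M1 M)) f" "f 0 = x"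
    unfolding locally_line_def by blast
  have fo: "openin (subtopology M (manifold_M1 M)) (range f)"
    by (rule open_arc_openin[OF f(1)]) simp
  have "connectedin (subtopology M (manifold_M1 M)) (range f)"
    by (rule connectedin_continuous_map_image[of euclideanreal]) (use f in \<open>auto simp: open_arc_def\<close>)
  moreover have "\<not> disjnt C (range f)" using x f(2) by (auto simp: disjnt_def)
  ultimately have "range f \<subseteq> C" using connected_components_of_maximal[OF C] by blast
  then show "\<exists>T. openin M T \<and> x \<in> T \<and> T \<subseteq> C"
    using fo f(2) op by (metis openin_open_subtopology rangeI)
qed

section \<open>Consequences of local finiteness\<close>

lemma branch_free_half_arcs:
  assumes lf: "locally_finite_subset M (branch_points M)" and G: "half_arcs M x G" and g: "g \<in> G"
  shows "\<forall>\<^sub>F t in at_right 0. g t \<in> manifold_M1 M"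
proof -
  have g': "continuous_map (top_of_set {0..<1}) M g" "inj_on g {0..<1}" "g 0 = x"
    using G g by (auto simp: half_arcs_def)
  have "g 0 \<in> topspace M"
    using continuous_map_image_subset_topspace[OF g'(1)] by force
  then have x: "x \<in> topspace M" using g'(3) by simp
  obtain U where U: "openin M U" "x \<in> U" "finite (U \<inter> branch_points M)"
    using lf x unfolding locally_finite_subset_def by blast
  have evU: "\<forall>\<^sub>F t in at_right 0. g t \<in> U"
    using half_arc_limit[OF G g] U by (simp add: limitin_def)
  \<comment> \<open>As g is injective, finitely many branch points near x account for finitely many
    parameters. These are positive, so t eventually passes below all of them; the boundary is
    avoided at every positive parameter.\<close>
  define F where "F = {t \<in> {0<..<1}. g t \<in> U \<inter> branch_points M}"
  have "finite F"
  proof (rule finite_imageD)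
    show "finite (g ` F)" by (rule finite_subset[OF _ U(3)]) (auto simp: F_def)
    show "inj_on g F" by (rule inj_on_subset[OF g'(2)]) (auto simp: F_def)
  qed
  then have "\<forall>\<^sub>F t in at_right 0. \<forall>s\<in>F. t \<noteq> s"
  proof (rule eventually_ball_finite, intro ballI)
    fix s assume "s \<in> F"
    then have "s > 0" by (simp add: F_def)
    then show "\<forall>\<^sub>F t in at_right 0. t \<noteq> s"
      unfolding eventually_at_right_field by (intro exI[of _ s]) auto
  qed
  moreover have "\<forall>\<^sub>F t in at_right 0. t \<in> {0<..<1::real}"
    by (rule eventually_at_right_real) simp
  ultimately show ?thesis using evU
  proof eventually_elim
    case (elim t)
    have "g t \<in> topspace M"
      using elim(3) U(1) openin_subset by blast
    moreover have "g t \<notin> branch_points M" using elim by (auto simp: F_def)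
    moreover have "g t \<notin> manifold_boundary M"
      using half_arc_avoids_boundary[OF G g] elim(2) by simp
    ultimately show ?case by (simp add: manifold_M1_def manifold_M0_def)
  qed
qed

lemma M1_open_of_locally_finite:
  assumes M: "one_manifold M" and lf: "locally_finite_subset M (branch_points M)"
  shows "openin M (manifold_M1 M)"
proof (subst openin_subopen, intro ballI)
  fix x assume x: "x \<in> manifold_M1 M"
  obtain G where G: "half_arcs M x G"
    using half_arcs_exist[OF M] x M1_subset_topspace[of M] by blast
  show "\<exists>T. openin M T \<and> x \<in> T \<and> T \<subseteq> manifold_M1 M"
    using half_arcs_neighbourhood[OF G x] branch_free_half_arcs[OF lf G] by metis
qed

text \<open>M^0 is closed, and an open set inside it would contain the beginning of a half arc,
  which runs in M^1.\<close>

lemma nowhere_dense_of_locally_finite: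
  assumes M: "one_manifold M" and lf: "locally_finite_subset M (branch_points M)"
  shows "nowhere_dense_in M (branch_points M)"
proof -
  have "closedin M (manifold_M0 M)"
    using M1_open_of_locally_finite[OF assms] M0_subset_topspace[of M]
    by (simp add: closedin_def manifold_M1_def)
  then have cl: "M closure_of branch_points M \<subseteq> manifold_M0 M"
    by (intro closure_of_minimal) (auto simp: manifold_M0_def)
  have "x \<notin> M interior_of (M closure_of branch_points M)" for x
  proof
    assume x: "x \<in> M interior_of (M closure_of branch_points M)"
    define V where "V = M interior_of (M closure_of branch_points M)"
    have V: "openin M V" "x \<in> V" "V \<subseteq> manifold_M0 M"
      using x cl interior_of_subset[of M "M closure_of branch_points M"] by (auto simp: V_def)
    then have "x \<in> topspace M" using openin_subset by blast
    then obtain G where G: "half_arcs M x G" using half_arcs_exist[OF M] by blast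
    then obtain g where g: "g \<in> G" by (auto simp: half_arcs_def)
    have "\<forall>\<^sub>F t in at_right 0. g t \<in> V"
      using half_arc_limit[OF G g] V by (simp add: limitin_def)
    with branch_free_half_arcs[OF lf G g] have "\<forall>\<^sub>F t in at_right (0::real). False"
      by eventually_elim (use V(3) in \<open>auto simp: manifold_M1_def\<close>)
    then show False by simp
  qed
  moreover have "branch_points M \<subseteq> topspace M"
    using M0_subset_topspace[of M] by (auto simp: manifold_M0_def)
  ultimately show ?thesis unfolding nowhere_dense_in_def by blast
qed

lemma M1_component_arc:
  assumes M: "one_manifold M" "connected_space M" "\<not> M homeomorphic_space top_of_set (sphere (0::complex) 1)"
    and G1: "condition_G1 M" and C: "C \<in> connected_components_of (subtopology M (manifold_M1 M))"
  obtains f where "open_arc M f" "range f = C"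
proof -
  have lf: "locally_finite_subset M (branch_points M)" using G1 by (simp add: condition_G1_def)
  have op: "openin M (manifold_M1 M)" by (rule M1_open_of_locally_finite[OF M(1) lf])
  have Co: "openin M C" by (rule M1_component_open[OF M(1) op C])
  have C1: "C \<subseteq> manifold_M1 M" using connected_components_of_subset[OF C] by auto
  have tC: "topspace (subtopology M C) = C" using openin_subset[OF Co] by auto
  have nb: "x \<notin> branch_points M" if "x \<in> C" for x
    using C1 that by (auto simp: manifold_M1_def manifold_M0_def)
  have 1: "locally_line (subtopology M C)"
    by (rule locally_line_interior[OF M(1) Co]) (use C1 in \<open>auto simp: manifold_M1_def manifold_M0_def\<close>)
  have 2: "Hausdorff_space (subtopology M C)"
    unfolding Hausdorff_space_def
  proof (intro allI impI)
    fix x y assume xy: "x \<in> topspace (subtopology M C) \<and> y \<in> topspace (subtopology M C) \<and> x \<noteq> y"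
    then have C: "x \<in> C" "y \<in> C" "x \<noteq> y" by auto
    have "\<not> inseparable M x y" using nonbranch_inseparable[OF nb[OF C(1)]] C(3) by blast
    then obtain U V where "openin M U" "x \<in> U" "openin M V" "y \<in> V" "U \<inter> V = {}"
      using xy by (auto simp: inseparable_def)
    then show "\<exists>U V. openin (subtopology M C) U \<and> openin (subtopology M C) V \<and> x \<in> U \<and> y \<in> V \<and> disjnt U V"
      using C by (intro exI[of _ "C \<inter> U"] exI[of _ "C \<inter> V"])
        (auto simp: openin_subtopology_Int2 disjnt_def)
  qed
  have "connectedin (subtopology M (manifold_M1 M)) C"
    by (rule connectedin_connected_components_of[OF C])
  then have 3: "connected_space (subtopology M C)"
    using C1 by (simp add: connectedin_def subtopology_subtopology inf_absorb2)
  have 4: "has_countable_base (subtopology M C)" using G1 C by (simp add: condition_G1_def)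
  have "C \<noteq> {}" by (rule nonempty_connected_components_of[OF C])
  then have 5: "topspace (subtopology M C) \<noteq> {}" using tC by metis
  from line_or_circle[OF 1 2 3 4 5] show thesis
  proof
    assume "\<exists>f. open_arc (subtopology M C) f \<and> range f = topspace (subtopology M C)"
    then obtain f where f: "open_arc (subtopology M C) f" "range f = C" using tC by auto
    then show thesis using that open_arc_subtopology[OF Co] by blast
  next
    assume circ: "subtopology M C homeomorphic_space top_of_set (sphere (0::complex) 1)"
    have "compact_space (top_of_set (sphere (0::complex) 1))" by (simp add: compact_space_subtopology)
    then have "compact_space (subtopology M C)"
      using homeomorphic_compact_space[OF circ] by simp
    then have "compactin M C"
      using openin_subset[OF Co] by (simp add: compactin_subspace)
    then have "closedin M C" by (rule compact_nonbranch_closed) (use nb in auto)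
    then have "C = topspace M"
      using Co M(2) \<open>C \<noteq> {}\<close> unfolding connected_space_clopen_in by blast
    then show thesis using circ M(3) by simp
  qed
qed


section \<open>The graph built from the components\<close>

definition logistic :: "real \<Rightarrow> real" where "logistic u = 1 / (1 + exp (- u))"

text \<open>Inverse of \<open>logistic\<close>. The pair matches the line that parametrizes an arc
  with the open edge (0, 1), the lower and upper end going to 0 and 1.\<close>

definition logit :: "real \<Rightarrow> real" where "logit t = ln (t / (1 - t))"

lemma logistic_bounds: "0 < logistic u" "logistic u < 1"
proof -
  have "0 < exp (- u)" by simp
  then show "0 < logistic u" "logistic u < 1" unfolding logistic_def by (simp_all add: add_pos_pos)
qed

lemma logit_logistic: "logit (logistic u) = u"
proof -
  have "0 < 1 + exp (- u)" by (simp add: add_pos_pos)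
  then have "1 - logistic u = exp (- u) / (1 + exp (- u))"
    unfolding logistic_def by (simp add: field_simps)
  then have "logistic u / (1 - logistic u) = 1 / exp (- u)"
    using \<open>0 < 1 + exp (- u)\<close> unfolding logistic_def by simp
  also have "\<dots> = exp u" by (simp add: exp_minus field_simps)
  finally show ?thesis by (simp add: logit_def)
qed

lemma logistic_logit:
  assumes "0 < t" "t < 1" shows "logistic (logit t) = t"
proof -
  have "exp (- ln (t / (1 - t))) = (1 - t) / t"
    using assms by (simp add: exp_minus)
  then have "1 + exp (- logit t) = 1 / t" using assms by (simp add: logit_def field_simps)
  then show ?thesis by (simp add: logistic_def)
qed

lemma logistic_less_iff: "logistic u < logistic v \<longleftrightarrow> u < v"
proof -
  have p: "0 < 1 + exp (- u)" "0 < 1 + exp (- v)" by (simp_all add: add_pos_pos)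
  then have "logistic u < logistic v \<longleftrightarrow> exp (- v) < exp (- u)"
    unfolding logistic_def by (simp add: divide_less_cancel field_simps)
  then show ?thesis by simp
qed

lemma continuous_on_logistic: "continuous_on A logistic"
proof -
  have "1 + exp (- u) \<noteq> 0" for u :: real using exp_gt_zero[of "-u"] by linarith
  then show ?thesis unfolding logistic_def by (intro continuous_intros) auto
qed

lemma continuous_on_logit: "continuous_on {0<..<1} logit"
  unfolding logit_def by (intro continuous_intros) auto

text \<open>The way to approach the end t of an edge in the parameter of its arc. Only t = 0 and t =
  1 are meant; every other t defaults to at_top.\<close>

definition end_filter :: "real \<Rightarrow> real filter" where
  "end_filter t = (if t = 0 then at_bot else at_top)"

lemma end_filter_nontrivial: "end_filter t \<noteq> bot"
  by (simp add: end_filter_def)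

lemma eventually_logistic:
  assumes "t \<in> {0, 1}" "0 < d"
  shows "\<forall>\<^sub>F u in end_filter t. \<bar>logistic u - t\<bar> < d"
proof (cases "t = 0")
  case True
  \<comment> \<open>The cap 1/2 keeps c in (0, 1), where \<open>logit\<close> inverts
    \<open>logistic\<close>.\<close>
  define c where "c = min d (1/2)"
  have c: "0 < c" "c < 1" "c \<le> d" using assms(2) by (auto simp: c_def)
  have "\<bar>logistic u - t\<bar> < d" if "u < logit c" for u
  proof -
    have "logistic u < c" using that logistic_less_iff[of u "logit c"] logistic_logit[OF c(1,2)] by simp
    then show ?thesis using True c(3) logistic_bounds(1)[of u] by simp
  qed
  then have "\<forall>\<^sub>F u in at_bot. \<bar>logistic u - t\<bar> < d"
    by (meson eventually_at_bot_dense)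
  then show ?thesis using True by (simp add: end_filter_def)
next
  case False
  define c where "c = 1 - min d (1/2)"
  have c: "0 < c" "c < 1" "1 - c \<le> d" using assms(2) by (auto simp: c_def)
  have "\<bar>logistic u - t\<bar> < d" if "u > logit c" for u
  proof -
    have "c < logistic u" using that logistic_less_iff[of "logit c" u] logistic_logit[OF c(1,2)] by simp
    then show ?thesis using False assms(1) c(3) logistic_bounds(2)[of u] by simp
  qed
  then have "\<forall>\<^sub>F u in at_top. \<bar>logistic u - t\<bar> < d"
    by (meson eventually_at_top_dense)
  then show ?thesis using False by (simp add: end_filter_def)
qed

lemma eventually_end_filterD:
  assumes t: "t \<in> {0, 1}" and ev: "eventually Q (end_filter t)"
  obtains d where "0 < d" "\<And>s. 0 < s \<Longrightarrow> s < 1 \<Longrightarrow> \<bar>s - t\<bar> < d \<Longrightarrow> Q (logit s)"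
proof (cases "t = 0")
  case True
  then obtain K where K: "\<And>u. u < K \<Longrightarrow> Q u"
    using ev by (auto simp: end_filter_def eventually_at_bot_dense)
  have "Q (logit s)" if s: "0 < s" "s < 1" "\<bar>s - t\<bar> < logistic K" for s
  proof (rule K)
    have "logistic (logit s) < logistic K" using s True by (simp add: logistic_logit)
    then show "logit s < K" by (simp only: logistic_less_iff)
  qed
  then show thesis using that logistic_bounds(1) by blast
next
  case False
  then obtain K where K: "\<And>u. u > K \<Longrightarrow> Q u"
    using ev by (auto simp: end_filter_def eventually_at_top_dense)
  have "Q (logit s)" if s: "0 < s" "s < 1" "\<bar>s - t\<bar> < 1 - logistic K" for s
  proof (rule K)
    have "logistic K < logistic (logit s)" using s False t by (simp add: logistic_logit)
    then show "K < logit s" by (simp only: logistic_less_iff)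
  qed
  then show thesis using that[of "1 - logistic K"] logistic_bounds(2)[of K] by simp
qed

abbreviation cell_space :: "'l set \<Rightarrow> (real \<times> 'l) set \<Rightarrow> (real \<times> 'l) topology" where
  "cell_space L P \<equiv> subtopology (prod_topology euclideanreal (discrete_topology L)) (graph_cells L P)"

lemma topspace_cell_space: "topspace (cell_space L P) = graph_cells L P"
  by (auto simp: graph_cells_def)

text \<open>As L is discrete, neighbourhoods can be taken on one edge at a time.\<close>

lemma openin_cell_space:
  "openin (cell_space L P) S \<longleftrightarrow> S \<subseteq> graph_cells L P \<and>
     (\<forall>t l. (t, l) \<in> S \<longrightarrow> (\<exists>d>0. \<forall>s. \<bar>s - t\<bar> < d \<and> (s, l) \<in> graph_cells L P \<longrightarrow> (s, l) \<in> S))"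
  (is "?lhs \<longleftrightarrow> ?rhs")
proof
  assume ?lhs
  then obtain T where T: "openin (prod_topology euclideanreal (discrete_topology L)) T" "S = T \<inter> graph_cells L P"
    by (auto simp: openin_subtopology)
  show ?rhs
  proof (intro conjI allI impI)
    show "S \<subseteq> graph_cells L P" using T(2) by blast
    fix t l assume tl: "(t, l) \<in> S"
    then have "(t, l) \<in> T" using T(2) by blast
    then obtain U V where UV: "open U" "t \<in> U" "l \<in> V" "U \<times> V \<subseteq> T"
      using T(1) unfolding openin_prod_topology_alt by (metis open_openin)
    obtain d where d: "d > 0" "ball t d \<subseteq> U" using openE[OF UV(1,2)] by blast
    show "\<exists>d>0. \<forall>s. \<bar>s - t\<bar> < d \<and> (s, l) \<in> graph_cells L P \<longrightarrow> (s, l) \<in> S"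
    proof (intro exI[of _ d] conjI allI impI d(1))
      fix s assume s: "\<bar>s - t\<bar> < d \<and> (s, l) \<in> graph_cells L P"
      then have "s \<in> U" using d(2) by (auto simp: dist_real_def abs_minus_commute)
      then show "(s, l) \<in> S" using UV(3,4) s T(2) by blast
    qed
  qed
next
  assume r: ?rhs
  \<comment> \<open>An open set of the full product with trace S: the points with a neighbourhood on
    their edge whose cells all lie in S. Halving d shows that it is open.\<close>
  define T where "T = {(s, l). l \<in> L \<and> (\<exists>d>0. \<forall>s'. \<bar>s' - s\<bar> < d \<and> (s', l) \<in> graph_cells L P \<longrightarrow> (s', l) \<in> S)}"
  have "openin (prod_topology euclideanreal (discrete_topology L)) T"
    unfolding openin_prod_topology_alt
  proof (intro allI impI)
    fix s l assume "(s, l) \<in> T"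
    then obtain d where d: "d > 0" "l \<in> L" "\<And>s'. \<bar>s' - s\<bar> < d \<Longrightarrow> (s', l) \<in> graph_cells L P \<Longrightarrow> (s', l) \<in> S"
      by (auto simp: T_def)
    have "(r, l) \<in> T" if "r \<in> ball s (d/2)" for r
    proof -
      have r: "\<bar>s - r\<bar> < d/2" using that by (simp add: dist_real_def)
      have "(s', l) \<in> S" if "\<bar>s' - r\<bar> < d/2" "(s', l) \<in> graph_cells L P" for s'
        by (rule d(3)) (use that r in linarith)+
      then show ?thesis unfolding T_def using d(1,2) half_gt_zero by blast
    qed
    then show "\<exists>U V. openin euclideanreal U \<and> openin (discrete_topology L) V \<and> s \<in> U \<and> l \<in> V \<and> U \<times> V \<subseteq> T"
      using d(1,2) by (intro exI[of _ "ball s (d/2)"] exI[of _ "{l}"]) auto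
  qed
  moreover have "S = T \<inter> graph_cells L P"
  proof (intro equalityI subsetI)
    fix p assume "p \<in> S"
    then show "p \<in> T \<inter> graph_cells L P"
      using r by (cases p) (auto simp: T_def graph_cells_def)
  next
    fix p assume p: "p \<in> T \<inter> graph_cells L P"
    obtain t l where tl: "p = (t, l)" by (cases p)
    then obtain d where "d > 0" "\<And>s'. \<bar>s' - t\<bar> < d \<Longrightarrow> (s', l) \<in> graph_cells L P \<Longrightarrow> (s', l) \<in> S"
      using p by (auto simp: T_def)
    then show "p \<in> S" using p tl by simp
  qed
  ultimately show ?lhs by (auto simp: openin_subtopology)
qed

text \<open>Reduces a graph structure to a quotient map from the cells whose fibres are the classes
  of the graph relation.\<close>

lemma quotient_map_kernel_homeomorphism:
  assumes F: "quotient_map X Y F" and R: "R = {(p, q). p \<in> topspace X \<and> q \<in> topspace X \<and> F p = F q}"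
  obtains h where "homeomorphic_map (quotient_topology X R) Y h"
    "\<And>p. p \<in> topspace X \<Longrightarrow> h (quotient_proj R p) = F p"
proof -
  define h where "h c = F (SOME p. p \<in> c)" for c
  have hp: "h (quotient_proj R p) = F p" if p: "p \<in> topspace X" for p
  proof -
    have "p \<in> quotient_proj R p" using p by (simp add: quotient_proj_def R)
    then have "(SOME q. q \<in> quotient_proj R p) \<in> quotient_proj R p" by (rule someI)
    then have "F p = F (SOME q. q \<in> quotient_proj R p)" unfolding quotient_proj_def R by blast
    then show ?thesis unfolding h_def by simp
  qed
  have t: "topspace (quotient_topology X R) = quotient_proj R ` topspace X"
    using quotient_map_quotient_proj[of X R] by (simp add: quotient_map_def)
  have "quotient_map X Y (h \<circ> quotient_proj R)"
    using F by (rule quotient_map_eq) (simp add: hp)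
  then have "quotient_map (quotient_topology X R) Y h"
    using quotient_map_compose_eq[OF quotient_map_quotient_proj] by blast
  moreover have "inj_on h (topspace (quotient_topology X R))"
    unfolding t
  proof (rule inj_onI)
    fix a b assume "a \<in> quotient_proj R ` topspace X" "b \<in> quotient_proj R ` topspace X" and e: "h a = h b"
    then obtain p q where pq: "p \<in> topspace X" "a = quotient_proj R p" "q \<in> topspace X" "b = quotient_proj R q"
      by blast
    then have "F p = F q" using e hp by simp
    then show "a = b" using pq by (auto simp: quotient_proj_def R)
  qed
  ultimately have "homeomorphic_map (quotient_topology X R) Y h" by (simp add: homeomorphic_map_def)
  then show thesis using that hp by blast
qed

lemma quotient_mapI:
  assumes "F ` topspace X = topspace Y"
    and "\<And>U. openin Y U \<Longrightarrow> openin X {x \<in> topspace X. F x \<in> U}"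
    and "\<And>U. U \<subseteq> topspace Y \<Longrightarrow> openin X {x \<in> topspace X. F x \<in> U} \<Longrightarrow> openin Y U"
  shows "quotient_map X Y F"
  using assms unfolding quotient_map_def by blast

section \<open>Attaching the ends of the components to their limits\<close>

locale arc_decomposition =
  fixes M :: "'a topology" and arc :: "'a set \<Rightarrow> real \<Rightarrow> 'a" and edges :: "'a set set"
  assumes one_manifold: "one_manifold M"
    and locally_finite: "locally_finite_subset M (branch_points M)"
    and edges: "edges = connected_components_of (subtopology M (manifold_M1 M))"
    and arc: "\<And>C. C \<in> edges \<Longrightarrow> open_arc M (arc C)" "\<And>C. C \<in> edges \<Longrightarrow> range (arc C) = C"
begin

text \<open>The removed set P of the graph: an end that converges nowhere in M has no vertex to be
  attached to.\<close>

definition missing_ends :: "(real \<times> 'a set) set" where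
  "missing_ends = {(t, C). t \<in> {0, 1} \<and> C \<in> edges \<and> \<not> (\<exists>y. limitin M (arc C) y (end_filter t))}"

abbreviation cells :: "(real \<times> 'a set) set" where
  "cells \<equiv> graph_cells edges missing_ends"

text \<open>
  The limit of an arc need not be unique in \<open>M\<close>, but all its limits are inseparable, so the choice
  disappears in the quotient.
\<close>

definition point :: "real \<times> 'a set \<Rightarrow> 'a" where
  "point p = (if 0 < fst p \<and> fst p < 1 then arc (snd p) (logit (fst p))
     else SOME y. limitin M (arc (snd p)) y (end_filter (fst p)))"

definition cell_map :: "real \<times> 'a set \<Rightarrow> 'a set" where
  "cell_map p = chain_proj M (point p)"

lemma M1_open: "openin M (manifold_M1 M)"
  by (rule M1_open_of_locally_finite[OF one_manifold locally_finite])

lemma edge_open: "C \<in> edges \<Longrightarrow> openin M C"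
  using M1_component_open[OF one_manifold M1_open] edges by blast

lemma edge_subset: "C \<in> edges \<Longrightarrow> C \<subseteq> manifold_M1 M"
  using connected_components_of_subset[of C] edges by force

lemma edges_disjoint: "C \<in> edges \<Longrightarrow> D \<in> edges \<Longrightarrow> x \<in> C \<Longrightarrow> x \<in> D \<Longrightarrow> C = D"
  using pairwise_disjoint_connected_components_of[of "subtopology M (manifold_M1 M)"] edges
  by (metis disjnt_iff pairwiseD)

lemma edge_cover: "x \<in> manifold_M1 M \<Longrightarrow> \<exists>C\<in>edges. x \<in> C"
  using Union_connected_components_of[of "subtopology M (manifold_M1 M)"] edges M1_subset_topspace[of M]
  by auto

lemma arc_in_edge: "C \<in> edges \<Longrightarrow> arc C u \<in> C"
  using arc(2) by blast

lemma arc_in_M1: "C \<in> edges \<Longrightarrow> arc C u \<in> manifold_M1 M"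
  using arc_in_edge edge_subset by blast

lemma arc_eq_iff: "C \<in> edges \<Longrightarrow> arc C u = arc C v \<longleftrightarrow> u = v"
  using arc(1) by (auto simp: open_arc_def inj_eq)

lemma cell_cases:
  assumes "(t, C) \<in> cells"
  obtains (inner) "0 < t" "t < 1" "C \<in> edges" | (limit) "t \<in> {0, 1}" "C \<in> edges" "limitin M (arc C) (point (t, C)) (end_filter t)"
proof -
  have tC: "0 \<le> t" "t \<le> 1" "C \<in> edges" "(t, C) \<notin> missing_ends"
    using assms by (auto simp: graph_cells_def)
  show thesis
  proof (cases "0 < t \<and> t < 1")
    case False
    then have t: "t \<in> {0, 1}" using tC by auto
    then have "\<exists>y. limitin M (arc C) y (end_filter t)" using tC by (auto simp: missing_ends_def)
    then have "limitin M (arc C) (point (t, C)) (end_filter t)"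
      using False unfolding point_def fst_conv snd_conv by (simp only: if_False) (rule someI_ex)
    then show thesis using limit t tC by blast
  qed (use tC inner in blast)
qed

lemma inner_cell: "0 < t \<Longrightarrow> t < 1 \<Longrightarrow> C \<in> edges \<Longrightarrow> (t, C) \<in> cells"
  by (auto simp: graph_cells_def missing_ends_def)

lemma point_inner: "0 < t \<Longrightarrow> t < 1 \<Longrightarrow> point (t, C) = arc C (logit t)"
  by (simp add: point_def)

lemma point_logistic: "point (logistic u, C) = arc C u"
  using logistic_bounds by (simp add: point_inner logit_logistic)

lemma point_in_topspace:
  assumes "p \<in> cells" shows "point p \<in> topspace M"
proof (cases p)
  case (Pair t C)
  then have "(t, C) \<in> cells" using assms by simp
  then show ?thesis
  proof (cases rule: cell_cases)
    case inner
    then show ?thesis using Pair arc_in_M1 M1_subset_topspace[of M] by (auto simp: point_inner)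
  next
    case limit
    then show ?thesis using Pair by (simp add: limitin_def)
  qed
qed

text \<open>A limit in M^1 lies in an open component, which the arc then enters, so the limit is a
  point \<open>arc C v\<close> of the same arc. A bounded piece of the arc around it is a
  neighbourhood and would have to contain a tail of the arc, against injectivity.\<close>

lemma end_limit_in_M0:
  assumes C: "C \<in> edges" and y: "limitin M (arc C) y (end_filter t)"
  shows "y \<in> manifold_M0 M"
proof (rule ccontr)
  assume n: "y \<notin> manifold_M0 M"
  have "y \<in> topspace M" using y by (simp add: limitin_def)
  then have "y \<in> manifold_M1 M" using n by (simp add: manifold_M1_def)
  then obtain D where D: "D \<in> edges" "y \<in> D" using edge_cover by blast
  have "\<forall>\<^sub>F u in end_filter t. arc C u \<in> D"
    using y D edge_open by (auto simp: limitin_def)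
  then obtain u where "arc C u \<in> D" using eventually_happens'[OF end_filter_nontrivial] by blast
  then have "D = C" using edges_disjoint[OF D(1) C _ arc_in_edge[OF C]] by blast
  then obtain v where v: "y = arc C v" using D(2) arc(2)[OF C] by blast
  have "openin M (arc C ` {v-1<..<v+1})" by (rule open_arc_openin[OF arc(1)[OF C]]) simp
  moreover have "y \<in> arc C ` {v-1<..<v+1}" using v by simp
  ultimately have "\<forall>\<^sub>F u in end_filter t. arc C u \<in> arc C ` {v-1<..<v+1}"
    using y by (simp add: limitin_def)
  then have "\<forall>\<^sub>F u in end_filter t. u \<in> {v-1<..<v+1}"
    by eventually_elim (use arc_eq_iff[OF C] in auto)
  moreover have "\<forall>\<^sub>F u in end_filter t. u \<notin> {v-1<..<v+1}"
    unfolding end_filter_def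
    by (auto intro: eventually_mono[OF eventually_le_at_bot[of "v-1"]] eventually_mono[OF eventually_ge_at_top[of "v+1"]])
  ultimately have "\<forall>\<^sub>F u in end_filter t. False" by eventually_elim blast
  then show False using end_filter_nontrivial by (simp add: trivial_limit_def)
qed

text \<open>Close to x the half arc stays in one component C, and \<open>arc_end\<close> applies
  because points of M^1 are inseparable only from themselves. The limit chosen for that end may
  differ from x but is inseparable from it. The last conclusion transports what holds near the end
  of the edge to what holds along g near x.\<close>

lemma half_arc_meets_end:
  assumes x: "x \<in> manifold_M0 M" and G: "half_arcs M x G" and g: "g \<in> G"
  obtains t C where "t \<in> {0, 1}" "C \<in> edges" "(t, C) \<in> cells" "cell_map (t, C) = chain_proj M x"
    "\<And>Q. (\<forall>\<^sub>F u in end_filter t. Q (arc C u)) \<Longrightarrow> \<forall>\<^sub>F s in at_right 0. Q (g s)"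
proof -
  have "\<forall>\<^sub>F s in at_right 0. g s \<in> manifold_M1 M"
    by (rule branch_free_half_arcs[OF locally_finite G g])
  then obtain d where d: "d > 0" "\<And>s. 0 < s \<Longrightarrow> s < d \<Longrightarrow> g s \<in> manifold_M1 M"
    unfolding eventually_at_right_field by blast
  define e where "e = min d 1"
  have e: "0 < e" "e \<le> 1" "e \<le> d" using d(1) by (auto simp: e_def)
  have g0: "continuous_map (top_of_set {0..<1}) M g" using G g by (simp add: half_arcs_def)
  have gc: "continuous_map (top_of_set {0<..<e}) M g"
    by (rule continuous_map_from_subtopology_mono[OF g0]) (use e in auto)
  have gM1: "g ` {0<..<e} \<subseteq> manifold_M1 M" using d(2) e(3) by auto
  have gc1: "continuous_map (top_of_set {0<..<e}) (subtopology M (manifold_M1 M)) g"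
    using gc gM1 by (auto simp: continuous_map_in_subtopology)
  have "g (e/2) \<in> manifold_M1 M" using gM1 e by auto
  then obtain C where C: "C \<in> edges" "g (e/2) \<in> C" using edge_cover by blast
  have "connectedin (top_of_set {0<..<e}) {0<..<e}"
    by (simp add: connectedin_def subtopology_subtopology)
  then have "connectedin (subtopology M (manifold_M1 M)) (g ` {0<..<e})"
    by (rule connectedin_continuous_map_image[OF gc1])
  moreover have "\<not> disjnt C (g ` {0<..<e})"
    using C(2) e(1) unfolding disjnt_iff by (metis field_sum_of_halves greaterThanLessThan_iff half_gt_zero image_eqI less_add_same_cancel1)
  ultimately have sub: "g ` {0<..<e} \<subseteq> C"
    using connected_components_of_maximal C(1) edges by blast
  have sep: "\<not> inseparable M (arc C u) x" for u
  proof
    assume i: "inseparable M (arc C u) x"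
    have "arc C u \<notin> branch_points M"
      using arc_in_M1[OF C(1)] by (auto simp: manifold_M1_def manifold_M0_def)
    then have "arc C u = x" using nonbranch_inseparable i by metis
    then show False using arc_in_M1[OF C(1), of u] x by (simp add: manifold_M1_def)
  qed
  define \<tau> where "\<tau> = inv (arc C) \<circ> g"
  have arc\<tau>: "arc C (\<tau> s) = g s" if "0 < s" "s < e" for s
  proof -
    have "g s \<in> range (arc C)" using sub arc(2)[OF C(1)] that by auto
    then show ?thesis by (simp add: \<tau>_def f_inv_into_f)
  qed
  have "\<exists>t\<in>{0,1}. filterlim \<tau> (end_filter t) (at_right 0) \<and> limitin M (arc C) x (end_filter t)"
    using arc_end[OF arc(1)[OF C(1)] e(1) gc _ half_arc_limit[OF G g] sep] sub arc(2)[OF C(1)]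
    by (auto simp: \<tau>_def end_filter_def)
  then obtain t where t: "t \<in> {0, 1}" "filterlim \<tau> (end_filter t) (at_right 0)" "limitin M (arc C) x (end_filter t)"
    by blast
  have cell: "(t, C) \<in> cells"
    using t C(1) by (auto simp: graph_cells_def missing_ends_def)
  then have "limitin M (arc C) (point (t, C)) (end_filter t)"
    by (cases rule: cell_cases) (use t in auto)
  then have "inseparable M (point (t, C)) x"
    using t(3) end_filter_nontrivial by (rule limits_inseparable)
  then have "cell_map (t, C) = chain_proj M x"
    unfolding cell_map_def by (rule chain_proj_inseparable)
  moreover have "\<forall>\<^sub>F s in at_right 0. Q (g s)" if "\<forall>\<^sub>F u in end_filter t. Q (arc C u)" for Q
  proof -
    have "\<forall>\<^sub>F s in at_right 0. Q (arc C (\<tau> s))"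
      by (rule eventually_compose_filterlim[OF that t(2)])
    moreover have "\<forall>\<^sub>F s in at_right 0. s \<in> {0<..<e}" by (rule eventually_at_right_real[OF e(1)])
    ultimately show ?thesis by eventually_elim (use arc\<tau> in auto)
  qed
  ultimately show thesis using that t(1) C(1) cell by blast
qed

text \<open>Every point of M^0 has at least one half arc, which leads to an end attached to its
  class; the other inclusion is \<open>end_limit_in_M0\<close>.\<close>

lemma cell_map_ends: "cell_map ` graph_ends edges missing_ends = chain_proj M ` manifold_M0 M"
proof (intro equalityI subsetI)
  fix z assume "z \<in> cell_map ` graph_ends edges missing_ends"
  then obtain t C where tC: "(t, C) \<in> cells" "t \<in> {0, 1}" "z = cell_map (t, C)"
    by (auto simp: graph_ends_def)
  from tC(1) have "point (t, C) \<in> manifold_M0 M"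
    by (cases rule: cell_cases) (use tC(2) end_limit_in_M0 in auto)
  then show "z \<in> chain_proj M ` manifold_M0 M" using tC(3) by (simp add: cell_map_def)
next
  fix z assume "z \<in> chain_proj M ` manifold_M0 M"
  then obtain x where x: "x \<in> manifold_M0 M" "z = chain_proj M x" by blast
  then have "x \<in> topspace M" using M0_subset_topspace[of M] by blast
  then obtain G where G: "half_arcs M x G" using half_arcs_exist[OF one_manifold] by blast
  then obtain g where g: "g \<in> G" by (auto simp: half_arcs_def)
  obtain t C where tC: "t \<in> {0, 1}" "C \<in> edges" "(t, C) \<in> cells" "cell_map (t, C) = chain_proj M x"
    using half_arc_meets_end[OF x(1) G g] by metis
  then have "(t, C) \<in> graph_ends edges missing_ends" by (auto simp: graph_ends_def)
  then show "z \<in> cell_map ` graph_ends edges missing_ends" using tC(4) x(2) by (metis image_eqI)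
qed

lemma cell_map_open_edge:
  assumes "C \<in> edges" shows "cell_map ` ({0<..<1} \<times> {C}) = chain_proj M ` C"
proof -
  have "point ` ({0<..<1} \<times> {C}) = C"
  proof (intro equalityI subsetI)
    fix x assume "x \<in> point ` ({0<..<1} \<times> {C})"
    then show "x \<in> C" using arc_in_edge[OF assms] by (auto simp: point_inner)
  next
    fix x assume "x \<in> C"
    then obtain u where "x = point (logistic u, C)"
      using arc(2)[OF assms] by (auto simp: point_logistic)
    then show "x \<in> point ` ({0<..<1} \<times> {C})" using logistic_bounds[of u] by simp
  qed
  then show ?thesis unfolding cell_map_def by (metis image_image)
qed

text \<open>Records that only ends are identified, in the shape of a graph relation: the identity on
  inner cells together with a relation on ends.\<close>

lemma cell_map_eq_iff:
  assumes p: "p \<in> cells" and q: "q \<in> cells"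
  shows "cell_map p = cell_map q \<longleftrightarrow>
    p = q \<or> p \<in> graph_ends edges missing_ends \<and> q \<in> graph_ends edges missing_ends \<and> cell_map p = cell_map q"
proof -
  have *: "p = q" if p: "p \<in> cells" and q: "q \<in> cells" and eq: "cell_map p = cell_map q"
    and pn: "p \<notin> graph_ends edges missing_ends" for p q
  proof -
    obtain t C where tC: "p = (t, C)" by (cases p)
    obtain s D where sD: "q = (s, D)" by (cases q)
    have t: "0 < t" "t < 1" "C \<in> edges" using p pn tC by (auto simp: graph_ends_def graph_cells_def)
    have pM1: "point p \<in> manifold_M1 M" using tC t arc_in_M1 by (simp add: point_inner)
    have "point p = point q"
      by (rule chain_proj_M1_eq[OF pM1 point_in_topspace[OF q]]) (use eq in \<open>simp add: cell_map_def\<close>)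
    have "(s, D) \<in> cells" using q sD by simp
    then show ?thesis
    proof (cases rule: cell_cases)
      case inner
      have eqp: "arc C (logit t) = arc D (logit s)"
        using \<open>point p = point q\<close> tC sD t inner by (simp add: point_inner)
      then have CD: "C = D"
        using edges_disjoint[OF t(3) inner(3)] arc_in_edge[OF t(3)] arc_in_edge[OF inner(3)] by metis
      then have "logit t = logit s" using eqp arc_eq_iff[OF t(3)] by simp
      then have "t = s" using logistic_logit t inner by metis
      then show ?thesis using tC sD CD by simp
    next
      case limit
      then have "point q \<in> manifold_M0 M" using end_limit_in_M0 sD by blast
      then show ?thesis using pM1 \<open>point p = point q\<close> by (simp add: manifold_M1_def)
    qed
  qed
  then show ?thesis using *[OF p q] *[OF q p] by metis
qed

text \<open>Continuity at an end is the definition of the limit there. Conversely, the preimage W in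
  M of a set with open pullback must be a neighbourhood of each of its points: inside an edge this
  is openness of the arc, and at x in M^0 each half arc follows some edge to an end identified with
  x.\<close>

lemma quotient_map_cell_map:
  "quotient_map (cell_space edges missing_ends) (chain_quotient M) cell_map"
proof (rule quotient_mapI)
  show "cell_map ` topspace (cell_space edges missing_ends) = topspace (chain_quotient M)"
    unfolding topspace_cell_space topspace_chain_quotient
  proof (intro equalityI subsetI)
    fix z assume "z \<in> cell_map ` cells"
    then show "z \<in> chain_proj M ` topspace M" using point_in_topspace by (auto simp: cell_map_def)
  next
    fix z assume "z \<in> chain_proj M ` topspace M"
    then obtain x where x: "x \<in> topspace M" "z = chain_proj M x" by blast
    show "z \<in> cell_map ` cells"
    proof (cases "x \<in> manifold_M0 M")
      case True
      then have "z \<in> cell_map ` graph_ends edges missing_ends" using cell_map_ends x(2) by blast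
      then show ?thesis by (auto simp: graph_ends_def)
    next
      case False
      then have "x \<in> manifold_M1 M" using x(1) by (simp add: manifold_M1_def)
      then obtain C where C: "C \<in> edges" "x \<in> C" using edge_cover by blast
      then obtain u where "x = arc C u" using arc(2) by blast
      then have "z = cell_map (logistic u, C)" using x(2) by (simp add: cell_map_def point_logistic)
      moreover have "(logistic u, C) \<in> cells" using inner_cell logistic_bounds C(1) by blast
      ultimately show ?thesis by blast
    qed
  qed
next
  fix U assume "openin (chain_quotient M) U"
  then have W: "openin M {x \<in> topspace M. chain_proj M x \<in> U}" by (simp add: openin_chain_quotient)
  define W where "W = {x \<in> topspace M. chain_proj M x \<in> U}"
  have pW: "cell_map p \<in> U \<longleftrightarrow> point p \<in> W" if "p \<in> cells" for p
    using point_in_topspace[OF that] by (simp add: cell_map_def W_def)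
  show "openin (cell_space edges missing_ends) {p \<in> topspace (cell_space edges missing_ends). cell_map p \<in> U}"
    unfolding topspace_cell_space openin_cell_space
  proof (intro conjI allI impI)
    fix t C assume a: "(t, C) \<in> {p \<in> cells. cell_map p \<in> U}"
    then have tC: "(t, C) \<in> cells" and ptW: "point (t, C) \<in> W" using pW by auto
    from tC show "\<exists>d>0. \<forall>s. \<bar>s - t\<bar> < d \<and> (s, C) \<in> cells \<longrightarrow> (s, C) \<in> {p \<in> cells. cell_map p \<in> U}"
    proof (cases rule: cell_cases)
      case inner
      have "continuous_map (top_of_set {0<..<1}) euclideanreal logit"
        using continuous_on_logit by simp
      then have "continuous_map (top_of_set {0<..<1}) M (arc C \<circ> logit)"
        using arc(1)[OF inner(3)] continuous_map_compose unfolding open_arc_def by blast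
      then have "openin (top_of_set {0<..<1}) {s \<in> topspace (top_of_set {0<..<1}). (arc C \<circ> logit) s \<in> W}"
        by (rule openin_continuous_map_preimage) (use W in \<open>simp add: W_def\<close>)
      then have "open {s \<in> {0<..<1}. arc C (logit s) \<in> W}" by (simp add: openin_open_eq)
      moreover have "t \<in> {s \<in> {0<..<1}. arc C (logit s) \<in> W}" using inner ptW by (simp add: point_inner)
      ultimately obtain d where d: "d > 0" "ball t d \<subseteq> {s \<in> {0<..<1}. arc C (logit s) \<in> W}" by (rule openE)
      show ?thesis
      proof (intro exI[of _ d] conjI allI impI d(1))
        fix s assume s: "\<bar>s - t\<bar> < d \<and> (s, C) \<in> cells"
        then have "s \<in> ball t d" by (simp add: dist_real_def abs_minus_commute)
        then have "s \<in> {0<..<1}" "arc C (logit s) \<in> W" using d(2) by blast+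
        then have "point (s, C) \<in> W" by (simp add: point_inner)
        then show "(s, C) \<in> {p \<in> cells. cell_map p \<in> U}" using s pW by simp
      qed
    next
      case limit
      have "\<forall>\<^sub>F u in end_filter t. arc C u \<in> W"
        using limit(3) ptW W[folded W_def] unfolding limitin_def by blast
      then obtain d where d: "0 < d" "\<And>s. 0 < s \<Longrightarrow> s < 1 \<Longrightarrow> \<bar>s - t\<bar> < d \<Longrightarrow> arc C (logit s) \<in> W"
        using eventually_end_filterD[OF limit(1)] by metis
      show ?thesis
      \<comment> \<open>A distance below 1 excludes the opposite end of the same edge, where
        \<open>point\<close> is not governed by this limit.\<close>
      proof (intro exI[of _ "min d 1"] conjI allI impI)
        fix s assume s: "\<bar>s - t\<bar> < min d 1 \<and> (s, C) \<in> cells"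
        have "point (s, C) \<in> W"
        proof (cases "s = t")
          case False
          moreover have "0 \<le> s" "s \<le> 1" using s by (auto simp: graph_cells_def)
          ultimately have "0 < s" "s < 1" using limit(1) s by auto
          then show ?thesis using d(2) s by (simp add: point_inner)
        qed (use ptW in simp)
        then show "(s, C) \<in> {p \<in> cells. cell_map p \<in> U}" using s pW by simp
      qed (use d(1) in simp)
    qed
  qed auto
next
  fix U assume U: "U \<subseteq> topspace (chain_quotient M)"
    and S: "openin (cell_space edges missing_ends) {p \<in> topspace (cell_space edges missing_ends). cell_map p \<in> U}"
  define W where "W = {x \<in> topspace M. chain_proj M x \<in> U}"
  have S: "\<exists>d>0. \<forall>s. \<bar>s - t\<bar> < d \<and> (s, C) \<in> cells \<longrightarrow> point (s, C) \<in> W"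
    if "(t, C) \<in> cells" "cell_map (t, C) \<in> U" for t C
  proof -
    have "(t, C) \<in> {p \<in> cells. cell_map p \<in> U}" using that by simp
    then obtain d where "d > 0" "\<And>s. \<bar>s - t\<bar> < d \<Longrightarrow> (s, C) \<in> cells \<Longrightarrow> (s, C) \<in> {p \<in> cells. cell_map p \<in> U}"
      using S unfolding topspace_cell_space openin_cell_space by blast
    then show ?thesis
      using point_in_topspace unfolding W_def cell_map_def by (intro exI[of _ d]) auto
  qed
  have "\<exists>V. openin M V \<and> x \<in> V \<and> V \<subseteq> W" if xW: "x \<in> W" for x
  proof (cases "x \<in> manifold_M0 M")
    case True
    have "x \<in> topspace M" using xW by (simp add: W_def)
    then obtain G where G: "half_arcs M x G" using half_arcs_exist[OF one_manifold] by blast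
    \<comment> \<open>The limit chosen for the end may be another point of the class of x; as W is a
      union of classes, openness of the pulled-back set at that end can still be used.\<close>
    have "\<forall>\<^sub>F s in at_right 0. g s \<in> W" if g: "g \<in> G" for g
    proof -
      obtain t C where tC: "t \<in> {0, 1}" "C \<in> edges" "(t, C) \<in> cells" "cell_map (t, C) = chain_proj M x"
        and ev: "\<And>Q. (\<forall>\<^sub>F u in end_filter t. Q (arc C u)) \<Longrightarrow> \<forall>\<^sub>F s in at_right 0. Q (g s)"
        using half_arc_meets_end[OF True G g] by metis
      have "cell_map (t, C) \<in> U" using tC(4) xW by (simp add: W_def)
      then obtain d where d: "d > 0" "\<And>s. \<bar>s - t\<bar> < d \<Longrightarrow> (s, C) \<in> cells \<Longrightarrow> point (s, C) \<in> W"
        using S[OF tC(3)] by blast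
      have "\<forall>\<^sub>F u in end_filter t. arc C u \<in> W"
        using eventually_logistic[OF tC(1) d(1)]
      proof eventually_elim
        case (elim u)
        have "(logistic u, C) \<in> cells" by (rule inner_cell[OF logistic_bounds tC(2)])
        then have "point (logistic u, C) \<in> W" using d(2) elim by blast
        then show ?case by (simp add: point_logistic)
      qed
      then show ?thesis by (rule ev)
    qed
    then show ?thesis using half_arcs_neighbourhood[OF G xW] by metis
  next
    case False
    then have "x \<in> manifold_M1 M" using xW by (simp add: manifold_M1_def W_def)
    then obtain C where C: "C \<in> edges" "x \<in> C" using edge_cover by blast
    then obtain u where u: "x = arc C u" using arc(2) by blast
    have cell: "(logistic v, C) \<in> cells" for v by (rule inner_cell[OF logistic_bounds C(1)])
    have "cell_map (logistic u, C) \<in> U" using xW u by (simp add: cell_map_def point_logistic W_def)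
    then obtain d where d: "d > 0" "\<And>s. \<bar>s - logistic u\<bar> < d \<Longrightarrow> (s, C) \<in> cells \<Longrightarrow> point (s, C) \<in> W"
      using S[OF cell] by blast
    define T where "T = {v. \<bar>logistic v - logistic u\<bar> < d}"
    have "open T" unfolding T_def
      by (intro open_Collect_less continuous_intros continuous_on_logistic)
    then have "openin M (arc C ` T)" by (rule open_arc_openin[OF arc(1)[OF C(1)]])
    moreover have "x \<in> arc C ` T" using u d(1) by (simp add: T_def)
    moreover have "arc C ` T \<subseteq> W"
    proof (rule image_subsetI)
      fix v assume "v \<in> T"
      then have "point (logistic v, C) \<in> W" using d(2) cell by (simp add: T_def)
      then show "arc C v \<in> W" by (simp add: point_logistic)
    qed
    ultimately show ?thesis by blast
  qed
  then have "openin M W" by (subst openin_subopen) blast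
  then show "openin (chain_quotient M) U" using U by (simp add: openin_chain_quotient W_def)
qed

lemma compatible_graph_structure: "has_compatible_graph_structure M"
proof -
  define r where "r = {(p, q). p \<in> graph_ends edges missing_ends \<and> q \<in> graph_ends edges missing_ends \<and>
      cell_map p = cell_map q}"
  have data: "graph_data edges missing_ends r"
    unfolding graph_data_def
  proof
    show "missing_ends \<subseteq> {0, 1} \<times> edges" by (auto simp: missing_ends_def)
    show "equiv (graph_ends edges missing_ends) r"
      by (rule equivI) (auto simp: r_def refl_on_def sym_def trans_def)
  qed
  have int: "{0<..<1} \<times> edges = cells - graph_ends edges missing_ends"
    by (auto simp: graph_ends_def graph_cells_def missing_ends_def)
  have ends: "graph_ends edges missing_ends \<subseteq> cells" by (auto simp: graph_ends_def)
  \<comment> \<open>The graph relation is the full kernel of \<open>cell_map\<close>, as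
    \<open>quotient_map_kernel_homeomorphism\<close> requires.\<close>
  have rel: "graph_rel edges r = {(p, q). p \<in> topspace (cell_space edges missing_ends) \<and>
      q \<in> topspace (cell_space edges missing_ends) \<and> cell_map p = cell_map q}"
    unfolding topspace_cell_space
  proof (intro equalityI subrelI)
    fix p q assume "(p, q) \<in> graph_rel edges r"
    then show "(p, q) \<in> {(p, q). p \<in> cells \<and> q \<in> cells \<and> cell_map p = cell_map q}"
      using ends unfolding graph_rel_def int r_def by auto
  next
    fix p q assume "(p, q) \<in> {(p, q). p \<in> cells \<and> q \<in> cells \<and> cell_map p = cell_map q}"
    then have pq: "p \<in> cells" "q \<in> cells" "cell_map p = cell_map q" by auto
    then show "(p, q) \<in> graph_rel edges r"
      using cell_map_eq_iff[OF pq(1,2)] unfolding graph_rel_def int r_def by auto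
  qed
  obtain h where h: "homeomorphic_map (topological_graph edges missing_ends r) (chain_quotient M) h"
    "\<And>p. p \<in> cells \<Longrightarrow> h (quotient_proj (graph_rel edges r) p) = cell_map p"
    using quotient_map_kernel_homeomorphism[OF quotient_map_cell_map rel]
    unfolding topological_graph_def topspace_cell_space by blast
  have himage: "h ` quotient_proj (graph_rel edges r) ` A = cell_map ` A" if "A \<subseteq> cells" for A
    unfolding image_image by (rule image_cong) (use h(2) that in auto)
  have "h ` graph_vertices edges missing_ends r = chain_proj M ` manifold_M0 M"
    unfolding graph_vertices_def himage[OF ends] by (rule cell_map_ends)
  moreover have "(\<lambda>e. h ` e) ` graph_edges edges r =
      connected_components_of (subtopology (chain_quotient M) (chain_proj M ` manifold_M1 M))"
  proof -
    have "(\<lambda>e. h ` e) ` graph_edges edges r = (\<lambda>C. cell_map ` ({0<..<1} \<times> {C})) ` edges"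
      unfolding graph_edges_def image_image[of "\<lambda>e. h ` e"]
    proof (rule image_cong[OF refl])
      fix C assume "C \<in> edges"
      then have "{0<..<1} \<times> {C} \<subseteq> cells" using inner_cell by auto
      then show "h ` quotient_proj (graph_rel edges r) ` ({0<..<1} \<times> {C}) = cell_map ` ({0<..<1} \<times> {C})"
        by (rule himage)
    qed
    also have "\<dots> = (\<lambda>C. chain_proj M ` C) ` edges"
      by (rule image_cong[OF refl]) (rule cell_map_open_edge)
    also have "\<dots> = connected_components_of (subtopology (chain_quotient M) (chain_proj M ` manifold_M1 M))"
      unfolding edges by (rule homeomorphic_map_connected_components_of[symmetric, OF homeomorphic_map_chain_proj_M1[OF M1_open]])
    finally show ?thesis .
  qed
  \<comment> \<open>The edges are indexed by the components of M^1 themselves; as sets of points of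
    M these have the type asked of an index.\<close>
  ultimately have "compatible_structure M edges missing_ends r h"
    using data h(1) by (simp add: compatible_structure_def graph_structure_def)
  then show ?thesis unfolding has_compatible_graph_structure_def by blast
qed

end

lemma condition_G1_imp_G2:
  assumes M: "one_manifold M" "connected_space M" "\<not> M homeomorphic_space top_of_set (sphere (0::complex) 1)"
    and G1: "condition_G1 M"
  shows "condition_G2 M"
proof -
  have lf: "locally_finite_subset M (branch_points M)" using G1 by (simp add: condition_G1_def)
  have "\<exists>f. open_arc M f \<and> range f = C"
    if "C \<in> connected_components_of (subtopology M (manifold_M1 M))" for C
    using M1_component_arc[OF M G1 that] by blast
  then obtain arc where arc: "\<And>C. C \<in> connected_components_of (subtopology M (manifold_M1 M)) \<Longrightarrow>
      open_arc M (arc C) \<and> range (arc C) = C"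
    by metis
  interpret arc_decomposition M arc "connected_components_of (subtopology M (manifold_M1 M))"
    by unfold_locales (use M lf arc in auto)
  show ?thesis
    using compatible_graph_structure nowhere_dense_of_locally_finite[OF M(1) lf]
    by (simp add: condition_G2_def)
qed


section \<open>From the graph back to the manifold\<close>

lemma equiv_graph_rel:
  assumes "graph_data L P r"
  shows "equiv (graph_cells L P) (graph_rel L r)"
proof -
  have P: "P \<subseteq> {0, 1} \<times> L" and e: "equiv (graph_ends L P) r"
    using assms by (auto simp: graph_data_def)
  have rs: "r \<subseteq> graph_ends L P \<times> graph_ends L P" by (rule equiv_type[OF e])
  have rr: "(p, p) \<in> r" if "p \<in> graph_ends L P" for p
    using equiv_class_self[OF e that] by simp
  have sub: "graph_ends L P \<subseteq> graph_cells L P" "{0<..<1} \<times> L \<subseteq> graph_cells L P"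
    using P by (auto simp: graph_ends_def graph_cells_def)
  have cell: "p \<in> graph_ends L P \<or> p \<in> {0<..<1} \<times> L" if "p \<in> graph_cells L P" for p
    using that by (cases p) (auto simp: graph_ends_def graph_cells_def)
  have disj: "p \<notin> {0<..<1} \<times> L" if "p \<in> graph_ends L P" for p
    using that by (auto simp: graph_ends_def)
  show ?thesis
  proof (rule equivI)
    show "graph_rel L r \<subseteq> graph_cells L P \<times> graph_cells L P"
      using rs sub by (auto simp: graph_rel_def)
    show "refl_on (graph_cells L P) (graph_rel L r)"
    proof (rule refl_onI)
      fix p assume "p \<in> graph_cells L P"
      then show "(p, p) \<in> graph_rel L r" using cell rr unfolding graph_rel_def by (metis Id_onI UnCI)
    qed
    show "sym (graph_rel L r)"
      using e unfolding graph_rel_def equiv_def by (intro sym_Un) (auto simp: sym_def)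
    show "trans (graph_rel L r)"
    proof (rule transI)
      fix a b c assume ab: "(a, b) \<in> graph_rel L r" "(b, c) \<in> graph_rel L r"
      show "(a, c) \<in> graph_rel L r"
      proof (cases "(a, b) \<in> r \<and> (b, c) \<in> r")
        case True
        then have "(a, c) \<in> r" using e unfolding equiv_def by (meson transD)
        then show ?thesis by (simp add: graph_rel_def)
      next
        case False
        then have "a = b \<or> b = c" using ab by (auto simp: graph_rel_def)
        then show ?thesis using ab by auto
      qed
    qed
  qed
qed

lemma graph_rel_inner:
  assumes r: "graph_data L P r" and pq: "(p, q) \<in> graph_rel L r" and "p \<notin> graph_ends L P \<or> q \<notin> graph_ends L P"
  shows "p = q"
proof -
  have "r \<subseteq> graph_ends L P \<times> graph_ends L P"
    using r equiv_type by (auto simp: graph_data_def)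
  then show ?thesis using pq assms(3) by (auto simp: graph_rel_def)
qed

lemma graph_inner_cells:
  assumes "graph_data L P r"
  shows "{0<..<1} \<times> L = graph_cells L P - graph_ends L P"
  using assms by (auto simp: graph_data_def graph_ends_def graph_cells_def)

text \<open>
  The \<open>d\<close>-neighbourhood of a class is saturated as long as \<open>d\<close> is at most \<open>1/2\<close> for a vertex and at
  most the distance to the ends of the edge for an interior point.
\<close>

lemma Hausdorff_topological_graph:
  assumes r: "graph_data L P r"
  shows "Hausdorff_space (topological_graph L P r)"
proof -
  define R where "R = graph_rel L r"
  define X where "X = cell_space L P"
  define N where "N c d = {p \<in> graph_cells L P. \<exists>t. (t, snd p) \<in> c \<and> \<bar>fst p - t\<bar> < d}"
    for c :: "(real \<times> 'a) set" and d
  define rad where "rad p = (if p \<in> graph_ends L P then 1/2 else min (fst p) (1 - fst p))" for p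
  have eq: "equiv (graph_cells L P) R" unfolding R_def by (rule equiv_graph_rel[OF r])
  have tX: "topspace X = graph_cells L P" unfolding X_def by (rule topspace_cell_space)
  have classI: "R `` {p} = R `` {q}" if "(p, q) \<in> R" for p q
    by (rule equiv_class_eq[OF eq that])
  have inner: "p = q" if "(p, q) \<in> R" "p \<notin> graph_ends L P \<or> q \<notin> graph_ends L P" for p q
    using graph_rel_inner[OF r] that unfolding R_def by blast
  have Rcells: "p \<in> graph_cells L P" "q \<in> graph_cells L P" if "(p, q) \<in> R" for p q
    using equiv_type[OF eq] that by auto
  have endval: "fst p \<in> {0, 1}" if "p \<in> graph_ends L P" for p
    using that by (auto simp: graph_ends_def)
  have innerval: "0 < fst p" "fst p < 1" if "p \<in> graph_cells L P" "p \<notin> graph_ends L P" for p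
    using that by (auto simp: graph_ends_def graph_cells_def less_le)
  have radpos: "0 < rad p" if "p \<in> graph_cells L P" for p
    using innerval[OF that] by (simp add: rad_def)
  have refl: "(p, p) \<in> R" if "p \<in> graph_cells L P" for p
    using equiv_class_self[OF eq that] by simp
  have Nopen: "openin X (N c d)" for c d
    unfolding X_def openin_cell_space
  proof (intro conjI allI impI)
    fix t l assume "(t, l) \<in> N c d"
    then obtain a where a: "(a, l) \<in> c" "\<bar>t - a\<bar> < d" by (auto simp: N_def)
    show "\<exists>e>0. \<forall>s. \<bar>s - t\<bar> < e \<and> (s, l) \<in> graph_cells L P \<longrightarrow> (s, l) \<in> N c d"
    proof (intro exI[of _ "d - \<bar>t - a\<bar>"] conjI allI impI)
      fix s assume s: "\<bar>s - t\<bar> < d - \<bar>t - a\<bar> \<and> (s, l) \<in> graph_cells L P"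
      then have "\<bar>s - a\<bar> < d" by linarith
      then show "(s, l) \<in> N c d" using s a(1) by (auto simp: N_def)
    qed (use a in simp)
  qed (auto simp: N_def)
  have sat: "y \<in> N (R `` {p}) d"
    if p: "p \<in> graph_cells L P" and d: "0 < d" "d \<le> rad p" and xy: "(x, y) \<in> R" and x: "x \<in> N (R `` {p}) d"
    for p d x y
  proof (cases "x \<in> graph_ends L P")
    case False
    then show ?thesis using inner[OF xy] x by simp
  next
    case True
    obtain a where a: "(p, (a, snd x)) \<in> R" "\<bar>fst x - a\<bar> < d" using x by (auto simp: N_def)
    show ?thesis
    proof (cases "p \<in> graph_ends L P")
      case p': True
      have "(a, snd x) \<in> graph_ends L P"
        using inner[OF a(1)] p' by metis
      then have "a \<in> {0, 1}" using endval by force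
      moreover have "fst x \<in> {0, 1}" by (rule endval[OF True])
      moreover have "d \<le> 1/2" using d(2) p' by (simp add: rad_def)
      \<comment> \<open>Both values are 0 or 1 and closer than 1/2.\<close>
      ultimately have "a = fst x" using a(2) by auto
      then have "(p, x) \<in> R" using a(1) by simp
      then have "(p, y) \<in> R" using xy eq unfolding equiv_def by (meson transD)
      then show ?thesis using Rcells[OF xy] d(1) by (auto simp: N_def intro!: exI[of _ "fst y"])
    next
      case False
      then have "a = fst p" using inner[OF a(1)] by (metis fst_conv)
      then have "\<bar>fst x - fst p\<bar> < min (fst p) (1 - fst p)" using a(2) d(2) False by (simp add: rad_def)
      then have False using endval[OF True] by auto
      then show ?thesis ..
    qed
  qed
  have Kopen: "openin (topological_graph L P r) (quotient_proj R ` N (R `` {p}) d)"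
    if "p \<in> graph_cells L P" "0 < d" "d \<le> rad p" for p d
  proof -
    have Nsub: "N (R `` {p}) d \<subseteq> graph_cells L P" by (auto simp: N_def)
    have "{x \<in> topspace X. quotient_proj R x \<in> quotient_proj R ` N (R `` {p}) d} = N (R `` {p}) d"
    proof (intro equalityI subsetI)
      fix x assume "x \<in> {x \<in> topspace X. quotient_proj R x \<in> quotient_proj R ` N (R `` {p}) d}"
      then obtain y where y: "x \<in> graph_cells L P" "y \<in> N (R `` {p}) d" "R `` {x} = R `` {y}"
        by (auto simp: tX quotient_proj_def)
      then have "(y, x) \<in> R" using refl[OF y(1)] by blast
      then show "x \<in> N (R `` {p}) d" using sat[OF that] y(2) by blast
    qed (use Nsub tX in auto)
    moreover have "quotient_proj R ` N (R `` {p}) d \<subseteq> topspace X // R"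
      using Nsub by (auto simp: tX quotient_proj_def intro: quotientI)
    ultimately show ?thesis
      using Nopen[of "R `` {p}" d]
      unfolding topological_graph_def openin_quotient_topology X_def[symmetric] R_def[symmetric] by simp
  qed
  show ?thesis
    unfolding Hausdorff_space_def
  proof (intro allI impI)
    fix c c' assume cc: "c \<in> topspace (topological_graph L P r) \<and> c' \<in> topspace (topological_graph L P r) \<and> c \<noteq> c'"
    then have "c \<in> graph_cells L P // R" "c' \<in> graph_cells L P // R"
      unfolding topological_graph_def topspace_quotient_topology X_def[symmetric] R_def[symmetric] tX by auto
    then obtain p p' where p: "p \<in> graph_cells L P" "c = R `` {p}" and p': "p' \<in> graph_cells L P" "c' = R `` {p'}"
      by (auto elim!: quotientE)
    have npp: "(p, p') \<notin> R" using cc p(2) p'(2) classI by blast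
    \<comment> \<open>A common point of the two neighbourhoods yields a in c and b in c' on one edge
      with |a - b| < 2 * d, so every bound is halved. The value 1 is a filler for equal first
      coordinates; it never binds, as radii are at most 1/2.\<close>
    define d where "d = min (min (rad p) (rad p') / 2) (if fst p = fst p' then 1 else \<bar>fst p - fst p'\<bar> / 2)"
    have d: "0 < d" "d \<le> rad p" "d \<le> rad p'" "2 * d \<le> rad p" "2 * d \<le> rad p'"
      using radpos[OF p(1)] radpos[OF p'(1)] by (auto simp: d_def min_def)
    have d': "2 * d \<le> \<bar>fst p - fst p'\<bar>" if "fst p \<noteq> fst p'"
    proof -
      have "d \<le> (if fst p = fst p' then 1 else \<bar>fst p - fst p'\<bar> / 2)"
        unfolding d_def by (rule min.cobounded2)
      then show ?thesis using that by simp
    qed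
    have disj: "N c d \<inter> N c' d = {}"
    proof (rule ccontr)
      assume "N c d \<inter> N c' d \<noteq> {}"
      then obtain x where x: "x \<in> N c d" "x \<in> N c' d" by blast
      then obtain a b where a: "(p, (a, snd x)) \<in> R" "\<bar>fst x - a\<bar> < d"
        and b: "(p', (b, snd x)) \<in> R" "\<bar>fst x - b\<bar> < d"
        by (auto simp: N_def p(2) p'(2))
      have ab: "\<bar>a - b\<bar> < 2 * d" using a(2) b(2) by linarith
      have ap: "(a, snd x) = p" if "p \<notin> graph_ends L P" using inner[OF a(1)] that by simp
      have bp: "(b, snd x) = p'" if "p' \<notin> graph_ends L P" using inner[OF b(1)] that by simp
      have ae: "a \<in> {0, 1}" if "p \<in> graph_ends L P"
        using inner[OF a(1)] that endval[of "(a, snd x)"] by (metis fst_conv)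
      have be: "b \<in> {0, 1}" if "p' \<in> graph_ends L P"
        using inner[OF b(1)] that endval[of "(b, snd x)"] by (metis fst_conv)
      have neq: "a \<noteq> b"
      proof
        assume "a = b"
        then have "R `` {p} = R `` {p'}" using classI[OF a(1)] classI[OF b(1)] by simp
        then show False using npp refl[OF p'(1)] by blast
      qed
      \<comment> \<open>Distinct ends of an edge are 1 apart, an inner point is at least its radius
        away from both ends, and two inner points must be p and p' themselves.\<close>
      consider "p \<in> graph_ends L P" "p' \<in> graph_ends L P" | "p \<in> graph_ends L P" "p' \<notin> graph_ends L P"
        | "p \<notin> graph_ends L P" "p' \<in> graph_ends L P" | "p \<notin> graph_ends L P" "p' \<notin> graph_ends L P" by blast
      then show False
      proof cases
        case 1
        then have "\<bar>a - b\<bar> < 1/2" using ab d(4) by (simp add: rad_def)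
        then show False using ae[OF 1(1)] be[OF 1(2)] neq by auto
      next
        case 2
        have "fst p' = b" using bp[OF 2(2)] by (metis fst_conv)
        then have "\<bar>a - b\<bar> < min b (1 - b)" using ab d(5) 2(2) by (simp add: rad_def)
        then show False using ae[OF 2(1)] by auto
      next
        case 3
        have "fst p = a" using ap[OF 3(1)] by (metis fst_conv)
        then have "\<bar>a - b\<bar> < min a (1 - a)" using ab d(4) 3(1) by (simp add: rad_def)
        then show False using be[OF 3(2)] by auto
      next
        case 4
        have "fst p = a" "fst p' = b" using ap[OF 4(1)] bp[OF 4(2)] by (metis fst_conv)+
        then show False using d' ab neq by auto
      qed
    qed
    have "disjnt (quotient_proj R ` N c d) (quotient_proj R ` N c' d)"
      unfolding disjnt_iff
    proof (intro allI notI, elim conjE)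
      fix z assume "z \<in> quotient_proj R ` N c d" "z \<in> quotient_proj R ` N c' d"
      then obtain x y where xy: "x \<in> N c d" "y \<in> N c' d" "R `` {x} = R `` {y}"
        by (auto simp: quotient_proj_def)
      have "x \<in> graph_cells L P" using xy(1) by (simp add: N_def)
      then have "(y, x) \<in> R" using refl xy(3) by blast
      then have "x \<in> N c' d" using sat[OF p'(1) d(1) d(3)] xy(2) p'(2) by blast
      then show False using disj xy(1) by blast
    qed
    moreover have "c \<in> quotient_proj R ` N c d" "c' \<in> quotient_proj R ` N c' d"
    proof -
      have "p \<in> N c d"
        using refl[OF p(1)] p d(1) unfolding N_def by (auto intro!: exI[of _ "fst p"])
      moreover have "p' \<in> N c' d"
        using refl[OF p'(1)] p' d(1) unfolding N_def by (auto intro!: exI[of _ "fst p'"])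
      ultimately show "c \<in> quotient_proj R ` N c d" "c' \<in> quotient_proj R ` N c' d"
        using p(2) p'(2) by (auto simp: quotient_proj_def)
    qed
    ultimately show "\<exists>U V. openin (topological_graph L P r) U \<and> openin (topological_graph L P r) V \<and>
        c \<in> U \<and> c' \<in> V \<and> disjnt U V"
      using Kopen[OF p(1) d(1,2), folded p(2)] Kopen[OF p'(1) d(1,3), folded p'(2)] by metis
  qed
qed

text \<open>Lifting the open edges to M gives arcs that exhaust the components of M^1, hence the
  countable bases. Local finiteness comes in a sharper form: every x has a neighbourhood whose other
  points all lie in M^1.\<close>

lemma condition_G2_imp_G1:
  assumes M: "one_manifold M" and G2: "condition_G2 M"
  shows "condition_G1 M"
proof -
  obtain L :: "'a set set" and P r h where s: "compatible_structure M L P r h"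
    using G2 by (auto simp: condition_G2_def has_compatible_graph_structure_def)
  have data: "graph_data L P r" and hh: "homeomorphic_map (topological_graph L P r) (chain_quotient M) h"
    and hv: "h ` graph_vertices L P r = chain_proj M ` manifold_M0 M"
    and he: "(\<lambda>e. h ` e) ` graph_edges L r =
       connected_components_of (subtopology (chain_quotient M) (chain_proj M ` manifold_M1 M))"
    using s by (auto simp: compatible_structure_def graph_structure_def)
  define F where "F = h \<circ> quotient_proj (graph_rel L r)"
  have F: "quotient_map (cell_space L P) (chain_quotient M) F"
    using quotient_map_compose[OF quotient_map_quotient_proj, of _ _ "chain_quotient M" h] hh
    by (simp add: F_def homeomorphic_map_def topological_graph_def)
  have eq: "equiv (graph_cells L P) (graph_rel L r)" by (rule equiv_graph_rel[OF data])
  have inn: "{0<..<1} \<times> L = graph_cells L P - graph_ends L P" by (rule graph_inner_cells[OF data])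
  have ends: "graph_ends L P \<subseteq> graph_cells L P" by (auto simp: graph_ends_def)
  \<comment> \<open>h is injective and the graph relation is trivial at inner cells.\<close>
  have Finner: "p = q" if "p \<in> {0<..<1} \<times> L" "q \<in> graph_cells L P" "F p = F q" for p q
  proof -
    have p: "p \<in> graph_cells L P" "p \<notin> graph_ends L P" using that(1) inn by blast+
    have "quotient_proj (graph_rel L r) p = quotient_proj (graph_rel L r) q"
    proof (rule inj_onD[OF homeomorphic_imp_injective_map[OF hh]])
      show "h (quotient_proj (graph_rel L r) p) = h (quotient_proj (graph_rel L r) q)"
        using that(3) by (simp add: F_def)
    qed (use p that(2) topspace_cell_space[of L P] in \<open>simp_all add: topological_graph_def topspace_quotient_topology quotient_proj_def quotientI\<close>)
    then have "(p, q) \<in> graph_rel L r"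
      using eq_equiv_class_iff[OF eq p(1) that(2)] by (simp add: quotient_proj_def)
    then show ?thesis using graph_rel_inner[OF data] p(2) by blast
  qed
  have tF: "F ` graph_cells L P = chain_proj M ` topspace M"
    using F topspace_cell_space[of L P] by (simp add: quotient_map_def topspace_chain_quotient)
  have Fopen: "openin (chain_quotient M) (F ` A)"
    if "A \<subseteq> graph_cells L P" "openin (cell_space L P) {p \<in> graph_cells L P. F p \<in> F ` A}" for A
  proof -
    have "F ` A \<subseteq> topspace (chain_quotient M)"
      using that(1) tF by (auto simp: topspace_chain_quotient)
    moreover have "openin (cell_space L P) {p \<in> topspace (cell_space L P). F p \<in> F ` A}"
      using that(2) by (simp only: topspace_cell_space)
    ultimately show ?thesis using F unfolding quotient_map_def by blast
  qed
  have Fends: "F ` graph_ends L P = chain_proj M ` manifold_M0 M"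
    using hv by (simp add: graph_vertices_def F_def image_comp)
  have M01: "x \<in> manifold_M1 M \<longleftrightarrow> x \<in> topspace M \<and> x \<notin> manifold_M0 M" for x
    by (simp add: manifold_M1_def)
  \<comment> \<open>No inner cell shares its image with an end, and no point of M^1 shares its class
    with a point of M^0; so the complements of the two matching sets match as well.\<close>
  have FM1: "F ` ({0<..<1} \<times> L) = chain_proj M ` manifold_M1 M"
  proof (intro equalityI subsetI)
    fix z assume "z \<in> F ` ({0<..<1} \<times> L)"
    then obtain p where p: "p \<in> {0<..<1} \<times> L" "z = F p" by blast
    then have "z \<in> chain_proj M ` topspace M" using tF inn by blast
    then obtain x where x: "x \<in> topspace M" "z = chain_proj M x" by blast
    have "x \<notin> manifold_M0 M"
    proof
      assume "x \<in> manifold_M0 M"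
      then obtain q where q: "q \<in> graph_ends L P" "F p = F q" using Fends x(2) p(2) by (metis imageE imageI)
      then have "p = q" using Finner[OF p(1)] ends by blast
      then show False using p(1) q(1) inn by blast
    qed
    then show "z \<in> chain_proj M ` manifold_M1 M" using x M01 by blast
  next
    fix z assume "z \<in> chain_proj M ` manifold_M1 M"
    then obtain x where x: "x \<in> manifold_M1 M" "z = chain_proj M x" by blast
    then have "z \<in> F ` graph_cells L P" using tF M01 by blast
    then obtain p where p: "p \<in> graph_cells L P" "z = F p" by blast
    have "p \<notin> graph_ends L P"
    proof
      assume "p \<in> graph_ends L P"
      then have "z \<in> chain_proj M ` manifold_M0 M" using Fends p(2) by blast
      then obtain y where y: "y \<in> manifold_M0 M" "chain_proj M x = chain_proj M y" using x(2) by blast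
      then have "x = y" using chain_proj_M1_eq[OF x(1)] M0_subset_topspace[of M] by blast
      then show False using x(1) y(1) M01 by blast
    qed
    then show "z \<in> F ` ({0<..<1} \<times> L)" using p inn by blast
  qed
  \<comment> \<open>Local finiteness is not yet available here, so openness comes from the graph:
    the inner cells form an open set saturated for F.\<close>
  have M1open: "openin M (manifold_M1 M)"
  proof -
    have "{p \<in> graph_cells L P. F p \<in> F ` ({0<..<1} \<times> L)} = {0<..<1} \<times> L"
    proof (intro equalityI subsetI)
      fix q assume "q \<in> {p \<in> graph_cells L P. F p \<in> F ` ({0<..<1} \<times> L)}"
      then obtain p where "q \<in> graph_cells L P" "p \<in> {0<..<1} \<times> L" "F p = F q" by force
      then show "q \<in> {0<..<1} \<times> L" using Finner by metis
    qed (use inn in blast)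
    moreover have "openin (cell_space L P) ({0<..<1} \<times> L)"
      unfolding openin_cell_space
    proof (intro conjI allI impI)
      fix t l assume "(t, l) \<in> {0<..<1::real} \<times> L"
      then show "\<exists>d>0. \<forall>s. \<bar>s - t\<bar> < d \<and> (s, l) \<in> graph_cells L P \<longrightarrow> (s, l) \<in> {0<..<1} \<times> L"
        by (intro exI[of _ "min t (1 - t)"]) auto
    qed (use inn in blast)
    ultimately have "openin (chain_quotient M) (F ` ({0<..<1} \<times> L))"
      using Fopen[of "{0<..<1} \<times> L"] inn by auto
    then have "openin M {x \<in> topspace M. chain_proj M x \<in> F ` ({0<..<1} \<times> L)}"
      by (simp add: openin_chain_quotient)
    moreover have "{x \<in> topspace M. chain_proj M x \<in> F ` ({0<..<1} \<times> L)} = manifold_M1 M"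
      unfolding FM1
    proof (intro equalityI subsetI)
      fix x assume "x \<in> {x \<in> topspace M. chain_proj M x \<in> chain_proj M ` manifold_M1 M}"
      then obtain y where "x \<in> topspace M" "y \<in> manifold_M1 M" "chain_proj M y = chain_proj M x" by force
      then show "x \<in> manifold_M1 M" using chain_proj_M1_eq by metis
    qed (use M01 in auto)
    ultimately show ?thesis by simp
  qed
  have H: "homeomorphic_map (subtopology M (manifold_M1 M))
           (subtopology (chain_quotient M) (chain_proj M ` manifold_M1 M)) (chain_proj M)"
    by (rule homeomorphic_map_chain_proj_M1[OF M1open])
  \<comment> \<open>A continuous section of the projection over the open edges, used to lift them to
    M.\<close>
  then obtain \<rho> where \<rho>: "homeomorphic_maps (subtopology M (manifold_M1 M))
           (subtopology (chain_quotient M) (chain_proj M ` manifold_M1 M)) (chain_proj M) \<rho>"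
    using homeomorphic_map_maps by blast
  have \<rho>c: "continuous_map (subtopology (chain_quotient M) (chain_proj M ` manifold_M1 M))
      (subtopology M (manifold_M1 M)) \<rho>"
    using \<rho> by (simp add: homeomorphic_maps_def)
  have \<rho>p: "chain_proj M (\<rho> z) = z" if "z \<in> chain_proj M ` manifold_M1 M" for z
  proof -
    have "z \<in> topspace (subtopology (chain_quotient M) (chain_proj M ` manifold_M1 M))"
      using that M01 by (auto simp: topspace_chain_quotient)
    then show ?thesis using \<rho> unfolding homeomorphic_maps_def by blast
  qed
  have injM1: "inj_on (chain_proj M) (manifold_M1 M)"
    using chain_proj_M1_eq M01 by (metis inj_onI)
  have LL: "locally_line (subtopology M (manifold_M1 M))"
    by (rule locally_line_interior[OF M M1open]) (auto simp: manifold_M1_def manifold_M0_def)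
  \<comment> \<open>The open edge l as a path in M; parameter 0 is its midpoint, since
    \<open>logistic 0\<close> is 1/2.\<close>
  define f where "f l u = \<rho> (F (logistic u, l))" for l u
  have inl: "(logistic u, l) \<in> {0<..<1} \<times> L" if "l \<in> L" for l u
    using that logistic_bounds[of u] by simp
  have pf: "chain_proj M (f l u) = F (logistic u, l)" if "l \<in> L" for l u
    unfolding f_def by (rule \<rho>p) (use inl[OF that] FM1 in blast)
  have farc: "open_arc M (f l)" and fM1: "range (f l) \<subseteq> manifold_M1 M" if l: "l \<in> L" for l
  proof -
    have "continuous_map euclideanreal (cell_space L P) (\<lambda>u. (logistic u, l))"
      unfolding continuous_map_in_subtopology
    proof
      show "continuous_map euclideanreal (prod_topology euclideanreal (discrete_topology L)) (\<lambda>u. (logistic u, l))"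
        by (intro continuous_map_pairedI) (use l continuous_on_logistic in auto)
      show "(\<lambda>u. (logistic u, l)) \<in> topspace euclideanreal \<rightarrow> graph_cells L P"
        using inl[OF l] inn by blast
    qed
    then have "continuous_map euclideanreal (chain_quotient M) (F \<circ> (\<lambda>u. (logistic u, l)))"
      by (rule continuous_map_compose[OF _ quotient_imp_continuous_map[OF F]])
    then have "continuous_map euclideanreal (subtopology (chain_quotient M) (chain_proj M ` manifold_M1 M))
        (F \<circ> (\<lambda>u. (logistic u, l)))"
    proof -
      assume c: "continuous_map euclideanreal (chain_quotient M) (F \<circ> (\<lambda>u. (logistic u, l)))"
      have "F (logistic u, l) \<in> chain_proj M ` manifold_M1 M" for u
        using inl[OF l] FM1 by blast
      then show ?thesis using c by (simp add: continuous_map_in_subtopology)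
    qed
    then have "continuous_map euclideanreal (subtopology M (manifold_M1 M)) (\<rho> \<circ> (F \<circ> (\<lambda>u. (logistic u, l))))"
      by (rule continuous_map_compose[OF _ \<rho>c])
    then have c: "continuous_map euclideanreal (subtopology M (manifold_M1 M)) (f l)"
      by (simp add: f_def[abs_def] o_def)
    have "inj (f l)"
    proof (rule injI)
      fix u v assume "f l u = f l v"
      then have "F (logistic u, l) = F (logistic v, l)" using pf[OF l] by metis
      then have "(logistic u, l) = (logistic v, l)"
        by (rule Finner[OF inl[OF l], rotated]) (use inl[OF l] inn in blast)
      then show "u = v" using logit_logistic by (metis fst_conv)
    qed
    then have a: "open_arc (subtopology M (manifold_M1 M)) (f l)" by (rule open_arcI[OF LL c])
    show fM1: "range (f l) \<subseteq> manifold_M1 M"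
      using c by (auto simp: continuous_map_in_subtopology)
    show "open_arc M (f l)" using a open_arc_subtopology[OF M1open fM1] by blast
  qed
  \<comment> \<open>Compatibility equates the open edges with the components of the projected M^1;
    injectivity of the projection on M^1 pulls this back to M.\<close>
  have comp: "\<exists>l\<in>L. C = range (f l)"
    if C: "C \<in> connected_components_of (subtopology M (manifold_M1 M))" for C
  proof -
    have "chain_proj M ` C \<in> (\<lambda>e. h ` e) ` graph_edges L r"
      unfolding he homeomorphic_map_connected_components_of[OF H] using C by blast
    then obtain l where l: "l \<in> L" "chain_proj M ` C = h ` quotient_proj (graph_rel L r) ` ({0<..<1} \<times> {l})"
      by (auto simp: graph_edges_def)
    have lr: "range logistic = {0<..<1}"
    proof (intro equalityI subsetI)
      fix t :: real assume "t \<in> {0<..<1}"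
      then have "t = logistic (logit t)" by (simp add: logistic_logit)
      then show "t \<in> range logistic" by blast
    qed (use logistic_bounds in auto)
    have "chain_proj M ` C = F ` ({0<..<1} \<times> {l})" using l(2) by (simp add: F_def image_comp)
    also have "{0<..<1} \<times> {l} = (\<lambda>u. (logistic u, l)) ` UNIV" using lr by auto
    also have "F ` \<dots> = chain_proj M ` range (f l)"
      unfolding image_image by (rule image_cong[OF refl]) (simp add: pf[OF l(1)])
    finally have "chain_proj M ` C = chain_proj M ` range (f l)" .
    moreover have "C \<subseteq> manifold_M1 M" using connected_components_of_subset[OF C] by simp
    ultimately have "C = range (f l)"
      using inj_on_image_eq_iff[OF injM1 _ fM1[OF l(1)]] by metis
    then show ?thesis using l(1) by blast
  qed
  \<comment> \<open>One inner point per edge: a closed, saturated set of cells. Its complement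
    therefore gives an open set \<open>avoid\<close> of M that contains M^0 but contains no edge
    entirely.\<close>
  define mid where "mid = {1/2::real} \<times> L"
  define avoid where "avoid = {x \<in> topspace M. chain_proj M x \<in> F ` (graph_cells L P - mid)}"
  have mid: "mid \<subseteq> {0<..<1} \<times> L" by (auto simp: mid_def)
  have Omid: "F p \<notin> F ` (graph_cells L P - mid)" if "p \<in> mid" for p
  proof
    assume "F p \<in> F ` (graph_cells L P - mid)"
    then obtain q where q: "q \<in> graph_cells L P" "q \<notin> mid" "F p = F q" by blast
    then have "p = q" using Finner mid that by blast
    then show False using q that by blast
  qed
  have "openin M avoid"
  proof -
    have "{p \<in> graph_cells L P. F p \<in> F ` (graph_cells L P - mid)} = graph_cells L P - mid"
      using Omid by auto
    moreover have "openin (cell_space L P) (graph_cells L P - mid)"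
      unfolding openin_cell_space
    proof (intro conjI allI impI)
      fix t l assume a: "(t, l) \<in> graph_cells L P - mid"
      then have "t \<noteq> 1/2" by (auto simp: mid_def graph_cells_def)
      then show "\<exists>d>0. \<forall>s. \<bar>s - t\<bar> < d \<and> (s, l) \<in> graph_cells L P \<longrightarrow> (s, l) \<in> graph_cells L P - mid"
        by (intro exI[of _ "\<bar>t - 1/2\<bar>"]) (auto simp: mid_def)
    qed auto
    ultimately have "openin (chain_quotient M) (F ` (graph_cells L P - mid))"
      by (intro Fopen) auto
    then show ?thesis unfolding avoid_def by (simp add: openin_chain_quotient)
  qed
  have fO: "f l 0 \<notin> avoid" if "l \<in> L" for l
  proof -
    have "(logistic 0, l) \<in> mid" using that by (simp add: mid_def logistic_def)
    then show ?thesis using Omid pf[OF that, of 0] by (simp add: avoid_def)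
  qed
  have M0O: "x \<in> avoid" if x: "x \<in> manifold_M0 M" for x
  proof -
    have "chain_proj M x \<in> F ` graph_ends L P" using Fends x by blast
    moreover have "graph_ends L P \<subseteq> graph_cells L P - mid" using mid inn ends by blast
    ultimately show ?thesis using x M0_subset_topspace[of M] by (auto simp: avoid_def)
  qed
  have nd: "M interior_of (M closure_of branch_points M) = {}"
    using G2 by (simp add: condition_G2_def nowhere_dense_in_def)
  have ev: "\<forall>\<^sub>F t in at_right 0. g t \<in> manifold_M1 M"
    if x: "x \<in> topspace M" and G: "half_arcs M x G" and g: "g \<in> G" for x G g
  proof (cases "x \<in> manifold_M0 M")
    case False
    then have "x \<in> manifold_M1 M" using x M01 by blast
    then show ?thesis using half_arc_limit[OF G g] M1open unfolding limitin_def by blast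
  next
    case True
    have gc: "continuous_map (top_of_set {0..<1}) M g" and gi: "inj_on g {0..<1}"
      and go: "open_map (top_of_set {0<..<1}) M g"
      using G g by (auto simp: half_arcs_def)
    have gt: "g t \<in> topspace M" if "0 \<le> t" "t < 1" for t
      using continuous_map_image_subset_topspace[OF gc] that by auto
    have "\<forall>\<^sub>F t in at_right 0. g t \<in> avoid"
      using half_arc_limit[OF G g] \<open>openin M avoid\<close> M0O[OF True] by (simp add: limitin_def)
    then obtain d where d: "d > 0" "\<And>t. 0 < t \<Longrightarrow> t < d \<Longrightarrow> g t \<in> avoid"
      unfolding eventually_at_right_field by blast
    \<comment> \<open>If the half arc left M^1 at arbitrarily small parameters, it would run through
      a whole edge between two of them and meet a midpoint, although it stays in
      \<open>avoid\<close>.\<close>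
    show ?thesis
    proof (rule ccontr)
      assume n: "\<not> ?thesis"
      have out: "\<exists>t. 0 < t \<and> t < e \<and> g t \<notin> manifold_M1 M" if "0 < e" for e
        using n that unfolding eventually_at_right_field by blast
      obtain p where p: "0 < p" "p < min d 1" "g p \<notin> manifold_M1 M" using out[of "min d 1"] d(1) by auto
      obtain t where t: "0 < t" "t < p" "g t \<notin> manifold_M1 M" using out p by blast
      have "{t<..<p} \<subseteq> {0<..<1}" using t p by auto
      then have "openin (top_of_set {0<..<1}) {t<..<p}" by (simp add: openin_open_eq)
      then have gto: "openin M (g ` {t<..<p})" using go unfolding open_map_def by blast
      \<comment> \<open>Nowhere density at work: the image of (t, p) is open, so it contains a point
        that is not a branch point. Such a point lies in M^1, as half arcs avoid the boundary at
        positive parameters.\<close>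
      have "\<not> g ` {t<..<p} \<subseteq> M closure_of branch_points M"
      proof
        assume "g ` {t<..<p} \<subseteq> M closure_of branch_points M"
        then have "g ` {t<..<p} \<subseteq> M interior_of (M closure_of branch_points M)"
          using gto by (rule interior_of_maximal)
        then show False using nd t(2) by simp
      qed
      moreover have "branch_points M \<subseteq> M closure_of branch_points M"
        using M0_subset_topspace[of M] by (intro closure_of_subset) (auto simp: manifold_M0_def)
      ultimately have "\<not> g ` {t<..<p} \<subseteq> branch_points M" by (metis order_trans)
      then obtain z where z: "z \<in> g ` {t<..<p}" "z \<notin> branch_points M" by blast
      then obtain q where "q \<in> {t<..<p}" "z = g q" by (elim imageE)
      then have q: "t < q" "q < p" "g q \<notin> branch_points M" using z(2) by simp_all
      have "g q \<notin> manifold_boundary M" using half_arc_avoids_boundary[OF G g, of q] q t p by simp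
      then have gq: "g q \<in> manifold_M1 M" using q gt[of q] t p by (simp add: manifold_M1_def manifold_M0_def)
      define A where "A = {s \<in> {0<..<1}. g s \<in> manifold_M1 M}"
      have gc': "continuous_map (top_of_set {0<..<1}) M g"
        by (rule continuous_map_from_subtopology_mono[OF gc]) auto
      have "openin (top_of_set {0<..<1}) {s \<in> topspace (top_of_set {0<..<1}). g s \<in> manifold_M1 M}"
        by (rule openin_continuous_map_preimage[OF gc' M1open])
      then have A: "open A" by (simp add: A_def openin_open_eq)
      \<comment> \<open>The maximal parameter interval around q inside M^1. Its ends map outside M^1
        and so are inseparable from no point of the edge, as \<open>arc_between_ends\<close>
        requires.\<close>
      obtain a b where ab: "t \<le> a" "a < q" "q < b" "b \<le> p" "a \<notin> A" "b \<notin> A" "{a<..<b} \<subseteq> A"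
        by (rule open_real_component[OF A q(1,2)]) (use t p q gq in \<open>auto simp: A_def\<close>)
      have gab: "g ` {a<..<b} \<subseteq> manifold_M1 M" using ab(7) by (auto simp: A_def)
      have "continuous_map (top_of_set {a<..<b}) M g"
        by (rule continuous_map_from_subtopology_mono[OF gc]) (use ab t p in auto)
      then have gcab: "continuous_map (top_of_set {a<..<b}) (subtopology M (manifold_M1 M)) g"
        using gab by (auto simp: continuous_map_in_subtopology)
      have "connectedin (top_of_set {a<..<b}) {a<..<b}"
        by (simp add: connectedin_def subtopology_subtopology)
      then have conn: "connectedin (subtopology M (manifold_M1 M)) (g ` {a<..<b})"
        by (rule connectedin_continuous_map_image[OF gcab])
      have "g q \<in> \<Union>(connected_components_of (subtopology M (manifold_M1 M)))"
        unfolding Union_connected_components_of using gq M01 by simp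
      then obtain C where C: "C \<in> connected_components_of (subtopology M (manifold_M1 M))" "g q \<in> C"
        by (rule UnionE)
      have "\<not> disjnt C (g ` {a<..<b})" using C(2) ab by (auto simp: disjnt_iff)
      then have sub: "g ` {a<..<b} \<subseteq> C" using connected_components_of_maximal[OF C(1) conn] by blast
      obtain l where l: "l \<in> L" "C = range (f l)" using comp[OF C(1)] by blast
      have sep: "\<not> inseparable M (f l u) z" if "z \<notin> manifold_M1 M" for u z
      proof
        assume i: "inseparable M (f l u) z"
        have fu: "f l u \<in> manifold_M1 M" using fM1[OF l(1)] by blast
        then have "f l u \<notin> branch_points M" by (simp add: manifold_M1_def manifold_M0_def)
        then show False using nonbranch_inseparable i fu that by metis
      qed
      have "g ` {a<..<b} = range (f l)"
      proof (rule arc_between_ends[OF farc[OF l(1)]])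
        show "a < b" using ab by linarith
        show "continuous_map (top_of_set {a..b}) M g"
          by (rule continuous_map_from_subtopology_mono[OF gc]) (use ab t p in auto)
        show "inj_on g {a<..<b}" by (rule inj_on_subset[OF gi]) (use ab t p in auto)
        show "g ` {a<..<b} \<subseteq> range (f l)" using sub l(2) by simp
        show "\<not> inseparable M (f l u) (g a)" for u
          by (rule sep) (use ab t p in \<open>auto simp: A_def\<close>)
        show "\<not> inseparable M (f l u) (g b)" for u
          by (rule sep) (use ab t p in \<open>auto simp: A_def\<close>)
      qed
      then obtain s where "s \<in> {a<..<b}" "f l 0 = g s" by (metis imageE rangeI)
      then have "f l 0 \<in> avoid" using d(2)[of s] ab t p by auto
      then show False using fO[OF l(1)] by blast
    qed
  qed
  have "locally_finite_subset M (branch_points M)"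
    unfolding locally_finite_subset_def
  proof (intro conjI ballI)
    show "branch_points M \<subseteq> topspace M"
      using M0_subset_topspace[of M] by (auto simp: manifold_M0_def)
    fix x assume x: "x \<in> topspace M"
    obtain G where G: "half_arcs M x G" using half_arcs_exist[OF M x] by blast
    have "\<forall>\<^sub>F t in at_right 0. g t \<in> insert x (manifold_M1 M)" if "g \<in> G" for g
      using ev[OF x G that] by eventually_elim simp
    then obtain W where W: "openin M W" "x \<in> W" "W \<subseteq> insert x (manifold_M1 M)"
      using half_arcs_neighbourhood[OF G, of "insert x (manifold_M1 M)"] by blast
    have "W \<inter> branch_points M \<subseteq> {x}" using W(3) by (auto simp: manifold_M1_def manifold_M0_def)
    then have "finite (W \<inter> branch_points M)" by (rule finite_subset) simp
    then show "\<exists>U. openin M U \<and> x \<in> U \<and> finite (U \<inter> branch_points M)" using W by blast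
  qed
  moreover have "has_countable_base (subtopology M C)"
    if "C \<in> connected_components_of (subtopology M (manifold_M1 M))" for C
    using comp[OF that] farc open_arc_second_countable by blast
  ultimately show ?thesis by (simp add: condition_G1_def)
qed

section \<open>Hausdorff quotient and universal property\<close>

lemma Hausdorff_chain_quotient:
  assumes "condition_G2 M"
  shows "Hausdorff_space (chain_quotient M)"
proof -
  obtain L :: "'a set set" and P r h where "compatible_structure M L P r h"
    using assms by (auto simp: condition_G2_def has_compatible_graph_structure_def)
  then have "graph_data L P r" "homeomorphic_map (topological_graph L P r) (chain_quotient M) h"
    by (auto simp: compatible_structure_def graph_structure_def)
  then show ?thesis
    using Hausdorff_topological_graph homeomorphic_Hausdorff_space homeomorphic_map_imp_homeomorphic_space by metis
qed

text \<open>Disjoint neighbourhoods of f x and f y pull back to disjoint neighbourhoods of x and y,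
  so f agrees on inseparable points and then along chains. The \<open>extensional\<close> clause
  fixes the values off the quotient, which makes uniqueness an equality of total functions.\<close>

lemma continuous_map_factors_through_chain_quotient:
  assumes N: "Hausdorff_space N" and f: "continuous_map M N f"
  shows "\<exists>!g. g \<in> extensional (topspace (chain_quotient M)) \<and> continuous_map (chain_quotient M) N g \<and>
    (\<forall>x\<in>topspace M. f x = g (chain_proj M x))"
proof -
  have ins: "f x = f y" if "inseparable M x y" for x y
  proof (rule ccontr)
    assume ne: "f x \<noteq> f y"
    have xy: "x \<in> topspace M" "y \<in> topspace M" using that by (auto simp: inseparable_def)
    then have "f x \<in> topspace N" "f y \<in> topspace N"
      using continuous_map_image_subset_topspace[OF f] by auto
    then obtain U V where UV: "openin N U" "openin N V" "f x \<in> U" "f y \<in> V" "disjnt U V"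
      using N ne unfolding Hausdorff_space_def by metis
    have "openin M {z \<in> topspace M. f z \<in> U}" "openin M {z \<in> topspace M. f z \<in> V}"
      using openin_continuous_map_preimage[OF f] UV by auto
    then have "{z \<in> topspace M. f z \<in> U} \<inter> {z \<in> topspace M. f z \<in> V} \<noteq> {}"
      using that xy UV unfolding inseparable_def by blast
    then show False using UV(5) by (auto simp: disjnt_iff)
  qed
  have resp: "f x = f y" if "x \<in> topspace M" "y \<in> topspace M" "chain_proj M x = chain_proj M y" for x y
  proof -
    have "(inseparable M)\<^sup>*\<^sup>* x y"
      using that by (simp add: chain_proj_eq_iff chain_inseparable_def)
    then show ?thesis by (induction rule: rtranclp_induct) (use ins in metis)+
  qed
  obtain g where g: "continuous_map (chain_quotient M) N g" "\<And>x. x \<in> topspace M \<Longrightarrow> g (chain_proj M x) = f x"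
  proof (rule quotient_map_lift_exists[OF quotient_map_chain_proj f resp])
    fix g assume "continuous_map (chain_quotient M) N g" "\<And>x. x \<in> topspace M \<Longrightarrow> g (chain_proj M x) = f x"
    then show thesis by (rule that)
  qed
  show ?thesis
  proof (rule ex1I)
    let ?g = "restrict g (topspace (chain_quotient M))"
    show "?g \<in> extensional (topspace (chain_quotient M)) \<and> continuous_map (chain_quotient M) N ?g \<and>
      (\<forall>x\<in>topspace M. f x = ?g (chain_proj M x))"
    proof (intro conjI ballI)
      show "continuous_map (chain_quotient M) N ?g" using g(1) by (rule continuous_map_eq) simp
      fix x assume "x \<in> topspace M"
      then show "f x = ?g (chain_proj M x)" using g(2) by (simp add: topspace_chain_quotient)
    qed simp
    fix k assume k: "k \<in> extensional (topspace (chain_quotient M)) \<and> continuous_map (chain_quotient M) N k \<and>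
      (\<forall>x\<in>topspace M. f x = k (chain_proj M x))"
    show "k = ?g"
    proof (rule extensionalityI)
      fix z assume "z \<in> topspace (chain_quotient M)"
      then obtain x where "x \<in> topspace M" "z = chain_proj M x" by (auto simp: topspace_chain_quotient)
      then show "k z = ?g z" using k g(2) by (simp add: topspace_chain_quotient)
    qed (use k in auto)
  qed
qed

theorem theorem1p1p1:
  fixes M :: "'a topology"
  assumes "one_manifold M" and "connected_space M"
    and "\<not> M homeomorphic_space top_of_set (sphere (0::complex) 1)"
  shows "(condition_G1 M \<longleftrightarrow> condition_G2 M) \<and>
    (condition_G1 M \<longrightarrow>
       Hausdorff_space (chain_quotient M) \<and>
       (\<forall>(N :: 'c topology) f. Hausdorff_space N \<and> continuous_map M N f \<longrightarrow>
          (\<exists>!g. g \<in> extensional (topspace (chain_quotient M)) \<and>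
                continuous_map (chain_quotient M) N g \<and>
                (\<forall>x\<in>topspace M. f x = g (chain_proj M x)))))"
proof -
  have iff: "condition_G1 M \<longleftrightarrow> condition_G2 M"
    using condition_G1_imp_G2[OF assms] condition_G2_imp_G1[OF assms(1)] by blast
  show ?thesis
  proof (intro conjI impI allI)
    assume "condition_G1 M"
    then show "Hausdorff_space (chain_quotient M)" using iff Hausdorff_chain_quotient by blast
  next
    fix N :: "'c topology" and f
    assume "Hausdorff_space N \<and> continuous_map M N f"
    then show "\<exists>!g. g \<in> extensional (topspace (chain_quotient M)) \<and>
                continuous_map (chain_quotient M) N g \<and>
                (\<forall>x\<in>topspace M. f x = g (chain_proj M x))"
      using continuous_map_factors_through_chain_quotient by blast
  qed (rule iff)
qed

end
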